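(* Let $S_{\rm inv}=\int_{\mathcal V}L_{\rm inv}(\zeta_I,\psi_I)\,d^Dx$ be an integral invariant under a group of local transformations which is an internal gauge group or the group of diffeomorphisms in a metric theory, and let the fields $\zeta_I$ be, respectively, the gauge connection $A_\mu^a$ or the metric $g_{\mu\nu}$. Suppose that the action $S$ of a physical theory is related to $S_{\rm inv}$ according to one of the following conditions: 1. $S=S_{\rm inv}[\zeta_I,\psi_I]$, with the fields $\psi_I$ being variables of the theory and the fields $\zeta_I$ being background fields, i.e. prescribed functions of spacetime, not variables. 2. All the fields are variables, and $S=S_{\rm inv}[\zeta_I,\psi_I]+S_{\rm g}[\zeta_I]$, the second term involving only the fields $\zeta_I$. 3. All the fields are variables, and $S=S_{\rm inv}[\psi_I,\zeta_I,\mathcal I_p(\zeta_I)]$, where the integrand contains combinations $\mathcal I_p$ of the fields $\zeta_I$ which are local invariant themselves. Then the covariant conservation laws $$\nabla_\mu j^\mu_a\approx0$$ hold, with $$j^\mu_a=\frac{\delta L_{\rm inv}}{\delta A_\mu^a}$$ in the case of gauge transformations, and $$j^\mu_\nu=-2g_{\nu\chi}\frac{\delta L_{\rm inv}}{\delta g_{\mu\chi}}$$ in the case of diffeomorphisms, where under condition 3 the derivatives with respect to $A_\mu^a$ or $g_{\mu\chi}$ are taken with the $\mathcal I_p$ held constant. Moreover, $\nabla_\mu j^\mu_a$ is not identically zero off-shell and $j^\mu_a$ is not identically zero on-shell.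
   Context: The symbol $=$ means equality off-shell (for all field configurations); $\approx$ means equality on-shell, i.e. when the equations of motion $\delta L/\delta\phi\approx0$ hold for every variable field $\phi$ of the theory with action $S=\int_{\mathcal V}L\,d^Dx$ (background fields have no equations of motion). Repeated indices are summed. $\mathcal V$ is a $D$-dimensional subset of a smooth manifold $\mathcal M$. Lagrangian densities are local (depending on fields and their derivatives up to a finite order $n$), and $\delta\mathcal L/\delta\phi_I=\sum_{i=0}^{n}(-1)^i\partial_{\mu_i}\cdots\partial_{\mu_1}\frac{\partial\mathcal L}{\partial(\partial_{\mu_i}\cdots\partial_{\mu_1}\phi_I)}$ is the Euler-Lagrange derivative (index strings numbered from right to left, empty for $i=0$). All fields $\phi_I$ (the $\zeta_I$ and the $\psi_I$, both sets non-empty) transform infinitesimally as $\delta\phi_I=\sum_{i=0}^{m}f_{Ia}^{\mu_i\ldots\mu_1}\partial_{\mu_i}\cdots\partial_{\mu_1}\varepsilon^a$, with $\varepsilon^a$ arbitrary functions on spacetime and $f_{Ia}^{\mu_i\ldots\mu_1}$ functions possibly depending on the fields and their derivatives. Invariance means $\delta S_{\rm inv}=0$, or at most a boundary term, under the simultaneous transformation of the $\zeta_I$ and $\psi_I$. "Local invariant" means $\delta\mathcal I_p=0$ under the transformations. Gauge and metric theories share the same notation. In the gauge case, $\varepsilon^a$ are the coordinates of a Lie algebra element in the adjoint representation, $\nabla_\mu$ is the covariant derivative with respect to the gauge connection, and the connection transforms as $$\delta A_\mu^a=\partial_\mu\varepsilon^a+g_{\rm YM}C_{abc}A_\mu^b\varepsilon^c=\nabla_\mu\varepsilon^a,$$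 with $g_{\rm YM}$ the coupling constant and $C_{abc}$ the structure constants of the gauge group; on the current, $\nabla_\mu j^\mu_a=\partial_\mu j^\mu_a+g_{\rm YM}C_{abc}A_\mu^bj^\mu_c$. In the diffeomorphism case, the index $a$ is a spacetime index, $\varepsilon^\mu$ are the components of the vector field generating the diffeomorphism, $\nabla_\mu$ is the covariant derivative of the Levi-Civita connection of $g_{\mu\nu}$ (acting on $j^\mu_\nu$ as a tensor density of weight 1), and the metric transforms by $$\delta g_{\mu\nu}=-\mathcal L_\varepsilon g_{\mu\nu}=-g_{\mu\chi}\nabla_\nu\varepsilon^\chi-g_{\nu\chi}\nabla_\mu\varepsilon^\chi,$$ where $\mathcal L_\varepsilon$ is the Lie derivative.
   Formalization: "Not identically zero" fails for some theories (neutral ψ; S_g = 0; constant I_p), so it is proved conditionally (ψ-only invariance fails; S_g or I_p contribute) and by examples, save for j on-shell under condition 3 for diffeomorphisms or D = 1, where j vanishes. *)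

theory Defs
  imports "HOL-Analysis.Analysis"
begin

section \<open>Partial derivatives on spacetime\<close>

text \<open>Spacetime is described in a coordinate chart: the integration domain is an open set
  \<open>V\<close> of \<open>real^'d\<close>, so that the dimension is \<open>D = CARD('d)\<close>. Index strings are lists; the list
  \<open>[m\<^sub>i, \<dots>, m\<^sub>1]\<close> stands for the operator with outermost derivative \<open>m\<^sub>i\<close>.\<close>

type_synonym 'd scalar = "real ^ 'd \<Rightarrow> real"

definition pd :: "'d::finite \<Rightarrow> 'd scalar \<Rightarrow> 'd scalar" where
  "pd \<mu> f x = deriv (\<lambda>t. f (x + t *\<^sub>R axis \<mu> 1)) 0"

fun pds :: "'d::finite list \<Rightarrow> 'd scalar \<Rightarrow> 'd scalar" where
  "pds [] f = f"
| "pds (\<mu> # s) f = pd \<mu> (pds s f)"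

definition smooth_on :: "(real ^ 'd::finite) set \<Rightarrow> 'd scalar \<Rightarrow> bool" where
  "smooth_on V f \<longleftrightarrow> (\<forall>s. pds s f differentiable_on V)"


section \<open>Jets and local functions\<close>

text \<open>A jet is an assignment of values to the variables a local function may depend on.
  \<open>Zeta z s\<close> and \<open>Psi k s\<close> are the derivatives with index string \<open>s\<close> of the components of the
  fields \<open>\<zeta>\<close> and \<open>\<psi>\<close>. \<open>Inv p\<close> is a slot for the value of a combination \<open>I\<^sub>p\<close> of
  the fields \<open>\<zeta>\<close>; a derivative of a local invariant is again a local invariant, so slots for
  derivatives of \<open>I\<^sub>p\<close> are not needed. As in the formula for the Euler-Lagrange derivative, which
  sums over all index strings, permuted strings are separate variables. The components of \<open>\<psi>\<close>
  are numbered, only finitely many numbers being used by a theory.\<close>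

datatype ('z, 'd) jvar = Zeta 'z "'d list" | Psi nat "'d list" | Inv nat

type_synonym ('z, 'd) jet = "('z, 'd) jvar \<Rightarrow> real"

type_synonym ('z, 'd) zfield = "'z \<Rightarrow> 'd scalar"
type_synonym 'd mfield = "nat \<Rightarrow> 'd scalar"
type_synonym ('a, 'd) param = "'a \<Rightarrow> 'd scalar"

definition jet :: "('z, 'd::finite) zfield \<Rightarrow> 'd mfield \<Rightarrow> real ^ 'd \<Rightarrow> ('z, 'd) jet" where
  "jet \<zeta> \<psi> x v = (case v of Zeta z s \<Rightarrow> pds s (\<zeta> z) x | Psi k s \<Rightarrow> pds s (\<psi> k) x | Inv p \<Rightarrow> 0)"

definition jpd :: "('z, 'd) jvar \<Rightarrow> (('z, 'd) jet \<Rightarrow> real) \<Rightarrow> ('z, 'd) jet \<Rightarrow> real" where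
  "jpd v F u = deriv (\<lambda>r. F (u(v := r))) (u v)"

definition jvars :: "nat \<Rightarrow> nat \<Rightarrow> nat \<Rightarrow> ('z, 'd) jvar set" where
  "jvars N Q n = {Zeta z s | z s. length s \<le> n}
     \<union> {Psi k s | k s. k < N \<and> length s \<le> n} \<union> {Inv p | p. p < Q}"

definition depends_only_on :: "('z, 'd) jvar set \<Rightarrow> (('z, 'd) jet \<Rightarrow> real) \<Rightarrow> bool" where
  "depends_only_on X F \<longleftrightarrow> (\<forall>u w. (\<forall>v\<in>X. u v = w v) \<longrightarrow> F u = F w)"

text \<open>Infinite differentiability in the jet variables on the open set \<open>U\<close>: all iterated partial
  derivatives exist and are continuous. Functions of jets carry the product topology; as only
  finitely many variables matter below, this is the usual notion in finitely many variables.\<close>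

definition smooth_jet_function :: "('z, 'd) jet set \<Rightarrow> (('z, 'd) jet \<Rightarrow> real) \<Rightarrow> bool" where
  "smooth_jet_function U F \<longleftrightarrow> (\<forall>vs. continuous_on U (foldr jpd vs F) \<and>
     (\<forall>u\<in>U. \<forall>v. (\<lambda>r. foldr jpd vs F (u(v := r))) differentiable (at (u v))))"

definition local_function ::
    "('z, 'd) jet set \<Rightarrow> nat \<Rightarrow> nat \<Rightarrow> nat \<Rightarrow> (('z, 'd) jet \<Rightarrow> real) \<Rightarrow> bool" where
  "local_function U N Q n F \<longleftrightarrow> depends_only_on (jvars N Q n) F \<and> smooth_jet_function U F"

text \<open>The variation of \<open>F\<close>, to first order in the variations of the fields.\<close>

definition variation :: "(('z, 'd::finite) jet \<Rightarrow> real) \<Rightarrow> ('z, 'd) zfield \<Rightarrow> 'd mfield \<Rightarrow>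
    ('z, 'd) zfield \<Rightarrow> 'd mfield \<Rightarrow> 'd scalar" where
  "variation F \<zeta> \<psi> \<delta>\<zeta> \<delta>\<psi> x =
     deriv (\<lambda>t. F (jet (\<lambda>z y. \<zeta> z y + t * \<delta>\<zeta> z y) (\<lambda>k y. \<psi> k y + t * \<delta>\<psi> k y) x)) 0"

text \<open>Euler-Lagrange derivative of \<open>L\<close> (of order at most \<open>n\<close>) with respect to the field whose
  derivatives are the variables \<open>c s\<close>. The map \<open>\<Phi>\<close> gives the values of all variables at each point
  of spacetime: it is the jet of a field configuration, with the slots \<open>Inv p\<close> possibly filled.
  Filling the slots in \<open>\<Phi>\<close>, and not in \<open>L\<close>, means that the derivatives with respect to the
  variables \<open>c s\<close> are taken with the \<open>I\<^sub>p\<close> held constant.\<close>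

definition euler :: "nat \<Rightarrow> (('z, 'd::finite) jet \<Rightarrow> real) \<Rightarrow> ('d list \<Rightarrow> ('z, 'd) jvar) \<Rightarrow>
    (real ^ 'd \<Rightarrow> ('z, 'd) jet) \<Rightarrow> 'd scalar" where
  "euler n L c \<Phi> x = (\<Sum>s | length s \<le> n. (-1) ^ length s * pds s (\<lambda>y. jpd (c s) L (\<Phi> y)) x)"


section \<open>The fields \<open>\<zeta>\<close>: gauge connection or metric\<close>

text \<open>\<open>zeta_euler\<close> maps an order, a Lagrangian and a map \<open>\<Phi>\<close> as above to the components of the
  derivative with respect to \<open>\<zeta>\<close>; \<open>make_current\<close> maps \<open>\<zeta>\<close> and this derivative to the current;
  \<open>covdiv\<close> is the covariant divergence of a current. The commutator of two transformations with
  parameters \<open>\<epsilon>\<close>, \<open>\<eta>\<close> is the transformation with parameter \<open>bracket \<epsilon> \<eta>\<close>.\<close>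

record ('z, 'd, 'a) sector =
  admissible :: "('z, 'd) zfield \<Rightarrow> bool"
  jet_domain :: "('z, 'd) jet set"
  zeta_tr :: "('z, 'd) zfield \<Rightarrow> ('a, 'd) param \<Rightarrow> ('z, 'd) zfield"
  bracket :: "('a, 'd) param \<Rightarrow> ('a, 'd) param \<Rightarrow> ('a, 'd) param"
  zeta_euler :: "nat \<Rightarrow> (('z, 'd) jet \<Rightarrow> real) \<Rightarrow> (real ^ 'd \<Rightarrow> ('z, 'd) jet) \<Rightarrow> ('z, 'd) zfield"
  make_current :: "('z, 'd) zfield \<Rightarrow> ('z, 'd) zfield \<Rightarrow> 'd \<Rightarrow> 'a \<Rightarrow> 'd scalar"
  covdiv :: "('z, 'd) zfield \<Rightarrow> ('d \<Rightarrow> 'a \<Rightarrow> 'd scalar) \<Rightarrow> 'a \<Rightarrow> 'd scalar"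

text \<open>Total antisymmetry is implicit in the convention of writing all indices of \<open>C\<close> in the same
  position, with the same formula for the covariant derivative of parameters and of currents.\<close>

definition structure_constants :: "('a::finite \<Rightarrow> 'a \<Rightarrow> 'a \<Rightarrow> real) \<Rightarrow> bool" where
  "structure_constants C \<longleftrightarrow>
     (\<forall>a b c. C a b c = - C b a c) \<and> (\<forall>a b c. C a b c = - C a c b) \<and>
     (\<forall>a b c d. (\<Sum>e\<in>UNIV. C a b e * C e c d + C a c e * C e d b + C a d e * C e b c) = 0)"

text \<open>The component \<open>(\<mu>, a)\<close> of the connection is \<open>A\<^sub>\<mu>\<close> with Lie algebra index \<open>a\<close>.\<close>

definition gauge_sector ::
    "(real ^ 'd::finite) set \<Rightarrow> ('a::finite \<Rightarrow> 'a \<Rightarrow> 'a \<Rightarrow> real) \<Rightarrow> real \<Rightarrow> ('d \<times> 'a, 'd, 'a) sector" where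
  "gauge_sector V C g = \<lparr>
     admissible = (\<lambda>A. \<forall>z. smooth_on V (A z)),
     jet_domain = UNIV,
     zeta_tr = (\<lambda>A \<epsilon> (\<mu>, a) x.
       pd \<mu> (\<epsilon> a) x + g * (\<Sum>b\<in>UNIV. \<Sum>c\<in>UNIV. C a b c * A (\<mu>, b) x * \<epsilon> c x)),
     bracket = (\<lambda>\<epsilon> \<eta> a x. g * (\<Sum>b\<in>UNIV. \<Sum>c\<in>UNIV. C a b c * \<epsilon> b x * \<eta> c x)),
     zeta_euler = (\<lambda>n L \<Phi> z. euler n L (Zeta z) \<Phi>),
     make_current = (\<lambda>A E \<mu> a. E (\<mu>, a)),
     covdiv = (\<lambda>A j a x. \<Sum>\<mu>\<in>UNIV.
       pd \<mu> (j \<mu> a) x + g * (\<Sum>b\<in>UNIV. \<Sum>c\<in>UNIV. C a b c * A (\<mu>, b) x * j \<mu> c x)) \<rparr>"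

definition metric_matrix :: "('d \<times> 'd, 'd::finite) zfield \<Rightarrow> real ^ 'd \<Rightarrow> real ^ 'd ^ 'd" where
  "metric_matrix g x = (\<chi> \<mu> \<nu>. g (\<mu>, \<nu>) x)"

definition christoffel :: "('d \<times> 'd, 'd::finite) zfield \<Rightarrow> 'd \<Rightarrow> 'd \<Rightarrow> 'd \<Rightarrow> 'd scalar" where
  "christoffel g \<rho> \<mu> \<nu> x = 1/2 * (\<Sum>\<sigma>\<in>UNIV. matrix_inv (metric_matrix g x) $ \<rho> $ \<sigma> *
     (pd \<mu> (g (\<nu>, \<sigma>)) x + pd \<nu> (g (\<mu>, \<sigma>)) x - pd \<sigma> (g (\<mu>, \<nu>)) x))"

text \<open>\<open>\<nabla>\<^sub>\<kappa> j\<close> for a tensor density of weight 1 with upper index \<open>\<mu>\<close> and lower index \<open>\<nu>\<close>.\<close>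

definition covd_density :: "('d \<times> 'd, 'd::finite) zfield \<Rightarrow> ('d \<Rightarrow> 'd \<Rightarrow> 'd scalar) \<Rightarrow>
    'd \<Rightarrow> 'd \<Rightarrow> 'd \<Rightarrow> 'd scalar" where
  "covd_density g j \<kappa> \<mu> \<nu> x = pd \<kappa> (j \<mu> \<nu>) x
     + (\<Sum>\<rho>\<in>UNIV. christoffel g \<mu> \<kappa> \<rho> x * j \<rho> \<nu> x)
     - (\<Sum>\<rho>\<in>UNIV. christoffel g \<rho> \<kappa> \<nu> x * j \<mu> \<rho> x)
     - (\<Sum>\<rho>\<in>UNIV. christoffel g \<rho> \<rho> \<kappa> x) * j \<mu> \<nu> x"

definition lie_metric :: "('d \<times> 'd, 'd::finite) zfield \<Rightarrow> ('d, 'd) param \<Rightarrow> ('d \<times> 'd, 'd) zfield" where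
  "lie_metric g \<epsilon> = (\<lambda>(\<mu>, \<nu>) x. \<Sum>\<rho>\<in>UNIV. \<epsilon> \<rho> x * pd \<rho> (g (\<mu>, \<nu>)) x
     + g (\<rho>, \<nu>) x * pd \<mu> (\<epsilon> \<rho>) x + g (\<mu>, \<rho>) x * pd \<nu> (\<epsilon> \<rho>) x)"

text \<open>The components \<open>g (\<mu>, \<nu>)\<close> and \<open>g (\<nu>, \<mu>)\<close> are separate jet variables, but only symmetric
  metrics are field configurations. Hence the derivative with respect to the metric is
  symmetrized: this is the symmetric density \<open>E\<close> with \<open>\<delta>L = E\<^bsup>\<mu>\<nu>\<^esup> \<delta>g\<^bsub>\<mu>\<nu>\<^esub>\<close> up to a divergence, and it
  depends only on the values of the Lagrangian on symmetric metrics. For the same reason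
  nondegeneracy is imposed on the symmetric part in \<open>jet_domain\<close>, so that every smooth function
  of a symmetric nondegenerate metric and its derivatives has an extension smooth on
  \<open>jet_domain\<close>, composing with symmetrization. The signature is arbitrary.\<close>

definition metric_sector :: "(real ^ 'd::finite) set \<Rightarrow> ('d \<times> 'd, 'd, 'd) sector" where
  "metric_sector V = \<lparr>
     admissible = (\<lambda>g. (\<forall>z. smooth_on V (g z)) \<and>
       (\<forall>x\<in>V. transpose (metric_matrix g x) = metric_matrix g x \<and> det (metric_matrix g x) \<noteq> 0)),
     jet_domain =
       {u. det ((\<chi> \<mu> \<nu>. (u (Zeta (\<mu>, \<nu>) []) + u (Zeta (\<nu>, \<mu>) [])) / 2) :: real ^ 'd ^ 'd) \<noteq> 0},
     zeta_tr = (\<lambda>g \<epsilon> z x. - lie_metric g \<epsilon> z x),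
     bracket = (\<lambda>\<epsilon> \<eta> \<mu> x. \<Sum>\<nu>\<in>UNIV. \<epsilon> \<nu> x * pd \<nu> (\<eta> \<mu>) x - \<eta> \<nu> x * pd \<nu> (\<epsilon> \<mu>) x),
     zeta_euler = (\<lambda>n L \<Phi> (\<mu>, \<nu>) x. (euler n L (Zeta (\<mu>, \<nu>)) \<Phi> x + euler n L (Zeta (\<nu>, \<mu>)) \<Phi> x) / 2),
     make_current = (\<lambda>g E \<mu> \<nu> x. - 2 * (\<Sum>\<rho>\<in>UNIV. g (\<nu>, \<rho>) x * E (\<mu>, \<rho>) x)),
     covdiv = (\<lambda>g j \<nu> x. \<Sum>\<mu>\<in>UNIV. covd_density g j \<mu> \<mu> \<nu> x) \<rparr>"


section \<open>Theories\<close>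

text \<open>How the action \<open>S\<close> is related to \<open>S\<^sub>i\<^sub>n\<^sub>v\<close>: \<open>Background \<zeta>0\<close> means \<open>S = S\<^sub>i\<^sub>n\<^sub>v\<close> with \<open>\<zeta>\<close>
  prescribed to be \<open>\<zeta>0\<close>; \<open>Extra Lg\<close> means \<open>S = S\<^sub>i\<^sub>n\<^sub>v + S\<^sub>g\<close>, where \<open>Lg\<close> is the integrand of \<open>S\<^sub>g\<close>;
  \<open>Invariants Q I\<close> means that the integrand contains \<open>I p\<close> for \<open>p < Q\<close>.\<close>

datatype ('z, 'd) setting =
    is_Background: Background "('z, 'd) zfield"
  | is_Extra: Extra "('z, 'd) jet \<Rightarrow> real"
  | is_Invariants: Invariants nat "nat \<Rightarrow> ('z, 'd) jet \<Rightarrow> real"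

text \<open>\<open>matter\<close> is the number of components of \<open>\<psi>\<close>, and \<open>deriv_order\<close> bounds the order of all derivatives
  in the Lagrangian densities. \<open>tr_coeff T k a s\<close> is the coefficient, as a function of the point
  and of the jet of the fields at that point, of the derivative with index string \<open>s\<close> of the
  parameter number \<open>a\<close> in the transformation of \<open>\<psi> k\<close>; \<open>tr_order\<close> bounds the length of \<open>s\<close>.\<close>

record ('z, 'd, 'a) field_theory =
  matter :: nat
  deriv_order :: nat
  L_inv :: "('z, 'd) jet \<Rightarrow> real"
  tr_order :: nat
  tr_coeff :: "nat \<Rightarrow> 'a \<Rightarrow> 'd list \<Rightarrow> real ^ 'd \<Rightarrow> ('z, 'd) jet \<Rightarrow> real"
  setting :: "('z, 'd) setting"

definition matter_tr :: "('z, 'd::finite, 'a::finite) field_theory \<Rightarrow> ('z, 'd) zfield \<Rightarrow> 'd mfield \<Rightarrow>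
    ('a, 'd) param \<Rightarrow> 'd mfield" where
  "matter_tr T \<zeta> \<psi> \<epsilon> k x =
     (\<Sum>s | length s \<le> tr_order T. \<Sum>a\<in>UNIV. tr_coeff T k a s x (jet \<zeta> \<psi> x) * pds s (\<epsilon> a) x)"

definition n_invariants :: "('z, 'd::finite) setting \<Rightarrow> nat" where
  "n_invariants c = (case c of Invariants Q I \<Rightarrow> Q | _ \<Rightarrow> 0)"

definition insert_invariants :: "('z, 'd::finite) setting \<Rightarrow> ('z, 'd) jet \<Rightarrow> ('z, 'd) jet" where
  "insert_invariants c u =
     (case c of Invariants Q I \<Rightarrow> (\<lambda>v. case v of Inv p \<Rightarrow> I p u | _ \<Rightarrow> u v) | _ \<Rightarrow> u)"

definition inv_density :: "('z, 'd::finite, 'a) field_theory \<Rightarrow> ('z, 'd) jet \<Rightarrow> real" where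
  "inv_density T u = L_inv T (insert_invariants (setting T) u)"

definition total_density :: "('z, 'd::finite, 'a) field_theory \<Rightarrow> ('z, 'd) jet \<Rightarrow> real" where
  "total_density T u = inv_density T u + (case setting T of Extra Lg \<Rightarrow> Lg u | _ \<Rightarrow> 0)"

definition fields :: "(real ^ 'd::finite) set \<Rightarrow> ('z, 'd, 'a) sector \<Rightarrow> ('z, 'd, 'b) field_theory \<Rightarrow>
    ('z, 'd) zfield \<Rightarrow> 'd mfield \<Rightarrow> bool" where
  "fields V K T \<zeta> \<psi> \<longleftrightarrow> admissible K \<zeta> \<and> (\<forall>k<matter T. smooth_on V (\<psi> k))"

definition smooth_param :: "(real ^ 'd::finite) set \<Rightarrow> ('a, 'd) param \<Rightarrow> bool" where
  "smooth_param V \<epsilon> \<longleftrightarrow> (\<forall>a. smooth_on V (\<epsilon> a))"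

definition test_param :: "(real ^ 'd::finite) set \<Rightarrow> ('a, 'd) param \<Rightarrow> bool" where
  "test_param V \<epsilon> \<longleftrightarrow> smooth_param V \<epsilon> \<and> (\<exists>X. compact X \<and> X \<subseteq> V \<and> (\<forall>a. \<forall>x. x \<notin> X \<longrightarrow> \<epsilon> a x = 0))"

text \<open>\<open>S\<^sub>i\<^sub>n\<^sub>v\<close> is invariant up to a boundary term: its variation vanishes whenever the parameters
  vanish near the boundary, that is, have compact support in \<open>V\<close>.\<close>

definition invariant_action :: "(real ^ 'd::finite) set \<Rightarrow> ('z, 'd, 'a::finite) sector \<Rightarrow>
    ('z, 'd, 'a) field_theory \<Rightarrow> bool" where
  "invariant_action V K T \<longleftrightarrow> (\<forall>\<zeta> \<psi> \<epsilon>. fields V K T \<zeta> \<psi> \<longrightarrow> test_param V \<epsilon> \<longrightarrow>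
     (variation (inv_density T) \<zeta> \<psi> (zeta_tr K \<zeta> \<epsilon>) (matter_tr T \<zeta> \<psi> \<epsilon>) has_integral 0) V)"

definition local_invariant :: "(real ^ 'd::finite) set \<Rightarrow> ('z, 'd, 'a) sector \<Rightarrow>
    (('z, 'd) jet \<Rightarrow> real) \<Rightarrow> bool" where
  "local_invariant V K I \<longleftrightarrow> (\<forall>\<zeta> \<epsilon>. admissible K \<zeta> \<longrightarrow> smooth_param V \<epsilon> \<longrightarrow>
     (\<forall>x\<in>V. variation I \<zeta> (\<lambda>_ _. 0) (zeta_tr K \<zeta> \<epsilon>) (\<lambda>_ _. 0) x = 0))"

definition proper_setting :: "(real ^ 'd::finite) set \<Rightarrow> ('z, 'd, 'a) sector \<Rightarrow>
    ('z, 'd, 'b) field_theory \<Rightarrow> bool" where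
  "proper_setting V K T \<longleftrightarrow> (case setting T of
       Background \<zeta>0 \<Rightarrow> admissible K \<zeta>0
     | Extra Lg \<Rightarrow> local_function (jet_domain K) 0 0 (deriv_order T) Lg
     | Invariants Q I \<Rightarrow>
         \<forall>p<Q. local_function (jet_domain K) 0 0 (deriv_order T) (I p) \<and> local_invariant V K (I p))"

definition invariant_theory :: "(real ^ 'd::finite) set \<Rightarrow> ('z, 'd, 'a::finite) sector \<Rightarrow>
    ('z, 'd, 'a) field_theory \<Rightarrow> bool" where
  "invariant_theory V K T \<longleftrightarrow> 0 < matter T \<and>
     local_function (jet_domain K) (matter T) (n_invariants (setting T)) (deriv_order T) (L_inv T) \<and>
     (\<exists>r. \<forall>k<matter T. \<forall>a s x. depends_only_on (jvars (matter T) 0 r) (tr_coeff T k a s x)) \<and>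
     (\<forall>\<zeta> \<psi>. fields V K T \<zeta> \<psi> \<longrightarrow>
       (\<forall>k<matter T. \<forall>a s. smooth_on V (\<lambda>x. tr_coeff T k a s x (jet \<zeta> \<psi> x)))) \<and>
     proper_setting V K T \<and> invariant_action V K T"

text \<open>The transformations of \<open>\<psi>\<close> represent the Lie algebra of the group. On \<open>\<zeta>\<close> this is automatic.\<close>

definition represents_algebra :: "(real ^ 'd::finite) set \<Rightarrow> ('z, 'd, 'a::finite) sector \<Rightarrow>
    ('z, 'd, 'a) field_theory \<Rightarrow> bool" where
  "represents_algebra V K T \<longleftrightarrow> (\<forall>\<zeta> \<psi> \<epsilon> \<eta>.
     fields V K T \<zeta> \<psi> \<longrightarrow> smooth_param V \<epsilon> \<longrightarrow> smooth_param V \<eta> \<longrightarrow> (\<forall>k<matter T. \<forall>x\<in>V.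
       deriv (\<lambda>t. matter_tr T (\<lambda>z y. \<zeta> z y + t * zeta_tr K \<zeta> \<epsilon> z y)
                              (\<lambda>l y. \<psi> l y + t * matter_tr T \<zeta> \<psi> \<epsilon> l y) \<eta> k x) 0
     - deriv (\<lambda>t. matter_tr T (\<lambda>z y. \<zeta> z y + t * zeta_tr K \<zeta> \<eta> z y)
                              (\<lambda>l y. \<psi> l y + t * matter_tr T \<zeta> \<psi> \<eta> l y) \<epsilon> k x) 0
     = matter_tr T \<zeta> \<psi> (bracket K \<epsilon> \<eta>) k x))"


section \<open>Conservation\<close>

definition configuration :: "(real ^ 'd::finite) set \<Rightarrow> ('z, 'd, 'a) sector \<Rightarrow>
    ('z, 'd, 'b) field_theory \<Rightarrow> ('z, 'd) zfield \<Rightarrow> 'd mfield \<Rightarrow> bool" where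
  "configuration V K T \<zeta> \<psi> \<longleftrightarrow> fields V K T \<zeta> \<psi> \<and>
     (case setting T of Background \<zeta>0 \<Rightarrow> \<zeta> = \<zeta>0 | _ \<Rightarrow> True)"

definition on_shell :: "(real ^ 'd::finite) set \<Rightarrow> ('z, 'd, 'a) sector \<Rightarrow>
    ('z, 'd, 'b) field_theory \<Rightarrow> ('z, 'd) zfield \<Rightarrow> 'd mfield \<Rightarrow> bool" where
  "on_shell V K T \<zeta> \<psi> \<longleftrightarrow>
     (\<forall>k<matter T. \<forall>x\<in>V. euler (deriv_order T) (total_density T) (Psi k) (jet \<zeta> \<psi>) x = 0) \<and>
     (\<not> is_Background (setting T) \<longrightarrow>
       (\<forall>z. \<forall>x\<in>V. zeta_euler K (deriv_order T) (total_density T) (jet \<zeta> \<psi>) z x = 0))"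

text \<open>The derivative of \<open>L\<^sub>i\<^sub>n\<^sub>v\<close> with respect to \<open>\<zeta>\<close>, with the \<open>I\<^sub>p\<close> (if any) held constant.\<close>

definition source :: "('z, 'd::finite, 'a) sector \<Rightarrow> ('z, 'd, 'b) field_theory \<Rightarrow>
    ('z, 'd) zfield \<Rightarrow> 'd mfield \<Rightarrow> ('z, 'd) zfield" where
  "source K T \<zeta> \<psi> =
     zeta_euler K (deriv_order T) (L_inv T) (\<lambda>y. insert_invariants (setting T) (jet \<zeta> \<psi> y))"

definition current :: "('z, 'd::finite, 'a) sector \<Rightarrow> ('z, 'd, 'b) field_theory \<Rightarrow>
    ('z, 'd) zfield \<Rightarrow> 'd mfield \<Rightarrow> 'd \<Rightarrow> 'a \<Rightarrow> 'd scalar" where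
  "current K T \<zeta> \<psi> = make_current K \<zeta> (source K T \<zeta> \<psi>)"

definition conserved_on_shell :: "(real ^ 'd::finite) set \<Rightarrow> ('z, 'd, 'a) sector \<Rightarrow>
    ('z, 'd, 'b) field_theory \<Rightarrow> bool" where
  "conserved_on_shell V K T \<longleftrightarrow> (\<forall>\<zeta> \<psi>. configuration V K T \<zeta> \<psi> \<longrightarrow> on_shell V K T \<zeta> \<psi> \<longrightarrow>
     (\<forall>a. \<forall>x\<in>V. covdiv K \<zeta> (current K T \<zeta> \<psi>) a x = 0))"

text \<open>The next two predicates express triviality of the conservation law. They cannot be refuted for
  each single theory: the divergence vanishes off-shell if \<open>\<psi>\<close> does not transform, and the current
  vanishes on-shell for \<open>Extra Lg\<close> with \<open>Lg = 0\<close> and for \<open>Invariants Q I\<close> with constant \<open>I p\<close>. The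
  latter is always the case for strict invariants of a metric under diffeomorphisms, and for those of
  a connection if \<open>D = 1\<close>.\<close>

definition divergence_identically_zero :: "(real ^ 'd::finite) set \<Rightarrow> ('z, 'd, 'a) sector \<Rightarrow>
    ('z, 'd, 'b) field_theory \<Rightarrow> bool" where
  "divergence_identically_zero V K T \<longleftrightarrow> (\<forall>\<zeta> \<psi>. configuration V K T \<zeta> \<psi> \<longrightarrow>
     (\<forall>a. \<forall>x\<in>V. covdiv K \<zeta> (current K T \<zeta> \<psi>) a x = 0))"

definition current_zero_on_shell :: "(real ^ 'd::finite) set \<Rightarrow> ('z, 'd, 'a) sector \<Rightarrow>
    ('z, 'd, 'b) field_theory \<Rightarrow> bool" where
  "current_zero_on_shell V K T \<longleftrightarrow> (\<forall>\<zeta> \<psi>. configuration V K T \<zeta> \<psi> \<longrightarrow> on_shell V K T \<zeta> \<psi> \<longrightarrow>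
     (\<forall>\<mu> a. \<forall>x\<in>V. current K T \<zeta> \<psi> \<mu> a x = 0))"

text \<open>\<open>S\<^sub>i\<^sub>n\<^sub>v\<close> is already invariant when only \<open>\<psi>\<close> is transformed, \<open>\<zeta>\<close> being left unchanged.\<close>

definition invariant_under_matter_alone :: "(real ^ 'd::finite) set \<Rightarrow> ('z, 'd, 'a::finite) sector \<Rightarrow>
    ('z, 'd, 'a) field_theory \<Rightarrow> bool" where
  "invariant_under_matter_alone V K T \<longleftrightarrow> (\<forall>\<zeta> \<psi> \<epsilon>. configuration V K T \<zeta> \<psi> \<longrightarrow> test_param V \<epsilon> \<longrightarrow>
     (variation (inv_density T) \<zeta> \<psi> (\<lambda>_ _. 0) (matter_tr T \<zeta> \<psi> \<epsilon>) has_integral 0) V)"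

text \<open>For some solution, \<open>S\<^sub>g\<close> or the dependence of the integrand on \<open>\<zeta>\<close> through the \<open>I\<^sub>p\<close> contributes
  to the equations of motion of \<open>\<zeta>\<close>.\<close>

definition extra_terms_contribute :: "(real ^ 'd::finite) set \<Rightarrow> ('z, 'd, 'a) sector \<Rightarrow>
    ('z, 'd, 'b) field_theory \<Rightarrow> bool" where
  "extra_terms_contribute V K T \<longleftrightarrow> (\<exists>\<zeta> \<psi> z. \<exists>x\<in>V. configuration V K T \<zeta> \<psi> \<and> on_shell V K T \<zeta> \<psi> \<and>
     zeta_euler K (deriv_order T) (total_density T) (jet \<zeta> \<psi>) z x - source K T \<zeta> \<psi> z x \<noteq> 0)"

end

theory Submission
  imports Defs
begin

text \<open>
  The first variation of \<open>S\<^sub>i\<^sub>n\<^sub>v\<close> under a transformation with compactly supported parameters is, after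
  integration by parts, \<open>\<integral> (\<delta>L\<^sub>i\<^sub>n\<^sub>v/\<delta>\<zeta>) \<delta>\<zeta> + (\<delta>L\<^sub>i\<^sub>n\<^sub>v/\<delta>\<psi>) \<delta>\<psi>\<close>, the invariants \<open>I\<^sub>p\<close> contributing nothing because they
  do not vary. The first term equals \<open>-\<integral> \<epsilon>\<^sup>a \<nabla>\<^sub>\<mu> j\<^sup>\<mu>\<^sub>a\<close>, and \<open>S\<^sub>g\<close> and the \<open>I\<^sub>p\<close> do not involve \<open>\<psi>\<close>, so the second
  term vanishes as soon as the equations of motion of \<open>\<psi>\<close> hold; the fundamental lemma of the calculus of
  variations then gives the conservation law. If instead the divergence vanishes off-shell, what is left says
  that \<open>S\<^sub>i\<^sub>n\<^sub>v\<close> is invariant under the transformation of \<open>\<psi>\<close> alone.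

  Nontrivial examples use polynomial densities: minimally coupled scalars for a background or dynamical gauge
  connection, a second connection for the case with a curvature invariant, and a pressureless fluid for the
  metric. With \<open>S\<^sub>g\<close> linear in \<open>\<zeta>\<close>, constant currents solve the equation of motion of \<open>\<zeta>\<close>.
\<close>

section \<open>Partial derivatives\<close>

text \<open>\<open>pd\<close> is a bare \<open>deriv\<close> along a coordinate line and has a value
  even where nothing is differentiable, while jets live in an infinite product space without a norm.
  The calculus is therefore rebuilt on these terms: smoothness is tracked order by order, and the
  chain rule for functions of jets rests on continuous partial derivatives in finitely many
  variables. The integrated identity between the Euler derivative and the divergence is isolated in
  a locale with two instances. For a connection it comes from the skewness of the bracket with
  respect to the standard inner product; for a metric it comes from the symmetry of the Euler
  derivative, under which the Christoffel symbols collapse to first derivatives of g. The examples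
  must exist for every coupling and every set of structure constants, also for an abelian group,
  where adjoint fields do not transform; there a shift of the scalars takes over. In the setting
  with an invariant the two connections enter with opposite signs of their curvature terms, so that
  one condition solves both field equations.\<close>

lemma pd_eq:
  assumes "(f has_derivative f') (at x)"
  shows "pd \<mu> f x = f' (axis \<mu> 1)"
proof -
  have "((\<lambda>t. x + t *\<^sub>R axis \<mu> 1) has_derivative (\<lambda>t. t *\<^sub>R axis \<mu> 1)) (at (0::real))"
    by (auto intro!: derivative_eq_intros)
  moreover have "(f has_derivative f') (at (x + 0 *\<^sub>R axis \<mu> 1))" using assms by simp
  ultimately have "((\<lambda>t. f (x + t *\<^sub>R axis \<mu> 1)) has_derivative (\<lambda>t. f' (t *\<^sub>R axis \<mu> 1))) (at 0)"
    by (rule has_derivative_compose)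
  moreover have "f' (t *\<^sub>R axis \<mu> 1) = t * f' (axis \<mu> 1)" for t
    using linear_scale[OF has_derivative_linear[OF assms]] by simp
  ultimately have "((\<lambda>t. f (x + t *\<^sub>R axis \<mu> 1)) has_real_derivative f' (axis \<mu> 1)) (at 0)"
    by (simp add: has_field_derivative_def mult_commute_abs)
  then show ?thesis unfolding pd_def by (rule DERIV_imp_deriv)
qed

text \<open>The mean value theorem asks for the derivative at every parameter of a segment, whereas
  \<open>pd\<close> is defined at parameter 0 only.\<close>

lemma pd_line:
  assumes "f differentiable at (x + t *\<^sub>R axis \<mu> 1)"
  shows "((\<lambda>t. f (x + t *\<^sub>R axis \<mu> 1)) has_real_derivative pd \<mu> f (x + t *\<^sub>R axis \<mu> 1)) (at t)"
proof -
  obtain f' where f': "(f has_derivative f') (at (x + t *\<^sub>R axis \<mu> 1))"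
    using assms by (auto simp: differentiable_def)
  have "((\<lambda>t. x + t *\<^sub>R axis \<mu> 1) has_derivative (\<lambda>t. t *\<^sub>R axis \<mu> 1)) (at t)"
    by (auto intro!: derivative_eq_intros)
  from has_derivative_compose[OF this f']
  have "((\<lambda>t. f (x + t *\<^sub>R axis \<mu> 1)) has_derivative (\<lambda>t. f' (t *\<^sub>R axis \<mu> 1))) (at t)" .
  moreover have "f' (t *\<^sub>R axis \<mu> 1) = t * f' (axis \<mu> 1)" for t
    using linear_scale[OF has_derivative_linear[OF f']] by simp
  ultimately show ?thesis
    by (simp add: has_field_derivative_def mult_commute_abs pd_eq[OF f'])
qed

lemma pd_const [simp]: "pd \<mu> (\<lambda>x. c) = (\<lambda>x. 0)"
  by (rule ext) (simp add: pd_eq[OF has_derivative_const])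

lemma pd_component: "pd \<mu> (\<lambda>x :: real ^ 'a::finite. x $ \<nu>) = (\<lambda>x. if \<mu> = \<nu> then 1 else 0)"
proof
  fix x :: "real ^ 'a"
  have "((\<lambda>x :: real ^ 'a. x $ \<nu>) has_derivative (\<lambda>h. h $ \<nu>)) (at x)"
    by (rule bounded_linear_imp_has_derivative[OF bounded_linear_vec_nth])
  from pd_eq[OF this] show "pd \<mu> (\<lambda>x. x $ \<nu>) x = (if \<mu> = \<nu> then 1 else 0)"
    by (simp add: axis_def)
qed

lemma pd_add:
  assumes "f differentiable at x" "g differentiable at x"
  shows "pd \<mu> (\<lambda>x. f x + g x) x = pd \<mu> f x + pd \<mu> g x"
proof -
  obtain f' g' where d: "(f has_derivative f') (at x)" "(g has_derivative g') (at x)"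
    using assms by (auto simp: differentiable_def)
  show ?thesis by (simp add: pd_eq[OF has_derivative_add[OF d]] pd_eq[OF d(1)] pd_eq[OF d(2)])
qed

lemma pd_mult:
  fixes f g :: "'d::finite scalar"
  assumes "f differentiable at x" "g differentiable at x"
  shows "pd \<mu> (\<lambda>x. f x * g x) x = pd \<mu> f x * g x + f x * pd \<mu> g x"
proof -
  obtain f' g' where d: "(f has_derivative f') (at x)" "(g has_derivative g') (at x)"
    using assms by (auto simp: differentiable_def)
  show ?thesis by (simp add: pd_eq[OF has_derivative_mult[OF d]] pd_eq[OF d(1)] pd_eq[OF d(2)])
qed

lemma pd_cmult:
  fixes f :: "'d::finite scalar"
  assumes "f differentiable at x"
  shows "pd \<mu> (\<lambda>x. c * f x) x = c * pd \<mu> f x"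
  using pd_mult[of "\<lambda>_. c" x f \<mu>] assms by simp

lemma pd_minus:
  fixes f :: "'d::finite scalar"
  assumes "f differentiable at x"
  shows "pd \<mu> (\<lambda>x. - f x) x = - pd \<mu> f x"
  using pd_cmult[OF assms, of \<mu> "-1"] by simp

lemma pd_sum:
  fixes f :: "'i \<Rightarrow> 'd::finite scalar"
  assumes "\<And>i. i \<in> I \<Longrightarrow> f i differentiable at x"
  shows "pd \<mu> (\<lambda>x. \<Sum>i\<in>I. f i x) x = (\<Sum>i\<in>I. pd \<mu> (f i) x)"
proof -
  obtain f' where d: "\<And>i. i \<in> I \<Longrightarrow> (f i has_derivative f' i) (at x)"
    using assms unfolding differentiable_def by metis
  have "pd \<mu> (\<lambda>x. \<Sum>i\<in>I. f i x) x = (\<Sum>i\<in>I. f' i (axis \<mu> 1))"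
    by (rule pd_eq[OF has_derivative_sum[OF d]])
  then show ?thesis using pd_eq[OF d] by simp
qed

text \<open>Fields are total functions with arbitrary values off V. Identities valid on the open set
  V may still be differentiated, because a line through x stays in V for small parameters.\<close>

lemma pd_cong_open:
  assumes "open V" "x \<in> V" "\<And>y. y \<in> V \<Longrightarrow> f y = g y"
  shows "pd \<mu> f x = pd \<mu> g x"
proof -
  have "open ((\<lambda>t::real. x + t *\<^sub>R axis \<mu> 1) -` V)"
    by (intro open_vimage assms continuous_intros)
  then have "eventually (\<lambda>t. t \<in> (\<lambda>t::real. x + t *\<^sub>R axis \<mu> 1) -` V) (nhds (0::real))"
    by (rule eventually_nhds_in_open) (simp add: assms)
  then have "eventually (\<lambda>t. f (x + t *\<^sub>R axis \<mu> 1) = g (x + t *\<^sub>R axis \<mu> 1)) (nhds (0::real))"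
    by eventually_elim (simp add: assms)
  then show ?thesis unfolding pd_def by (intro deriv_cong_ev) auto
qed

lemma pds_cong_open:
  assumes "open V" "\<And>y. y \<in> V \<Longrightarrow> f y = g y" "x \<in> V"
  shows "pds s f x = pds s g x"
  using assms(3)
proof (induction s arbitrary: x)
  case (Cons \<mu> s)
  show ?case using pd_cong_open[OF assms(1) Cons.prems, of "pds s f" "pds s g"] Cons.IH by simp
qed (simp add: assms)

lemma pds_append: "pds (s @ t) f = pds s (pds t f)"
  by (induction s) auto

lemma differentiable_on_openD:
  "f differentiable_on V \<Longrightarrow> open V \<Longrightarrow> x \<in> V \<Longrightarrow> f differentiable at x"
  by (simp add: differentiable_on_eq_differentiable_at)

lemma smooth_on_pds: "smooth_on V f \<Longrightarrow> smooth_on V (pds s f)"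
  unfolding smooth_on_def by (metis pds_append)

lemma smooth_on_pd: "smooth_on V f \<Longrightarrow> smooth_on V (pd \<mu> f)"
  using smooth_on_pds[of V f "[\<mu>]"] by simp

lemma smooth_on_differentiable:
  "smooth_on V f \<Longrightarrow> open V \<Longrightarrow> x \<in> V \<Longrightarrow> f differentiable at x"
  unfolding smooth_on_def by (metis differentiable_on_openD pds.simps(1))

lemma smooth_on_pds_differentiable:
  "smooth_on V f \<Longrightarrow> open V \<Longrightarrow> x \<in> V \<Longrightarrow> pds s f differentiable at x"
  by (rule smooth_on_differentiable[OF smooth_on_pds])

lemma smooth_on_continuous_on: "smooth_on V f \<Longrightarrow> continuous_on V f"
  unfolding smooth_on_def by (metis differentiable_imp_continuous_on pds.simps(1))

section \<open>Smoothness of finite order and its closure properties\<close>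

primrec smooth_upto :: "nat \<Rightarrow> (real ^ 'd::finite) set \<Rightarrow> 'd scalar \<Rightarrow> bool" where
  "smooth_upto 0 V f \<longleftrightarrow> f differentiable_on V"
| "smooth_upto (Suc n) V f \<longleftrightarrow> f differentiable_on V \<and> (\<forall>\<mu>. smooth_upto n V (pd \<mu> f))"

text \<open>The recursion of \<open>smooth_upto\<close> peels off the derivative that acts first,
  which is the last letter of a string, so strings are split at their right end. It supplies the
  induction on the order that \<open>smooth_on\<close>, which quantifies over all strings at once,
  does not give.\<close>

lemma smooth_upto_iff: "smooth_upto n V f \<longleftrightarrow> (\<forall>s. length s \<le> n \<longrightarrow> pds s f differentiable_on V)"
proof (induction n arbitrary: f)
  case (Suc n)
  have "(\<forall>s. length s \<le> Suc n \<longrightarrow> pds s f differentiable_on V) \<longleftrightarrow>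
    f differentiable_on V \<and> (\<forall>\<mu> s. length s \<le> n \<longrightarrow> pds (s @ [\<mu>]) f differentiable_on V)" (is "?L = ?R")
  proof
    assume ?L
    then have "\<And>s. length s \<le> Suc n \<Longrightarrow> pds s f differentiable_on V" by blast
    from this[of "[]"] this[of "_ @ [_]"] show ?R by auto
  next
    assume R: ?R
    show ?L
    proof (intro allI impI)
      fix s :: "'a list" assume "length s \<le> Suc n"
      then show "pds s f differentiable_on V" using R by (cases s rule: rev_cases) auto
    qed
  qed
  then show ?case by (simp add: Suc pds_append)
qed simp

lemma smooth_on_iff_upto: "smooth_on V f \<longleftrightarrow> (\<forall>n. smooth_upto n V f)"
  unfolding smooth_upto_iff smooth_on_def by blast

lemma smooth_upto_Suc: "smooth_upto (Suc n) V f \<Longrightarrow> smooth_upto n V f"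
  unfolding smooth_upto_iff by auto

lemma smooth_upto_cong:
  assumes "open V" "smooth_upto n V f" "\<And>x. x \<in> V \<Longrightarrow> f x = g x"
  shows "smooth_upto n V g"
proof -
  have "pds s g differentiable_on V" if "length s \<le> n" for s
    unfolding differentiable_on_def
  proof
    fix x assume "x \<in> V"
    moreover have "pds s f differentiable at x within V"
      using assms(2) that \<open>x \<in> V\<close> unfolding smooth_upto_iff differentiable_on_def by blast
    ultimately show "pds s g differentiable at x within V"
      by (intro differentiable_transform_within[where d = 1 and f = "pds s f" and g = "pds s g"])
        (auto intro: pds_cong_open[OF assms(1,3)])
  qed
  then show ?thesis unfolding smooth_upto_iff by blast
qed


lemma smooth_upto_const: "smooth_upto n V (\<lambda>x. c)"
  by (induction n arbitrary: c) auto

lemma smooth_upto_component: "smooth_upto n V (\<lambda>x. x $ \<nu>)"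
proof -
  have "(\<lambda>x. x $ \<nu>) differentiable_on V"
    by (intro linear_imp_differentiable_on bounded_linear.linear bounded_linear_vec_nth)
  then show ?thesis by (cases n) (auto simp: pd_component smooth_upto_const)
qed

lemma smooth_upto_add:
  assumes "open V"
  shows "smooth_upto n V f \<Longrightarrow> smooth_upto n V g \<Longrightarrow> smooth_upto n V (\<lambda>x. f x + g x)"
proof (induction n arbitrary: f g)
  case (Suc n)
  have d: "f differentiable_on V" "g differentiable_on V" using Suc.prems by auto
  have "smooth_upto n V (pd \<mu> (\<lambda>x. f x + g x))" for \<mu>
    by (rule smooth_upto_cong[OF assms Suc.IH[of "pd \<mu> f" "pd \<mu> g"]])
      (use Suc.prems d in \<open>auto simp: pd_add differentiable_on_openD[OF _ assms]\<close>)
  then show ?case using d by (auto intro: differentiable_on_add)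
qed (auto intro: differentiable_on_add)

lemma smooth_upto_mult:
  assumes "open V"
  shows "smooth_upto n V f \<Longrightarrow> smooth_upto n V g \<Longrightarrow> smooth_upto n V (\<lambda>x. f x * g x)"
proof (induction n arbitrary: f g)
  case (Suc n)
  have d: "f differentiable_on V" "g differentiable_on V" using Suc.prems by auto
  have "smooth_upto n V (\<lambda>x. pd \<mu> f x * g x + f x * pd \<mu> g x)" for \<mu>
    using Suc.prems smooth_upto_Suc[of n V f] smooth_upto_Suc[of n V g]
    by (intro smooth_upto_add[OF assms] Suc.IH) auto
  then have "smooth_upto n V (pd \<mu> (\<lambda>x. f x * g x))" for \<mu>
    by (rule smooth_upto_cong[OF assms])
      (use d in \<open>auto simp: pd_mult differentiable_on_openD[OF _ assms]\<close>)
  then show ?case using d by (auto intro: differentiable_on_mult)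
qed (auto intro: differentiable_on_mult)

lemma smooth_on_cong:
  "smooth_on V f \<Longrightarrow> open V \<Longrightarrow> (\<And>x. x \<in> V \<Longrightarrow> f x = g x) \<Longrightarrow> smooth_on V g"
  unfolding smooth_on_iff_upto using smooth_upto_cong by blast

lemma smooth_on_const [simp]: "smooth_on V (\<lambda>x. c)"
  by (simp add: smooth_on_iff_upto smooth_upto_const)

lemma smooth_on_component [simp]: "smooth_on V (\<lambda>x. x $ \<nu>)"
  by (simp add: smooth_on_iff_upto smooth_upto_component)

lemma smooth_on_add:
  "open V \<Longrightarrow> smooth_on V f \<Longrightarrow> smooth_on V g \<Longrightarrow> smooth_on V (\<lambda>x. f x + g x)"
  by (simp add: smooth_on_iff_upto smooth_upto_add)

lemma smooth_on_mult:
  "open V \<Longrightarrow> smooth_on V f \<Longrightarrow> smooth_on V g \<Longrightarrow> smooth_on V (\<lambda>x. f x * g x)"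
  by (simp add: smooth_on_iff_upto smooth_upto_mult)

lemma smooth_on_minus:
  "open V \<Longrightarrow> smooth_on V f \<Longrightarrow> smooth_on V (\<lambda>x. - f x)"
  using smooth_on_mult[OF _ smooth_on_const, of V f "-1"] by simp

lemma smooth_on_diff:
  "open V \<Longrightarrow> smooth_on V f \<Longrightarrow> smooth_on V g \<Longrightarrow> smooth_on V (\<lambda>x. f x - g x)"
  using smooth_on_add[OF _ _ smooth_on_minus, of V f g] by simp

lemma smooth_on_sum:
  assumes "open V" "\<And>i. i \<in> I \<Longrightarrow> smooth_on V (f i)"
  shows "smooth_on V (\<lambda>x. \<Sum>i\<in>I. f i x)"
  using assms(2) by (induction I rule: infinite_finite_induct) (auto intro: smooth_on_add assms)

lemma smooth_on_divide:
  "open V \<Longrightarrow> smooth_on V f \<Longrightarrow> smooth_on V (\<lambda>x. f x / c)"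
  using smooth_on_mult[OF _ _ smooth_on_const, of V f "1 / c"] by simp

lemma smooth_on_power:
  "open V \<Longrightarrow> smooth_on V f \<Longrightarrow> smooth_on V (\<lambda>x. f x ^ n)"
  by (induction n) (auto intro: smooth_on_mult)

lemmas smooth_on_intros = smooth_on_add smooth_on_mult smooth_on_minus smooth_on_diff
  smooth_on_sum smooth_on_divide smooth_on_power smooth_on_pd smooth_on_pds

lemma smooth_on_subset: "smooth_on V f \<Longrightarrow> U \<subseteq> V \<Longrightarrow> smooth_on U f"
  unfolding smooth_on_def using differentiable_on_subset by blast

text \<open>Used with c as the parameter of a variation: the jet of a varied field moves along a
  straight line, and its velocity is the jet of the variation.\<close>

lemma pds_linear:
  assumes "open V" "smooth_on V f" "smooth_on V g" "x \<in> V"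
  shows "pds s (\<lambda>y. f y + c * g y) x = pds s f x + c * pds s g x"
  using assms(4)
proof (induction s arbitrary: x)
  case (Cons \<mu> s)
  have d: "pds s f differentiable at x" "pds s g differentiable at x"
    using assms Cons.prems by (auto intro: smooth_on_pds_differentiable)
  have "pds (\<mu> # s) (\<lambda>y. f y + c * g y) x = pd \<mu> (\<lambda>x. pds s f x + c * pds s g x) x"
    by (simp add: pd_cong_open[OF assms(1) Cons.prems Cons.IH])
  also have "\<dots> = pds (\<mu> # s) f x + c * pds (\<mu> # s) g x"
    using d by (simp add: pd_add pd_cmult)
  finally show ?case .
qed simp

text \<open>Two applications of the mean value theorem write the second difference of \<open>f\<close>, which is
  symmetric in \<open>\<mu>\<close> and \<open>\<nu>\<close>, as a mixed derivative at a nearby point.\<close>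

lemma second_difference:
  fixes f :: "'d::finite scalar"
  assumes sm: "smooth_on V f" and V: "open V" and "ball x r \<subseteq> V" "0 < h" "2 * h < r"
  shows "\<exists>a\<in>ball x r. f (x + h *\<^sub>R axis \<mu> 1 + h *\<^sub>R axis \<nu> 1) - f (x + h *\<^sub>R axis \<mu> 1)
    - f (x + h *\<^sub>R axis \<nu> 1) + f x = h * h * pd \<nu> (pd \<mu> f) a"
proof -
  define e :: "'d \<Rightarrow> real ^ 'd" where "e = (\<lambda>i. axis i 1)"
  have B: "x + s *\<^sub>R e \<mu> + t *\<^sub>R e \<nu> \<in> ball x r" if "0 \<le> s" "s \<le> h" "0 \<le> t" "t \<le> h" for s t
  proof -
    \<comment> \<open>The corners of a square of side h lie within 2 h of x, whence the hypothesis
      \<open>2 * h < r\<close>.\<close>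
    have "norm (s *\<^sub>R e \<mu> + t *\<^sub>R e \<nu>) \<le> s + t"
      by (rule order_trans[OF norm_triangle_ineq]) (use that in \<open>simp add: e_def\<close>)
    then have "dist (x + (s *\<^sub>R e \<mu> + t *\<^sub>R e \<nu>)) x < r"
      unfolding dist_norm using that assms by (simp add: algebra_simps)
    then show ?thesis by (simp add: dist_commute add.assoc)
  qed
  have d: "((\<lambda>s. f (x + s *\<^sub>R e \<mu> + t *\<^sub>R e \<nu>)) has_real_derivative
      pd \<mu> f (x + s *\<^sub>R e \<mu> + t *\<^sub>R e \<nu>)) (at s)"
    if "0 \<le> s" "s \<le> h" "0 \<le> t" "t \<le> h" for s t
  proof -
    have "x + t *\<^sub>R e \<nu> + s *\<^sub>R e \<mu> \<in> V" using B[OF that] assms(3) by (auto simp: algebra_simps)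
    from pd_line[OF smooth_on_differentiable[OF sm V this[unfolded e_def]]]
    show ?thesis by (simp add: algebra_simps e_def)
  qed
  define \<phi> where "\<phi> = (\<lambda>s. f (x + s *\<^sub>R e \<mu> + h *\<^sub>R e \<nu>) - f (x + s *\<^sub>R e \<mu> + 0 *\<^sub>R e \<nu>))"
  define \<phi>' where
    "\<phi>' = (\<lambda>s. pd \<mu> f (x + s *\<^sub>R e \<mu> + h *\<^sub>R e \<nu>) - pd \<mu> f (x + s *\<^sub>R e \<mu> + 0 *\<^sub>R e \<nu>))"
  have "(\<phi> has_real_derivative \<phi>' s) (at s)" if "0 \<le> s" "s \<le> h" for s
    unfolding \<phi>_def \<phi>'_def using that \<open>0 < h\<close> by (intro DERIV_diff d) auto
  from MVT2[OF \<open>0 < h\<close> this] obtain s where s: "0 < s" "s < h" and eq: "\<phi> h - \<phi> 0 = (h - 0) * \<phi>' s"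
    by blast
  have d2: "((\<lambda>t. pd \<mu> f (x + s *\<^sub>R e \<mu> + t *\<^sub>R e \<nu>)) has_real_derivative
      pd \<nu> (pd \<mu> f) (x + s *\<^sub>R e \<mu> + t *\<^sub>R e \<nu>)) (at t)"
    if "0 \<le> t" "t \<le> h" for t
  proof -
    have "x + s *\<^sub>R e \<mu> + t *\<^sub>R e \<nu> \<in> V" using B[of s t] that s assms(3) by auto
    from pd_line[OF smooth_on_differentiable[OF smooth_on_pd[OF sm] V this[unfolded e_def]]]
    show ?thesis by (simp add: e_def)
  qed
  obtain t where t: "0 < t" "t < h" and
    "pd \<mu> f (x + s *\<^sub>R e \<mu> + h *\<^sub>R e \<nu>) - pd \<mu> f (x + s *\<^sub>R e \<mu> + 0 *\<^sub>R e \<nu>)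
      = (h - 0) * pd \<nu> (pd \<mu> f) (x + s *\<^sub>R e \<mu> + t *\<^sub>R e \<nu>)"
    using MVT2[OF \<open>0 < h\<close> d2] by blast
  then have "f (x + h *\<^sub>R e \<mu> + h *\<^sub>R e \<nu>) - f (x + h *\<^sub>R e \<mu>) - f (x + h *\<^sub>R e \<nu>) + f x
      = h * h * pd \<nu> (pd \<mu> f) (x + s *\<^sub>R e \<mu> + t *\<^sub>R e \<nu>)"
    using eq by (simp add: \<phi>_def \<phi>'_def)
  then show ?thesis using B[of s t] s t by (auto simp: e_def)
qed

text \<open>One second difference equals a mixed derivative in either order, taken at points a and b
  of a small ball around x. Continuity of both mixed derivatives moves a and b to x with an error
  below any e.\<close>

lemma pd_commute:
  fixes f :: "'d::finite scalar"
  assumes sm: "smooth_on V f" and V: "open V" "x \<in> V"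
  shows "pd \<mu> (pd \<nu> f) x = pd \<nu> (pd \<mu> f) x"
proof -
  have cont: "isCont (pd i (pd j f)) x" for i j
    using continuous_on_eq_continuous_at[OF V(1)] V(2)
      smooth_on_continuous_on[OF smooth_on_pd[OF smooth_on_pd[OF sm]]] by blast
  have "\<bar>pd \<mu> (pd \<nu> f) x - pd \<nu> (pd \<mu> f) x\<bar> \<le> e" if "e > 0" for e
  proof -
    obtain r0 where r0: "r0 > 0" "ball x r0 \<subseteq> V" using V open_contains_ball by blast
    obtain r1 where r1: "r1 > 0" "\<And>y. dist y x < r1 \<Longrightarrow> dist (pd \<mu> (pd \<nu> f) y) (pd \<mu> (pd \<nu> f) x) < e / 2"
      using cont[of \<mu> \<nu>] \<open>e > 0\<close> unfolding continuous_at_eps_delta by (meson half_gt_zero)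
    obtain r2 where r2: "r2 > 0" "\<And>y. dist y x < r2 \<Longrightarrow> dist (pd \<nu> (pd \<mu> f) y) (pd \<nu> (pd \<mu> f) x) < e / 2"
      using cont[of \<nu> \<mu>] \<open>e > 0\<close> unfolding continuous_at_eps_delta by (meson half_gt_zero)
    define r where "r = min r0 (min r1 r2)"
    have r: "r > 0" "ball x r \<subseteq> V" using r0 r1 r2 unfolding r_def by auto
    define h where "h = r / 3"
    have h: "0 < h" "2 * h < r" using r by (auto simp: h_def)
    obtain a where a: "a \<in> ball x r" "f (x + h *\<^sub>R axis \<mu> 1 + h *\<^sub>R axis \<nu> 1) - f (x + h *\<^sub>R axis \<mu> 1)
      - f (x + h *\<^sub>R axis \<nu> 1) + f x = h * h * pd \<nu> (pd \<mu> f) a"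
      using second_difference[OF sm V(1) r(2) h] by blast
    obtain b where b: "b \<in> ball x r" "f (x + h *\<^sub>R axis \<nu> 1 + h *\<^sub>R axis \<mu> 1) - f (x + h *\<^sub>R axis \<nu> 1)
      - f (x + h *\<^sub>R axis \<mu> 1) + f x = h * h * pd \<mu> (pd \<nu> f) b"
      using second_difference[OF sm V(1) r(2) h] by blast
    have "h * h * pd \<nu> (pd \<mu> f) a = h * h * pd \<mu> (pd \<nu> f) b"
      using a b by (simp add: algebra_simps)
    then have "pd \<nu> (pd \<mu> f) a = pd \<mu> (pd \<nu> f) b" using h by simp
    moreover have "dist (pd \<nu> (pd \<mu> f) a) (pd \<nu> (pd \<mu> f) x) < e / 2"
      using a r2 by (auto simp: r_def dist_commute)
    moreover have "dist (pd \<mu> (pd \<nu> f) b) (pd \<mu> (pd \<nu> f) x) < e / 2"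
      using b r1 by (auto simp: r_def dist_commute)
    ultimately show ?thesis unfolding dist_real_def by linarith
  qed
  then have "\<bar>pd \<mu> (pd \<nu> f) x - pd \<nu> (pd \<mu> f) x\<bar> \<le> 0" by (rule field_le_epsilon) auto
  then show ?thesis by simp
qed

lemma pds_pd:
  assumes "smooth_on V f" "open V" "x \<in> V"
  shows "pds s (pd \<mu> f) x = pd \<mu> (pds s f) x"
  using assms(3)
proof (induction s arbitrary: x)
  case (Cons \<nu> s)
  have "pds (\<nu> # s) (pd \<mu> f) x = pd \<nu> (pd \<mu> (pds s f)) x"
    by (simp add: pd_cong_open[OF assms(2) Cons.prems Cons.IH])
  also have "\<dots> = pd \<mu> (pd \<nu> (pds s f)) x"
    by (rule pd_commute[OF smooth_on_pds[OF assms(1)] assms(2) Cons.prems])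
  finally show ?case by simp
qed simp

text \<open>Integration by parts moves the letters of a string one at a time and thereby reverses
  it; commuting derivatives undo the reversal.\<close>

lemma pds_rev:
  assumes "smooth_on V f" "open V" "x \<in> V"
  shows "pds (rev s) f x = pds s f x"
  using assms(3)
proof (induction s arbitrary: x)
  case (Cons \<mu> s)
  have "pds (rev (\<mu> # s)) f x = pd \<mu> (pds (rev s) f) x"
    by (simp add: pds_append pds_pd[OF assms(1,2) Cons.prems])
  also have "\<dots> = pd \<mu> (pds s f) x" by (rule pd_cong_open[OF assms(2) Cons.prems Cons.IH])
  finally show ?case by simp
qed simp

section \<open>Integration by parts and the fundamental lemma\<close>

text \<open>The difference quotients \<open>D n\<close> have integral 0 by translation invariance of
  Lebesgue measure. They converge to \<open>pd \<mu> f\<close>, and the mean value theorem bounds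
  them uniformly on a fixed ball, so dominated convergence carries the 0 to the limit.\<close>

lemma has_integral_pd_zero:
  fixes f :: "'d::finite scalar"
  assumes df: "\<And>x. f differentiable at x" and cont: "continuous_on UNIV (pd \<mu> f)"
    and X: "bounded X" "\<And>x. x \<notin> X \<Longrightarrow> f x = 0"
  shows "(pd \<mu> f has_integral 0) UNIV"
proof -
  define e :: "real ^ 'd" where "e = axis \<mu> 1"
  define h where "h n = inverse (real (Suc n))" for n
  have h: "0 < h n" "h n \<le> 1" for n by (auto simp: h_def field_simps)
  define D where "D n x = (f (x + h n *\<^sub>R e) - f x) / h n" for n x
  obtain R where R: "\<And>x. x \<in> X \<Longrightarrow> norm x \<le> R" using X bounded_iff by blast
  \<comment> \<open>A quotient with step at most 1 can be nonzero only within radius R + 1, and its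
    intermediate point may lie one unit further out.\<close>
  have "bounded (pd \<mu> f ` cball 0 (R + 2))"
    by (intro compact_imp_bounded compact_continuous_image continuous_on_subset[OF cont]) auto
  then obtain M where M: "\<And>x. norm x \<le> R + 2 \<Longrightarrow> \<bar>pd \<mu> f x\<bar> \<le> M"
    unfolding bounded_iff by (force simp: real_norm_def)
  have fc: "continuous_on UNIV f"
    using df by (simp add: continuous_on_eq_continuous_at differentiable_imp_continuous_within)
  have [measurable]: "f \<in> borel_measurable borel" "pd \<mu> f \<in> borel_measurable borel"
    by (auto intro: borel_measurable_continuous_onI fc cont)
  have Dm [measurable]: "D n \<in> borel_measurable borel" for n unfolding D_def by measurable
  have "integrable lborel (\<lambda>x. indicator (cball 0 R) x *\<^sub>R f x)"
    by (intro borel_integrable_compact compact_cball continuous_on_subset[OF fc]) auto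
  moreover have "(\<lambda>x. indicator (cball 0 R) x *\<^sub>R f x) = f"
    using R X(2) by (fastforce simp: indicator_def fun_eq_iff)
  ultimately have fi: "integrable lborel f" by simp
  have fs: "integrable lborel (\<lambda>x. f (x + c))" "(\<integral>x. f (x + c) \<partial>lborel) = (\<integral>x. f x \<partial>lborel)" for c
  proof -
    have "(\<integral>x. f x \<partial>(distr lborel borel ((+) c))) = (\<integral>x. f (c + x) \<partial>lborel)"
      by (rule integral_distr) auto
    then show "(\<integral>x. f (x + c) \<partial>lborel) = (\<integral>x. f x \<partial>lborel)"
      by (simp add: lborel_distr_plus add.commute)
    have "integrable (distr lborel borel ((+) c)) f" using fi by (simp add: lborel_distr_plus)
    then show "integrable lborel (\<lambda>x. f (x + c))" by (subst (asm) integrable_distr_eq) (auto simp: add.commute)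
  qed
  have D0: "(\<integral>x. D n x \<partial>lborel) = 0" for n
    unfolding D_def using fs[of "h n *\<^sub>R e"] fi by simp
  have mvt: "\<exists>t. 0 < t \<and> t < h n \<and> D n x = pd \<mu> f (x + t *\<^sub>R e)" for n x
  proof -
    have "((\<lambda>t. f (x + t *\<^sub>R e)) has_real_derivative pd \<mu> f (x + t *\<^sub>R e)) (at t)" for t
      unfolding e_def by (rule pd_line[OF df])
    from MVT2[OF h(1)[of n] this]
    obtain t where "0 < t" "t < h n" "f (x + h n *\<^sub>R e) - f x = h n * pd \<mu> f (x + t *\<^sub>R e)"
      by auto
    then show ?thesis using h(1)[of n] by (intro exI[of _ t]) (simp add: D_def)
  qed
  have lim: "(\<lambda>n. D n x) \<longlonglongrightarrow> pd \<mu> f x" for x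
  proof -
    have "((\<lambda>t. f (x + t *\<^sub>R e)) has_real_derivative pd \<mu> f (x + 0 *\<^sub>R e)) (at 0)"
      unfolding e_def by (rule pd_line[OF df])
    then have "((\<lambda>t. (f (x + t *\<^sub>R e) - f x) / t) \<longlongrightarrow> pd \<mu> f x) (at 0)"
      unfolding DERIV_def by simp
    moreover have "filterlim h (at 0) sequentially"
      unfolding filterlim_at using LIMSEQ_inverse_real_of_nat by (auto simp: h_def[abs_def])
    ultimately show ?thesis unfolding D_def by (rule filterlim_compose)
  qed
  have bound: "norm (D n x) \<le> indicator (cball 0 (R + 1)) x *\<^sub>R M" for n x
  proof (cases "norm x \<le> R + 1")
    case True
    obtain t where t: "0 < t" "t < h n" "D n x = pd \<mu> f (x + t *\<^sub>R e)" using mvt by blast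
    have "norm (x + t *\<^sub>R e) \<le> R + 2"
      by (rule order_trans[OF norm_triangle_ineq]) (use t h(2)[of n] True in \<open>simp add: e_def\<close>)
    then show ?thesis using M True t by simp
  next
    case False
    have "norm x - norm (h n *\<^sub>R e) \<le> norm (x + h n *\<^sub>R e)" by (rule norm_diff_ineq)
    then have "norm (x + h n *\<^sub>R e) > R" using False h[of n] by (simp add: e_def)
    then have "f (x + h n *\<^sub>R e) = 0" "f x = 0" using R X(2) False by force+
    then show ?thesis using False by (simp add: D_def)
  qed
  have w: "integrable lborel (\<lambda>x. indicator (cball (0 :: real ^ 'd) (R + 1)) x *\<^sub>R M)"
    by (intro borel_integrable_compact compact_cball continuous_intros)
  have "(\<lambda>n. \<integral>x. D n x \<partial>lborel) \<longlonglongrightarrow> (\<integral>x. pd \<mu> f x \<partial>lborel)"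
    by (rule integral_dominated_convergence[OF _ _ w]) (use lim bound in auto)
  then have I: "(\<integral>x. pd \<mu> f x \<partial>lborel) = 0" by (simp add: D0 LIMSEQ_const_iff)
  have "integrable lborel (pd \<mu> f)"
    by (rule integrable_dominated_convergence[where s = D, OF _ _ w]) (use lim bound in auto)
  from has_integral_integral_lborel[OF this] I show ?thesis by simp
qed

lemma pd_outside:
  assumes "closed X" "\<And>x. x \<notin> X \<Longrightarrow> f x = 0" "x \<notin> X"
  shows "pd \<mu> f x = 0"
  using pd_cong_open[of "- X" x f "\<lambda>_. 0" \<mu>] assms by auto

lemma pds_outside:
  assumes "closed X" "\<And>x. x \<notin> X \<Longrightarrow> f x = 0" "x \<notin> X"
  shows "pds s f x = 0"
  using assms(3) by (induction s arbitrary: x) (auto intro: pd_outside assms)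

text \<open>V and the complement of X are open and cover the space; f is smooth on the first and
  zero on the second, hence differentiable everywhere with a continuous derivative.\<close>

lemma has_integral_pd_compact_support:
  fixes f :: "'d::finite scalar"
  assumes V: "open V" and sm: "smooth_on V f"
    and X: "compact X" "X \<subseteq> V" "\<And>x. x \<notin> X \<Longrightarrow> f x = 0"
  shows "(pd \<mu> f has_integral 0) V"
proof -
  have oX: "open (- X)" using X(1) by (simp add: compact_imp_closed open_Compl)
  have U: "V \<union> - X = UNIV" using X by auto
  have "f differentiable at x" for x
  proof (cases "x \<in> V")
    case False
    then have x: "x \<in> - X" using X by auto
    have "(f has_derivative (\<lambda>_. 0)) (at x)"
      by (rule has_derivative_transform_within_open[OF has_derivative_const[of 0] oX x])
        (use X in auto)
    then show ?thesis by (auto simp: differentiable_def)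
  qed (rule smooth_on_differentiable[OF sm V])
  moreover have pd0: "pd \<mu> f x = 0" if "x \<notin> X" for x
    using pd_outside[OF compact_imp_closed] X that by blast
  moreover have "continuous_on (- X) (pd \<mu> f)"
    by (rule continuous_on_eq[OF continuous_on_const[of _ 0]]) (use pd0 in auto)
  then have "continuous_on (V \<union> - X) (pd \<mu> f)"
    by (intro continuous_on_open_Un V oX smooth_on_continuous_on[OF smooth_on_pd[OF sm]])
  ultimately have "(pd \<mu> f has_integral 0) UNIV"
    using has_integral_pd_zero[OF _ _ compact_imp_bounded[OF X(1)]] X(3) U by metis
  moreover have "pd \<mu> f = (\<lambda>x. if x \<in> V then pd \<mu> f x else 0)"
    using pd0 X by (auto simp: fun_eq_iff)
  ultimately show ?thesis using has_integral_restrict_UNIV[of V "pd \<mu> f" 0] by simp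
qed

lemma integral_by_parts:
  fixes P Q :: "'d::finite scalar"
  assumes V: "open V" and sm: "smooth_on V P" "smooth_on V Q"
    and X: "compact X" "X \<subseteq> V" "\<And>x. x \<notin> X \<Longrightarrow> Q x = 0"
  shows "((\<lambda>x. P x * pd \<mu> Q x + pd \<mu> P x * Q x) has_integral 0) V"
proof -
  have "(pd \<mu> (\<lambda>x. P x * Q x) has_integral 0) V"
    by (rule has_integral_pd_compact_support[OF V smooth_on_mult[OF V sm] X(1,2)]) (simp add: X)
  then show ?thesis
    by (rule has_integral_eq[rotated])
      (simp add: pd_mult smooth_on_differentiable[OF _ V] sm)
qed

text \<open>Each letter moved from Q to P costs a sign and lands on the inner side of P, so the
  version that can be proved by induction has the reversed string.\<close>

lemma integral_by_parts_pds:
  fixes P Q :: "'d::finite scalar"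
  assumes V: "open V" and sm: "smooth_on V P" "smooth_on V Q"
    and X: "compact X" "X \<subseteq> V" "\<And>x. x \<notin> X \<Longrightarrow> Q x = 0"
  shows "((\<lambda>x. P x * pds s Q x - (-1) ^ length s * pds s P x * Q x) has_integral 0) V"
proof -
  have "((\<lambda>x. P x * pds s Q x - (-1) ^ length s * pds (rev s) P x * Q x) has_integral 0) V"
    using sm(1)
  proof (induction s arbitrary: P)
    case (Cons \<mu> s)
    have 1: "((\<lambda>x. P x * pd \<mu> (pds s Q) x + pd \<mu> P x * pds s Q x) has_integral 0) V"
      by (rule integral_by_parts[OF V Cons.prems smooth_on_pds[OF sm(2)] X(1,2)])
        (rule pds_outside[OF compact_imp_closed[OF X(1)] X(3)])
    have 2: "((\<lambda>x. pd \<mu> P x * pds s Q x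
        - (-1) ^ length s * pds (rev s) (pd \<mu> P) x * Q x) has_integral 0) V"
      by (rule Cons.IH[OF smooth_on_pd[OF Cons.prems]])
    from has_integral_diff[OF 1 2] show ?case by (simp add: pds_append)
  qed simp
  then show ?thesis by (rule has_integral_eq[rotated]) (simp add: pds_rev[OF sm(1) V])
qed

section \<open>A smooth bump function built from exp (-1/t)\<close>

definition flat_exp :: "nat \<Rightarrow> real \<Rightarrow> real" where
  "flat_exp k t = (if t \<le> 0 then 0 else exp (- 1 / t) / t ^ k)"

lemma power_le_exp:
  assumes "0 \<le> x" shows "x ^ n \<le> fact n * exp (x::real)"
proof -
  have "(\<Sum>i\<in>{n}. x ^ i /\<^sub>R fact i) \<le> (\<Sum>i. x ^ i /\<^sub>R fact i)"
    by (rule sum_le_suminf[OF summable_exp_generic]) (use assms in auto)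
  then show ?thesis by (simp add: exp_def field_simps)
qed

text \<open>The term of degree k + 1 in the exponential series at \<open>1 / t\<close> beats the
  denominator \<open>t ^ k\<close> with one power of t to spare, which gives the limit 0 at the
  origin.\<close>

lemma flat_exp_le: "\<bar>flat_exp k t\<bar> \<le> fact (Suc k) * \<bar>t\<bar>"
proof (cases "t \<le> 0")
  case True
  have "0 \<le> fact (Suc k) * \<bar>t\<bar>" by (intro mult_nonneg_nonneg) auto
  then show ?thesis using True by (simp only: flat_exp_def if_True abs_zero)
next
  case False
  have "(1 / t) ^ Suc k \<le> fact (Suc k) * exp (1 / t)" by (rule power_le_exp) (use False in simp)
  then have "exp (- 1 / t) \<le> fact (Suc k) * t ^ Suc k"
    using False by (simp add: exp_minus field_simps power_divide)
  then have "exp (- 1 / t) / t ^ k \<le> fact (Suc k) * t" using False by (simp add: field_simps)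
  then show ?thesis using False by (simp add: flat_exp_def)
qed

lemma flat_exp_derivative:
  "(flat_exp k has_real_derivative flat_exp (k + 2) t - real k * flat_exp (k + 1) t) (at t)"
proof -
  consider "t < 0" | "t = 0" | "t > 0" by linarith
  then show ?thesis
  proof cases
    case 1
    have "((\<lambda>_. 0) has_real_derivative 0) (at t)" by simp
    then have "(flat_exp k has_real_derivative 0) (at t)"
      by (rule DERIV_cong_ev[THEN iffD1, rotated -1])
        (use eventually_nhds_in_open[of "{..<0}" t] 1 in \<open>auto simp: flat_exp_def elim!: eventually_mono\<close>)
    then show ?thesis using 1 by (simp add: flat_exp_def)
  next
    case 2
    \<comment> \<open>At the origin the difference quotient of \<open>flat_exp k\<close> is
      \<open>flat_exp (Suc k)\<close>, so the derivative is a limit of the next member of the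
      family.\<close>
    have "((\<lambda>s. flat_exp (Suc k) s) \<longlongrightarrow> 0) (at 0)"
    proof (rule Lim_null_comparison)
      show "eventually (\<lambda>s. norm (flat_exp (Suc k) s) \<le> fact (Suc (Suc k)) * \<bar>s\<bar>) (at 0)"
        unfolding real_norm_def by (intro always_eventually allI flat_exp_le)
      have "((\<lambda>s::real. fact (Suc (Suc k)) * \<bar>s\<bar>) \<longlongrightarrow> fact (Suc (Suc k)) * \<bar>0\<bar>) (at 0)"
        by (intro tendsto_intros)
      then show "((\<lambda>s::real. fact (Suc (Suc k)) * \<bar>s\<bar>) \<longlongrightarrow> 0) (at 0)" by simp
    qed
    then have "((\<lambda>s. (flat_exp k (0 + s) - flat_exp k 0) / s) \<longlongrightarrow> 0) (at 0)"
      by (rule Lim_transform_eventually)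
        (auto simp: flat_exp_def eventually_at_filter intro!: always_eventually)
    then show ?thesis using 2 unfolding DERIV_def by (simp add: flat_exp_def)
  next
    case 3
    have "((\<lambda>t. exp (- 1 / t) / t ^ k) has_real_derivative
        flat_exp (k + 2) t - real k * flat_exp (k + 1) t) (at t)"
    proof (cases k)
      case 0
      then show ?thesis using 3
        by (auto intro!: derivative_eq_intros simp: flat_exp_def field_simps power2_eq_square)
    next
      case (Suc m)
      then show ?thesis using 3
        by (auto intro!: derivative_eq_intros simp: flat_exp_def divide_simps power2_eq_square)
           (cases m; simp add: algebra_simps)+
    qed
    then show ?thesis
      by (rule DERIV_cong_ev[THEN iffD1, rotated -1])
        (use eventually_nhds_in_open[of "{0<..}" t] 3 in \<open>auto simp: flat_exp_def elim!: eventually_mono\<close>)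
  qed
qed

text \<open>The denominators \<open>t ^ k\<close> make the family closed under differentiation up to
  linear combinations, so one induction on the order treats all k together.\<close>

lemma smooth_upto_flat_exp:
  assumes q: "smooth_on UNIV q"
  shows "smooth_upto n UNIV (\<lambda>x. flat_exp k (q x))"
proof (induction n arbitrary: k)
  have d: "((\<lambda>x. flat_exp k (q x)) has_derivative
     (\<lambda>v. (flat_exp (k + 2) (q x) - real k * flat_exp (k + 1) (q x)) * q' v)) (at x)"
    if "(q has_derivative q') (at x)" for k x q'
    using has_derivative_compose[OF that flat_exp_derivative[of k "q x", unfolded has_field_derivative_def]]
    by (simp add: mult.commute)
  have dq: "q differentiable at x" for x using smooth_on_differentiable[OF q] by simp
  have D: "(\<lambda>x. flat_exp k (q x)) differentiable_on UNIV" for k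
    using d dq unfolding differentiable_on_def differentiable_def by blast
  case 0
  show ?case using D by simp
  case (Suc n)
  have "pd \<mu> (\<lambda>x. flat_exp k (q x))
      = (\<lambda>x. (flat_exp (k + 2) (q x) + - real k * flat_exp (k + 1) (q x)) * pd \<mu> q x)" for \<mu>
  proof
    fix x
    obtain q' where q': "(q has_derivative q') (at x)" using dq by (auto simp: differentiable_def)
    show "pd \<mu> (\<lambda>x. flat_exp k (q x)) x
      = (flat_exp (k + 2) (q x) + - real k * flat_exp (k + 1) (q x)) * pd \<mu> q x"
      by (simp add: pd_eq[OF d[OF q']] pd_eq[OF q'])
  qed
  moreover have "smooth_upto n UNIV
      (\<lambda>x. (flat_exp (k + 2) (q x) + - real k * flat_exp (k + 1) (q x)) * pd \<mu> q x)" for \<mu>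
    using smooth_on_pd[OF q] unfolding smooth_on_iff_upto
    by (intro smooth_upto_mult smooth_upto_add smooth_upto_const Suc) auto
  ultimately show ?case using D by simp
qed

text \<open>\<open>q\<close> is a polynomial in the coordinates and positive exactly on the open
  ball, so composing it with \<open>flat_exp 0\<close> gives a smooth cutoff at the sphere.\<close>

lemma bump_function:
  fixes x0 :: "real ^ 'd::finite"
  assumes "0 < r"
  obtains \<eta> where "smooth_on UNIV \<eta>" "\<And>x. 0 \<le> \<eta> x" "\<eta> x0 \<noteq> 0" "\<And>x. x \<notin> cball x0 r \<Longrightarrow> \<eta> x = 0"
proof
  define q :: "real ^ 'd \<Rightarrow> real" where "q x = r ^ 2 - (\<Sum>i\<in>UNIV. (x $ i - x0 $ i) ^ 2)" for x
  have q: "q x = r ^ 2 - (dist x x0) ^ 2" for x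
    by (simp add: q_def dist_norm power2_norm_eq_inner)
      (simp add: inner_vec_def power2_eq_square)
  have "smooth_on UNIV q" unfolding q_def by (intro smooth_on_intros smooth_on_const smooth_on_component) auto
  then show "smooth_on UNIV (\<lambda>x. flat_exp 0 (q x))"
    unfolding smooth_on_iff_upto[of _ "\<lambda>x. flat_exp 0 (q x)"] by (blast intro: smooth_upto_flat_exp)
  show "0 \<le> flat_exp 0 (q x)" for x by (simp add: flat_exp_def)
  show "flat_exp 0 (q x0) \<noteq> 0" using assms by (simp add: flat_exp_def q)
  show "flat_exp 0 (q x) = 0" if "x \<notin> cball x0 r" for x
  proof -
    have "r < dist x x0" using that by (simp add: dist_commute)
    then have "r ^ 2 < (dist x x0) ^ 2" using assms by (intro power_strict_mono) auto
    then show ?thesis by (simp add: flat_exp_def q)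
  qed
qed

lemma fundamental_lemma:
  fixes G :: "'d::finite scalar"
  assumes V: "open V" and G: "continuous_on V G" and x0: "x0 \<in> V"
    and int: "\<And>\<eta> X. smooth_on UNIV \<eta> \<Longrightarrow> compact X \<Longrightarrow> X \<subseteq> V \<Longrightarrow> (\<forall>x. x \<notin> X \<longrightarrow> \<eta> x = 0) \<Longrightarrow>
      ((\<lambda>x. G x * \<eta> x) has_integral 0) V"
  shows "G x0 = 0"
proof (rule ccontr)
  assume ne: "G x0 \<noteq> 0"
  \<comment> \<open>Multiplication by \<open>G x0\<close> makes the value at x0 a square, so only
    the positive sign has to be treated.\<close>
  define H where "H x = G x0 * G x" for x
  have cH: "continuous_on V H" unfolding H_def by (intro continuous_intros G)
  have "H x0 > 0" using ne by (auto simp: H_def zero_less_mult_iff linorder_neq_iff)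
  have "open (H -` {0<..} \<inter> V)" using continuous_open_preimage[OF cH V, of "{0<..}"]
    by (simp add: Int_commute)
  moreover have "x0 \<in> H -` {0<..} \<inter> V" using x0 \<open>H x0 > 0\<close> by auto
  \<comment> \<open>A box is chosen because a continuous nonnegative function with integral 0 over a
    closed box vanishes on it; this is the contradiction at the end.\<close>
  ultimately obtain a b where ab: "x0 \<in> box a b" "cbox a b \<subseteq> H -` {0<..} \<inter> V"
    by (metis open_contains_cbox)
  obtain r where r: "0 < r" "cball x0 r \<subseteq> box a b"
    using open_contains_cball[of "box a b"] ab by auto
  obtain \<eta> where \<eta>: "smooth_on UNIV \<eta>" "\<And>x. 0 \<le> \<eta> x" "\<eta> x0 \<noteq> 0"
    "\<And>x. x \<notin> cball x0 r \<Longrightarrow> \<eta> x = 0" using bump_function[OF r(1)] by metis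
  have boxV: "box a b \<subseteq> V" using ab box_subset_cbox by blast
  have "((\<lambda>x. G x * \<eta> x) has_integral 0) V"
    by (rule int[OF \<eta>(1), of "cball x0 r"]) (use \<eta> r boxV in auto)
  from has_integral_mult_right[OF this, of "G x0"]
  have "((\<lambda>x. H x * \<eta> x) has_integral 0) V" by (simp add: H_def mult.assoc)
  then have "((\<lambda>x. if x \<in> cbox a b then H x * \<eta> x else 0) has_integral 0) V"
  proof (rule has_integral_eq[rotated])
    fix x assume "x \<in> V"
    have "\<eta> x = 0" if "x \<notin> cbox a b" using that \<eta>(4) r(2) box_subset_cbox[of a b] by blast
    then show "H x * \<eta> x = (if x \<in> cbox a b then H x * \<eta> x else 0)" by auto
  qed
  then have I: "((\<lambda>x. H x * \<eta> x) has_integral 0) (cbox a b)"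
    using ab by (subst (asm) has_integral_restrict) auto
  have "continuous_on (cbox a b) \<eta>"
    using smooth_on_continuous_on[OF \<eta>(1)] continuous_on_subset by blast
  moreover have "continuous_on (cbox a b) H" using cH ab continuous_on_subset by blast
  ultimately have "continuous_on (cbox a b) (\<lambda>x. H x * \<eta> x)" by (intro continuous_intros)
  moreover have "0 \<le> H x * \<eta> x" if "x \<in> box a b" for x
  proof -
    have "x \<in> H -` {0<..}" using that ab(2) box_subset_cbox[of a b] by blast
    then show ?thesis using \<eta>(2)[of x] by simp
  qed
  ultimately have "H x0 * \<eta> x0 = 0"
    using has_integral_0_cbox_imp_0[OF _ _ I] ab(1) box_subset_cbox[of a b] by blast
  then show False using \<open>H x0 > 0\<close> \<eta> by simp
qed

section \<open>Functions of jets\<close>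

lemma tendsto_fun_iff:
  fixes f :: "'i \<Rightarrow> 'k \<Rightarrow> 'b::topological_space"
  shows "(f \<longlongrightarrow> l) F \<longleftrightarrow> (\<forall>k. ((\<lambda>i. f i k) \<longlongrightarrow> l k) F)"
  using limitin_componentwise[of "\<lambda>_. euclidean" UNIV f l F]
  by (simp add: euclidean_product_topology)

lemma depends_only_onD:
  "depends_only_on X F \<Longrightarrow> (\<And>v. v \<in> X \<Longrightarrow> u v = w v) \<Longrightarrow> F u = F w"
  unfolding depends_only_on_def by blast

lemma jpd_has_derivative:
  assumes "(\<lambda>r. F (u(v := r))) differentiable at (u v)"
  shows "((\<lambda>r. F (u(v := r))) has_real_derivative jpd v F u) (at (u v))"
  using assms unfolding jpd_def
  by (metis DERIV_deriv_iff_real_differentiable)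

text \<open>The variables are released one after the other; each step is the mean value theorem in a
  single variable, together with the continuity of the partial derivative.\<close>

lemma jet_chain_rule_aux:
  fixes \<gamma> :: "'b::real_normed_vector \<Rightarrow> ('z, 'd) jet"
  assumes U: "open U" "u0 \<in> U"
    and cont: "\<And>v. continuous_on U (jpd v F)"
    and diff: "\<And>u v. u \<in> U \<Longrightarrow> (\<lambda>r. F (u(v := r))) differentiable at (u v)"
    and "finite Y"
    and \<gamma>: "\<And>v. v \<in> Y \<Longrightarrow> ((\<lambda>z. \<gamma> z v) has_derivative \<gamma>' v) (at y)" "\<And>v. v \<in> Y \<Longrightarrow> \<gamma> y v = u0 v"
  shows "((\<lambda>z. F (\<lambda>v. if v \<in> Y then \<gamma> z v else u0 v)) has_derivative
    (\<lambda>h. \<Sum>v\<in>Y. jpd v F u0 * \<gamma>' v h)) (at y)"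
  using \<open>finite Y\<close> \<gamma>
proof (induction Y)
  case empty
  then show ?case by simp
next
  case (insert w Y)
  \<comment> \<open>In \<open>m z\<close> the variables of Y already move, while w and all others
    keep their values in u0. The variable w is then released by a function update.\<close>
  define m where "m z = (\<lambda>v. if v \<in> Y then \<gamma> z v else u0 v)" for z
  have my: "m y = u0" using insert.prems by (auto simp: m_def fun_eq_iff)
  have mw: "m z w = u0 w" for z using insert.hyps by (simp add: m_def)
  have step: "(\<lambda>v. if v \<in> insert w Y then \<gamma> z v else u0 v) = (m z)(w := \<gamma> z w)" for z
    using insert.hyps by (auto simp: m_def)
  have IH: "((\<lambda>z. F (m z)) has_derivative (\<lambda>h. \<Sum>v\<in>Y. jpd v F u0 * \<gamma>' v h)) (at y)"
    unfolding m_def using insert by blast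
  define D where "D z = \<gamma> z w - u0 w" for z
  define q0 where "q0 = jpd w F u0"
  have Dd: "(D has_derivative \<gamma>' w) (at y)"
    unfolding D_def using has_derivative_diff[OF insert.prems(1)[of w] has_derivative_const[of "u0 w"]] by simp
  have Dy: "D y = 0" using insert.prems by (simp add: D_def)
  \<comment> \<open>The base point and the new coordinate vary independently, hence the product
    filter. Openness of U in the product topology keeps the updated jet inside U.\<close>
  have near: "\<exists>d>0. \<forall>z r. dist z y < d \<longrightarrow> \<bar>r - u0 w\<bar> < d \<longrightarrow>
      (m z)(w := r) \<in> U \<and> \<bar>jpd w F ((m z)(w := r)) - q0\<bar> < e" if "e > 0" for e
  proof -
    have lim: "((\<lambda>p. (m (fst p))(w := snd p)) \<longlongrightarrow> u0) (nhds y \<times>\<^sub>F nhds (u0 w))"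
      unfolding tendsto_fun_iff
    proof
      fix k
      have f: "filterlim fst (nhds y) (nhds y \<times>\<^sub>F nhds (u0 w))" by (rule filterlim_fst)
      have "((\<lambda>z. m z k) \<longlongrightarrow> m y k) (nhds y)"
      proof (cases "k \<in> Y")
        case True
        then have "isCont (\<lambda>z. \<gamma> z k) y" using has_derivative_continuous insert.prems(1) by blast
        then show ?thesis using True by (simp add: m_def isCont_def tendsto_nhds_iff)
      qed (simp add: m_def)
      from filterlim_compose[OF this f] have "((\<lambda>p. m (fst p) k) \<longlongrightarrow> u0 k) (nhds y \<times>\<^sub>F nhds (u0 w))"
        by (simp add: my)
      moreover have "((\<lambda>p. snd p) \<longlongrightarrow> u0 w) (nhds y \<times>\<^sub>F nhds (u0 w))" by (rule filterlim_snd)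
      ultimately show "((\<lambda>p. ((m (fst p))(w := snd p)) k) \<longlongrightarrow> u0 k) (nhds y \<times>\<^sub>F nhds (u0 w))"
        by (cases "k = w") auto
    qed
    have "open (jpd w F -` ball q0 e \<inter> U)"
      using cont U(1) by (simp add: continuous_on_open_vimage)
    then have "eventually (\<lambda>u. u \<in> jpd w F -` ball q0 e \<inter> U) (nhds u0)"
      by (rule eventually_nhds_in_open) (use U \<open>e > 0\<close> in \<open>simp add: q0_def\<close>)
    then have "eventually (\<lambda>u. u \<in> U \<and> \<bar>jpd w F u - q0\<bar> < e) (nhds u0)"
      by eventually_elim (simp add: dist_real_def abs_minus_commute)
    with lim have "eventually (\<lambda>p. (m (fst p))(w := snd p) \<in> U \<and>
        \<bar>jpd w F ((m (fst p))(w := snd p)) - q0\<bar> < e) (nhds y \<times>\<^sub>F nhds (u0 w))"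
      by (rule eventually_compose_filterlim[rotated])
    then obtain P Q where PQ: "eventually P (nhds y)" "eventually Q (nhds (u0 w))"
      "\<And>z r. P z \<Longrightarrow> Q r \<Longrightarrow> (m z)(w := r) \<in> U \<and> \<bar>jpd w F ((m z)(w := r)) - q0\<bar> < e"
      unfolding eventually_prod_filter by auto
    obtain d1 where d1: "d1 > 0" "\<And>z. dist z y < d1 \<Longrightarrow> P z"
      using PQ(1) unfolding eventually_nhds_metric by blast
    obtain d2 where d2: "d2 > 0" "\<And>r. dist r (u0 w) < d2 \<Longrightarrow> Q r"
      using PQ(2) unfolding eventually_nhds_metric by blast
    show ?thesis
      by (rule exI[of _ "min d1 d2"]) (use d1 d2 PQ(3) in \<open>auto simp: dist_real_def\<close>)
  qed
  have Dcont: "\<exists>d>0. \<forall>z. dist z y < d \<longrightarrow> \<bar>D z\<bar> < e" if "e > 0" for e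
    using has_derivative_continuous[OF Dd] that Dy
    unfolding continuous_at_eps_delta by (auto simp: dist_real_def)
  \<comment> \<open>The error of replacing the increment in w by the fixed slope \<open>q0\<close>
    times \<open>D\<close>. It is small compared with \<open>D\<close>, which is itself of first
    order, so \<open>R\<close> has derivative 0 at y.\<close>
  define R where "R z = F ((m z)(w := \<gamma> z w)) - F (m z) - q0 * D z" for z
  have small: "\<exists>d>0. \<forall>z. dist z y < d \<longrightarrow> \<bar>R z\<bar> \<le> e * \<bar>D z\<bar>" if "e > 0" for e
  proof -
    obtain d where d: "d > 0" and A: "\<And>z r. dist z y < d \<Longrightarrow> \<bar>r - u0 w\<bar> < d \<Longrightarrow>
      (m z)(w := r) \<in> U \<and> \<bar>jpd w F ((m z)(w := r)) - q0\<bar> < e" using near[OF \<open>e > 0\<close>] by blast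
    obtain d' where d': "d' > 0" "\<And>z. dist z y < d' \<Longrightarrow> \<bar>D z\<bar> < d" using Dcont[OF d] by blast
    have "\<bar>R z\<bar> \<le> e * \<bar>D z\<bar>" if z: "dist z y < min d d'" for z
    proof -
      \<comment> \<open>With the linear part subtracted, the derivative is below e on the whole
        segment, and one mean value bound estimates the error.\<close>
      define G where "G r = F ((m z)(w := r)) - q0 * r" for r
      have dG: "(G has_real_derivative (jpd w F ((m z)(w := r)) - q0)) (at r)"
        if "\<bar>r - u0 w\<bar> < d" for r
      proof -
        have "(m z)(w := r) \<in> U" using A z that by simp
        from jpd_has_derivative[OF diff[OF this, of w]]
        have "((\<lambda>r. F ((m z)(w := r))) has_real_derivative jpd w F ((m z)(w := r))) (at r)"
          by (simp only: fun_upd_upd fun_upd_same)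
        then show ?thesis unfolding G_def by (auto intro!: derivative_eq_intros)
      qed
      have seg: "\<bar>r - u0 w\<bar> < d" if "r \<in> closed_segment (u0 w) (\<gamma> z w)" for r
      proof -
        have "\<bar>D z\<bar> < d" using d'(2) z by simp
        moreover have "\<bar>r - u0 w\<bar> \<le> \<bar>D z\<bar>"
          using that by (auto simp: closed_segment_eq_real_ivl D_def split: if_splits)
        ultimately show ?thesis by simp
      qed
      have "norm (G (\<gamma> z w) - G (u0 w)) \<le> e * norm (\<gamma> z w - u0 w)"
      proof (rule field_differentiable_bound[of "closed_segment (u0 w) (\<gamma> z w)"])
        fix r assume r: "r \<in> closed_segment (u0 w) (\<gamma> z w)"
        show "(G has_field_derivative (jpd w F ((m z)(w := r)) - q0)) (at r within closed_segment (u0 w) (\<gamma> z w))"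
          using dG[OF seg[OF r]] by (rule has_field_derivative_at_within)
        have "\<bar>jpd w F ((m z)(w := r)) - q0\<bar> < e" using A[of z r] z seg[OF r] by simp
        then show "norm (jpd w F ((m z)(w := r)) - q0) \<le> e" by simp
      qed auto
      moreover have "(m z)(w := u0 w) = m z" using mw[of z] by (metis fun_upd_triv)
      ultimately show ?thesis by (simp add: G_def R_def D_def algebra_simps)
    qed
    then show ?thesis using d d' by (intro exI[of _ "min d d'"]) auto
  qed
  have "(R has_derivative (\<lambda>h. 0)) (at y)"
    unfolding has_derivative_at_alt
  proof (intro conjI allI impI)
    fix e :: real assume "e > 0"
    have bl: "bounded_linear (\<gamma>' w)" using Dd by (rule has_derivative_bounded_linear)
    then obtain K where K: "\<And>h. norm (\<gamma>' w h) \<le> norm h * K" "K > 0"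
      using bounded_linear.pos_bounded[OF bl] by blast
    obtain d1 where d1: "d1 > 0" "\<And>z. norm (z - y) < d1 \<Longrightarrow> norm (D z - D y - \<gamma>' w (z - y)) \<le> 1 * norm (z - y)"
      using Dd unfolding has_derivative_at_alt by (meson zero_less_one)
    \<comment> \<open>K bounds the derivative of \<open>D\<close>, and the additional 1 is the
      differentiability error of \<open>D\<close> at tolerance 1.\<close>
    have "e / (K + 1) > 0" using K \<open>e > 0\<close> by simp
    then obtain d2 where d2: "d2 > 0" "\<And>z. dist z y < d2 \<Longrightarrow> \<bar>R z\<bar> \<le> e / (K + 1) * \<bar>D z\<bar>"
      using small by blast
    have "\<bar>R z\<bar> \<le> e * norm (z - y)" if "norm (z - y) < min d1 d2" for z
    proof -
      have "\<bar>D z\<bar> \<le> (K + 1) * norm (z - y)"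
        using d1(2)[of z] that K(1)[of "z - y"] Dy by (simp add: algebra_simps)
      then have "e / (K + 1) * \<bar>D z\<bar> \<le> e / (K + 1) * ((K + 1) * norm (z - y))"
        using K \<open>e > 0\<close> by (intro mult_left_mono) auto
      also have "\<dots> = e * norm (z - y)" using K by simp
      finally show ?thesis using d2(2)[of z] that by (simp add: dist_norm)
    qed
    moreover have "R y = 0" using my mw[of y] insert.prems(2)[of w] by (simp add: R_def Dy)
    ultimately show "\<exists>d>0. \<forall>z. norm (z - y) < d \<longrightarrow> norm (R z - R y - 0) \<le> e * norm (z - y)"
      using d1 d2 by (intro exI[of _ "min d1 d2"]) auto
  qed (rule bounded_linear_zero)
  from has_derivative_add[OF has_derivative_add[OF this has_derivative_mult_right[OF Dd, of q0]] IH]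
  show ?case unfolding step R_def
    using insert.hyps by (simp add: q0_def)
qed

text \<open>Variables outside X may move in any way along the curve. Freezing them at their values
  at y does not change F and leads back to finitely many moving variables.\<close>

lemma jet_chain_rule:
  fixes \<gamma> :: "'b::real_normed_vector \<Rightarrow> ('z, 'd) jet"
  assumes "open U" "\<gamma> y \<in> U" "smooth_jet_function U F" "depends_only_on X F" "finite X"
    and \<gamma>: "\<And>v. v \<in> X \<Longrightarrow> ((\<lambda>z. \<gamma> z v) has_derivative \<gamma>' v) (at y)"
  shows "((\<lambda>z. F (\<gamma> z)) has_derivative (\<lambda>h. \<Sum>v\<in>X. jpd v F (\<gamma> y) * \<gamma>' v h)) (at y)"
proof -
  have c: "continuous_on U (jpd v F)" for v
    using spec[OF assms(3)[unfolded smooth_jet_function_def], of "[v]"] by simp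
  have d: "(\<lambda>r. F (u(v := r))) differentiable at (u v)" if "u \<in> U" for u v
    using spec[OF assms(3)[unfolded smooth_jet_function_def], of "[]"] that by simp
  have "((\<lambda>z. F (\<lambda>v. if v \<in> X then \<gamma> z v else \<gamma> y v)) has_derivative
    (\<lambda>h. \<Sum>v\<in>X. jpd v F (\<gamma> y) * \<gamma>' v h)) (at y)"
    by (rule jet_chain_rule_aux[OF assms(1,2) c d assms(5) \<gamma> refl])
  moreover have "F (\<lambda>v. if v \<in> X then \<gamma> z v else \<gamma> y v) = F (\<gamma> z)" for z
    by (rule depends_only_onD[OF assms(4)]) simp
  ultimately show ?thesis by simp
qed

lemma jpd_eq_0: "depends_only_on X F \<Longrightarrow> v \<notin> X \<Longrightarrow> jpd v F u = 0"
proof -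
  assume a: "depends_only_on X F" "v \<notin> X"
  then have "F (u(v := r)) = F u" for r by (intro depends_only_onD[OF a(1)]) auto
  then show ?thesis by (simp add: jpd_def)
qed

text \<open>\<open>jpd v F u\<close> is evaluated at the coordinate \<open>u v\<close> itself, so
  agreement on X determines it only if v lies in X; otherwise the derivative is 0.\<close>

lemma depends_only_on_jpd:
  assumes "depends_only_on X F" shows "depends_only_on X (jpd v F)"
proof (cases "v \<in> X")
  case True
  show ?thesis unfolding depends_only_on_def
  proof (intro allI impI)
    fix u w :: "('a, 'b) jet" assume e: "\<forall>v\<in>X. u v = w v"
    then have "F (u(v := r)) = F (w(v := r))" for r
      by (intro depends_only_onD[OF assms]) simp
    then show "jpd v F u = jpd v F w" using e True by (simp add: jpd_def)
  qed
next
  case False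
  then show ?thesis using jpd_eq_0[OF assms] by (simp add: depends_only_on_def)
qed

lemma smooth_jet_function_jpd: "smooth_jet_function U F \<Longrightarrow> smooth_jet_function U (jpd v F)"
  unfolding smooth_jet_function_def
proof
  fix vs :: "('a, 'b) jvar list"
  assume "\<forall>vs. continuous_on U (foldr jpd vs F) \<and>
     (\<forall>u\<in>U. \<forall>v. (\<lambda>r. foldr jpd vs F (u(v := r))) differentiable at (u v))"
  from spec[OF this, of "vs @ [v]"]
  show "continuous_on U (foldr jpd vs (jpd v F)) \<and>
    (\<forall>u\<in>U. \<forall>va. (\<lambda>r. foldr jpd vs (jpd v F) (u(va := r))) differentiable at (u va))" by simp
qed

text \<open>The chain rule expresses a derivative of the composite as a sum of products of
  derivatives of \<Phi> with composites of the same kind, with F replaced by its partial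
  derivatives; hence the induction on the order runs over all F.\<close>

lemma smooth_on_jet_function:
  assumes "open U" "smooth_jet_function U F" "depends_only_on X F" "finite X" and V: "open V"
    and \<Phi>: "\<And>v. v \<in> X \<Longrightarrow> smooth_on V (\<lambda>x. \<Phi> x v)" "\<And>x. x \<in> V \<Longrightarrow> \<Phi> x \<in> U"
  shows "smooth_on V (\<lambda>x. F (\<Phi> x))"
  unfolding smooth_on_iff_upto
proof
  fix n
  show "smooth_upto n V (\<lambda>x. F (\<Phi> x))"
    using assms(2,3)
  proof (induction n arbitrary: F)
    have D: "((\<lambda>x. F (\<Phi> x)) has_derivative (\<lambda>h. \<Sum>v\<in>X. jpd v F (\<Phi> x) * frechet_derivative (\<lambda>x. \<Phi> x v) (at x) h)) (at x)"
      if "x \<in> V" "smooth_jet_function U F" "depends_only_on X F" for F x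
      by (rule jet_chain_rule[where \<gamma> = \<Phi> and y = x, OF assms(1) \<Phi>(2)[OF that(1)] that(2,3) assms(4)])
        (metis \<Phi>(1) V frechet_derivative_works smooth_on_differentiable that(1))
    have D0: "(\<lambda>x. F (\<Phi> x)) differentiable_on V"
      if "smooth_jet_function U F" "depends_only_on X F" for F
      unfolding differentiable_on_def using D[OF _ that]
      by (meson differentiable_at_withinI differentiable_def)
    case 0
    then show ?case using D0 by simp
    case (Suc n)
    have "smooth_upto n V (pd \<mu> (\<lambda>x. F (\<Phi> x)))" for \<mu>
    proof (rule smooth_upto_cong[OF V])
      have s: "smooth_upto n V (pd \<mu> (\<lambda>x. \<Phi> x v))" if "v \<in> X" for v
        using smooth_on_pd[OF \<Phi>(1)[OF that]] unfolding smooth_on_iff_upto by blast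
      show "smooth_upto n V (\<lambda>x. \<Sum>v\<in>X. jpd v F (\<Phi> x) * pd \<mu> (\<lambda>x. \<Phi> x v) x)"
        using s assms(4)
      proof (induction X rule: infinite_finite_induct)
        case (insert v X)
        have "smooth_upto n V (\<lambda>x. jpd v F (\<Phi> x))"
          using Suc.IH[OF smooth_jet_function_jpd[OF Suc.prems(1)] depends_only_on_jpd[OF Suc.prems(2)]] .
        then show ?case using insert
          by (simp, intro smooth_upto_add smooth_upto_mult V) auto
      qed (auto simp: smooth_upto_const)
      show "(\<Sum>v\<in>X. jpd v F (\<Phi> x) * pd \<mu> (\<lambda>x. \<Phi> x v) x) = pd \<mu> (\<lambda>x. F (\<Phi> x)) x" if "x \<in> V" for x
      proof -
        have "pd \<mu> (\<lambda>x. \<Phi> x v) x = frechet_derivative (\<lambda>x. \<Phi> x v) (at x) (axis \<mu> 1)" if "v \<in> X" for v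
          by (rule pd_eq) (metis \<Phi>(1) V frechet_derivative_works smooth_on_differentiable that \<open>x \<in> V\<close>)
        then show ?thesis using pd_eq[OF D[OF that Suc.prems]] by simp
      qed
    qed
    then show ?case using D0[OF Suc.prems] by simp
  qed
qed

section \<open>Polynomial functions of jets\<close>

inductive poly_jet :: "(('z, 'd) jet \<Rightarrow> real) \<Rightarrow> bool" where
  poly_const: "poly_jet (\<lambda>u. c)"
| poly_var: "poly_jet (\<lambda>u. u v)"
| poly_add: "poly_jet F \<Longrightarrow> poly_jet G \<Longrightarrow> poly_jet (\<lambda>u. F u + G u)"
| poly_mult: "poly_jet F \<Longrightarrow> poly_jet G \<Longrightarrow> poly_jet (\<lambda>u. F u * G u)"

lemma poly_sum: "(\<And>i. i \<in> I \<Longrightarrow> poly_jet (F i)) \<Longrightarrow> poly_jet (\<lambda>u. \<Sum>i\<in>I. F i u)"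
  by (induction I rule: infinite_finite_induct) (auto intro: poly_jet.intros)

lemma poly_minus: "poly_jet F \<Longrightarrow> poly_jet (\<lambda>u. - F u)"
  using poly_mult[OF poly_const[of "-1"], of F] by simp

lemma poly_diff: "poly_jet F \<Longrightarrow> poly_jet G \<Longrightarrow> poly_jet (\<lambda>u. F u - G u)"
  using poly_add[OF _ poly_minus, of F G] by simp

lemma poly_power: "poly_jet F \<Longrightarrow> poly_jet (\<lambda>u. F u ^ n)"
  by (induction n) (auto intro: poly_jet.intros)

lemmas poly_intros = poly_const poly_var poly_add poly_mult poly_sum poly_minus poly_diff poly_power

lemma poly_differentiable: "poly_jet F \<Longrightarrow> (\<lambda>r. F (u(v := r))) differentiable at r0"
proof (induction rule: poly_jet.induct)
  case (poly_var w)
  then show ?case by (cases "v = w") auto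
qed auto

lemma jpd_has_derivative_poly:
  "poly_jet F \<Longrightarrow> ((\<lambda>r. F (u(v := r))) has_real_derivative jpd v F u) (at (u v))"
  by (intro jpd_has_derivative poly_differentiable)

lemma jpd_eqI: "((\<lambda>r. F (u(v := r))) has_real_derivative D) (at (u v)) \<Longrightarrow> jpd v F u = D"
  unfolding jpd_def by (rule DERIV_imp_deriv)

lemma jpd_const [simp]: "jpd v (\<lambda>u. c) = (\<lambda>u. 0)"
  by (rule ext, rule jpd_eqI) auto

lemma jpd_var: "jpd v (\<lambda>u. u w) = (\<lambda>u. if v = w then 1 else 0)"
  by (rule ext, rule jpd_eqI) (cases "v = w"; auto)

lemma jpd_add: "poly_jet F \<Longrightarrow> poly_jet G \<Longrightarrow> jpd v (\<lambda>u. F u + G u) = (\<lambda>u. jpd v F u + jpd v G u)"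
  by (rule ext, rule jpd_eqI) (intro DERIV_add jpd_has_derivative_poly)

lemma jpd_mult:
  "poly_jet F \<Longrightarrow> poly_jet G \<Longrightarrow> jpd v (\<lambda>u. F u * G u) = (\<lambda>u. jpd v F u * G u + F u * jpd v G u)"
proof (rule ext, rule jpd_eqI)
  fix u assume "poly_jet F" "poly_jet G"
  from DERIV_mult[OF this[THEN jpd_has_derivative_poly, of u v]]
  show "((\<lambda>r. F (u(v := r)) * G (u(v := r))) has_real_derivative
      jpd v F u * G u + F u * jpd v G u) (at (u v))" by (simp add: mult.commute)
qed

lemma jpd_minus: "poly_jet F \<Longrightarrow> jpd v (\<lambda>u. - F u) = (\<lambda>u. - jpd v F u)"
  using jpd_mult[OF poly_const[of "-1"], of F v] by simp

lemma jpd_diff: "poly_jet F \<Longrightarrow> poly_jet G \<Longrightarrow> jpd v (\<lambda>u. F u - G u) = (\<lambda>u. jpd v F u - jpd v G u)"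
  using jpd_add[OF _ poly_minus, of F G v] jpd_minus[of G v] by simp

lemma jpd_cmult: "poly_jet F \<Longrightarrow> jpd v (\<lambda>u. c * F u) = (\<lambda>u. c * jpd v F u)"
  using jpd_mult[OF poly_const[of c], of F v] by simp

lemma jpd_sum:
  "(\<And>i. i \<in> I \<Longrightarrow> poly_jet (F i)) \<Longrightarrow> jpd v (\<lambda>u. \<Sum>i\<in>I. F i u) = (\<lambda>u. \<Sum>i\<in>I. jpd v (F i) u)"
  by (induction I rule: infinite_finite_induct) (auto simp: jpd_add poly_sum)

text \<open>Closure under \<open>jpd\<close> makes every polynomial a smooth function of jets, and
  lets the field equations of the examples be computed by rewriting.\<close>

lemma poly_jpd: "poly_jet F \<Longrightarrow> poly_jet (jpd v F)"
  by (induction rule: poly_jet.induct)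
    (auto simp: jpd_var jpd_add jpd_mult intro: poly_jet.intros)

lemma poly_continuous: "poly_jet F \<Longrightarrow> continuous_on U F"
  by (induction rule: poly_jet.induct) (auto intro!: continuous_intros
    intro: continuous_on_subset[OF continuous_on_product_coordinates])

lemma poly_smooth: assumes "poly_jet F" shows "smooth_jet_function U F"
proof -
  have "poly_jet (foldr jpd vs F)" for vs
    by (induction vs) (auto simp: assms poly_jpd)
  then show ?thesis unfolding smooth_jet_function_def
    using poly_continuous poly_differentiable by blast
qed

lemma finite_strings [simp]: "finite {s :: 'd::finite list. length s \<le> n}"
  using finite_lists_length_le[of "UNIV :: 'd set" n] by simp

lemma jvars_alt:
  "jvars N Q n = (\<lambda>(z, s). Zeta z s) ` (UNIV \<times> {s. length s \<le> n})
     \<union> (\<lambda>(k, s). Psi k s) ` ({..<N} \<times> {s. length s \<le> n}) \<union> Inv ` {..<Q}"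
  by (auto simp: jvars_def image_iff)

lemma finite_jvars [simp]: "finite (jvars N Q n :: ('z::finite, 'd::finite) jvar set)"
  unfolding jvars_alt by auto

lemma sum_jvars:
  fixes f :: "('z::finite, 'd::finite) jvar \<Rightarrow> 'b::comm_monoid_add"
  shows "sum f (jvars N Q n) = (\<Sum>z\<in>UNIV. \<Sum>s | length s \<le> n. f (Zeta z s))
    + (\<Sum>k<N. \<Sum>s | length s \<le> n. f (Psi k s)) + (\<Sum>p<Q. f (Inv p))"
proof -
  have "sum f ((\<lambda>(z, s). Zeta z s) ` (UNIV \<times> {s. length s \<le> n}))
    = (\<Sum>z\<in>UNIV. \<Sum>s | length s \<le> n. f (Zeta z s))"
    by (subst sum.reindex) (auto simp: inj_on_def sum.cartesian_product intro!: sum.cong)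
  moreover have "sum f ((\<lambda>(k, s). Psi k s) ` ({..<N} \<times> {s. length s \<le> n}))
    = (\<Sum>k<N. \<Sum>s | length s \<le> n. f (Psi k s))"
    by (subst sum.reindex) (auto simp: inj_on_def sum.cartesian_product intro!: sum.cong)
  moreover have "sum f (Inv ` {..<Q}) = (\<Sum>p<Q. f (Inv p))"
    by (subst sum.reindex) (auto simp: inj_on_def)
  ultimately show ?thesis unfolding jvars_alt
    by (subst sum.union_disjoint; auto)+
qed

lemma jet_simps [simp]:
  "jet \<zeta> \<psi> x (Zeta z s) = pds s (\<zeta> z) x" "jet \<zeta> \<psi> x (Psi k s) = pds s (\<psi> k) x"
  "jet \<zeta> \<psi> x (Inv p) = 0"
  by (auto simp: jet_def)

section \<open>First variation and conservation\<close>

lemma depends_only_on_zetaD: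
  "depends_only_on (jvars 0 0 n) F \<Longrightarrow> (\<And>z s. u (Zeta z s) = w (Zeta z s)) \<Longrightarrow> F u = F w"
  by (rule depends_only_onD) (auto simp: jvars_def)

lemma insert_invariants_simps [simp]:
  "insert_invariants c u (Zeta z s) = u (Zeta z s)" "insert_invariants c u (Psi k s) = u (Psi k s)"
  by (auto simp: insert_invariants_def split: setting.splits)

lemma insert_invariants_Inv: "c = Invariants Q I \<Longrightarrow> insert_invariants c u (Inv p) = I p u"
  by (simp add: insert_invariants_def)

lemma insert_not_Invariants: "\<not> is_Invariants c \<Longrightarrow> insert_invariants c u = u"
  by (cases c) (auto simp: insert_invariants_def)

lemma test_paramE:
  assumes "test_param V \<epsilon>"
  obtains X where "compact X" "X \<subseteq> V" "\<And>a x. x \<notin> X \<Longrightarrow> \<epsilon> a x = 0" "\<And>a. smooth_on V (\<epsilon> a)"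
  using assms unfolding test_param_def smooth_param_def by blast

text \<open>What the conservation proof must know about a connection or a metric.
  \<open>domain_zeta\<close> keeps a jet in the domain when its slots are filled,
  \<open>covdiv_adjoint\<close> is the integrated identity behind the current, and
  \<open>make_current_inj\<close> recovers the Euler derivative from the current. In
  \<open>covdiv_adjoint\<close> the plain Euler derivative multiplies the transformation, while the
  current is built from \<open>zeta_euler\<close>; for a metric the two differ by
  symmetrization.\<close>

locale sector_laws =
  fixes V :: "(real ^ 'd::finite) set" and K :: "('z::finite, 'd, 'a::finite) sector"
  assumes open_V: "open V"
    and open_domain: "open (jet_domain K)"
    and domain_zeta: "\<And>u w. u \<in> jet_domain K \<Longrightarrow> (\<And>z s. u (Zeta z s) = w (Zeta z s)) \<Longrightarrow> w \<in> jet_domain K"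
    and admissible_smooth: "\<And>\<zeta> z. admissible K \<zeta> \<Longrightarrow> smooth_on V (\<zeta> z)"
    and admissible_domain: "\<And>\<zeta> \<psi> x. admissible K \<zeta> \<Longrightarrow> x \<in> V \<Longrightarrow> jet \<zeta> \<psi> x \<in> jet_domain K"
    and zeta_tr_smooth:
      "\<And>\<zeta> \<epsilon> z. admissible K \<zeta> \<Longrightarrow> smooth_param V \<epsilon> \<Longrightarrow> smooth_on V (zeta_tr K \<zeta> \<epsilon> z)"
    and zeta_tr_support: "\<And>\<zeta> \<epsilon> X z x. closed X \<Longrightarrow> (\<And>a x. x \<notin> X \<Longrightarrow> \<epsilon> a x = 0) \<Longrightarrow>
      x \<notin> X \<Longrightarrow> zeta_tr K \<zeta> \<epsilon> z x = 0"
    and covdiv_adjoint: "\<And>\<zeta> \<epsilon> X n L \<Phi>. admissible K \<zeta> \<Longrightarrow> compact X \<Longrightarrow> X \<subseteq> V \<Longrightarrow>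
      (\<And>a x. x \<notin> X \<Longrightarrow> \<epsilon> a x = 0) \<Longrightarrow> (\<And>a. smooth_on V (\<epsilon> a)) \<Longrightarrow>
      (\<And>z. smooth_on V (euler n L (Zeta z) \<Phi>)) \<Longrightarrow>
      ((\<lambda>x. (\<Sum>z\<in>UNIV. euler n L (Zeta z) \<Phi> x * zeta_tr K \<zeta> \<epsilon> z x)
        + (\<Sum>a\<in>UNIV. \<epsilon> a x * covdiv K \<zeta> (make_current K \<zeta> (zeta_euler K n L \<Phi>)) a x)) has_integral 0) V"
    and covdiv_smooth: "\<And>\<zeta> n L \<Phi> a. admissible K \<zeta> \<Longrightarrow> (\<And>z. smooth_on V (euler n L (Zeta z) \<Phi>)) \<Longrightarrow>
      smooth_on V (covdiv K \<zeta> (make_current K \<zeta> (zeta_euler K n L \<Phi>)) a)"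
    and make_current_inj: "\<And>\<zeta> n L \<Phi> x z. admissible K \<zeta> \<Longrightarrow> x \<in> V \<Longrightarrow>
      (\<And>\<mu> a. make_current K \<zeta> (zeta_euler K n L \<Phi>) \<mu> a x = 0) \<Longrightarrow> zeta_euler K n L \<Phi> z x = 0"
begin

context
  fixes T :: "('z, 'd, 'a) field_theory"
  assumes T: "invariant_theory V K T"
begin

abbreviation "full_jet \<zeta> \<psi> \<equiv> (\<lambda>y. insert_invariants (setting T) (jet \<zeta> \<psi> y))"

lemma L_inv_local: "smooth_jet_function (jet_domain K) (L_inv T)"
  "depends_only_on (jvars (matter T) (n_invariants (setting T)) (deriv_order T)) (L_inv T)"
  using T by (auto simp: invariant_theory_def local_function_def)

lemma invariants_local:
  assumes "setting T = Invariants Q I" "p < Q"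
  shows "smooth_jet_function (jet_domain K) (I p)" "depends_only_on (jvars 0 0 (deriv_order T)) (I p)"
    "local_invariant V K (I p)"
  using T assms by (auto simp: invariant_theory_def proper_setting_def local_function_def)

lemma n_invariantsE:
  assumes "p < n_invariants (setting T)"
  obtains Q I where "setting T = Invariants Q I" "p < Q"
  using assms by (cases "setting T") (auto simp: n_invariants_def)

lemma full_jet_domain:
  assumes "fields V K T \<zeta> \<psi>" "x \<in> V" shows "full_jet \<zeta> \<psi> x \<in> jet_domain K"
  by (rule domain_zeta[OF admissible_domain[of \<zeta> x \<psi>]]) (use assms in \<open>auto simp: fields_def\<close>)

lemma full_jet_smooth:
  assumes f: "fields V K T \<zeta> \<psi>" and v: "v \<in> jvars (matter T) (n_invariants (setting T)) (deriv_order T)"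
  shows "smooth_on V (\<lambda>x. full_jet \<zeta> \<psi> x v)"
proof -
  have adm: "admissible K \<zeta>" using f by (simp add: fields_def)
  have zs: "smooth_on V (pds s (\<zeta> z))" for z s by (rule smooth_on_pds[OF admissible_smooth[OF adm]])
  show ?thesis
  proof (cases v)
    case (Inv p)
    then have "p < n_invariants (setting T)" using v by (auto simp: jvars_def)
    then obtain Q I where I: "setting T = Invariants Q I" "p < Q" by (rule n_invariantsE)
    have "smooth_on V (\<lambda>x. I p (jet \<zeta> \<psi> x))"
    proof (rule smooth_on_jet_function[OF open_domain invariants_local(1,2)[OF I] finite_jvars open_V])
      fix w :: "('z, 'd) jvar" assume "w \<in> jvars 0 0 (deriv_order T)"
      then obtain z s where "w = Zeta z s" by (auto simp: jvars_def)
      then show "smooth_on V (\<lambda>x. jet \<zeta> \<psi> x w)" using zs by simp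
    qed (rule admissible_domain[OF adm])
    then show ?thesis using Inv I by (simp add: insert_invariants_Inv)
  qed (use f v zs in \<open>auto simp: jvars_def fields_def intro: smooth_on_pds\<close>)
qed

lemma momentum_smooth:
  assumes "fields V K T \<zeta> \<psi>"
  shows "smooth_on V (\<lambda>x. jpd v (L_inv T) (full_jet \<zeta> \<psi> x))"
  by (rule smooth_on_jet_function[OF open_domain smooth_jet_function_jpd[OF L_inv_local(1)]
        depends_only_on_jpd[OF L_inv_local(2)] _ open_V])
    (use assms in \<open>auto intro: full_jet_smooth full_jet_domain\<close>)

lemma euler_smooth:
  assumes "fields V K T \<zeta> \<psi>"
  shows "smooth_on V (euler n (L_inv T) c (full_jet \<zeta> \<psi>))"
  unfolding euler_def[abs_def]
  by (intro smooth_on_intros open_V smooth_on_const momentum_smooth[OF assms])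

lemma variation_formula:
  assumes f: "fields V K T \<zeta> \<psi>" and x: "x \<in> V"
    and \<delta>: "\<And>z. smooth_on V (\<delta>\<zeta> z)" "\<And>k. k < matter T \<Longrightarrow> smooth_on V (\<delta>\<psi> k)"
    and inv: "\<And>Q I p. setting T = Invariants Q I \<Longrightarrow> p < Q \<Longrightarrow>
      variation (I p) \<zeta> (\<lambda>_ _. 0) \<delta>\<zeta> (\<lambda>_ _. 0) x = 0"
  shows "variation (inv_density T) \<zeta> \<psi> \<delta>\<zeta> \<delta>\<psi> x =
    (\<Sum>z\<in>UNIV. \<Sum>s | length s \<le> deriv_order T.
       jpd (Zeta z s) (L_inv T) (full_jet \<zeta> \<psi> x) * pds s (\<delta>\<zeta> z) x) +
    (\<Sum>k<matter T. \<Sum>s | length s \<le> deriv_order T.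
       jpd (Psi k s) (L_inv T) (full_jet \<zeta> \<psi> x) * pds s (\<delta>\<psi> k) x)"
proof -
  define \<zeta>t where "\<zeta>t t = (\<lambda>z y. \<zeta> z y + t * \<delta>\<zeta> z y)" for t :: real
  define \<psi>t where "\<psi>t t = (\<lambda>k y. \<psi> k y + t * \<delta>\<psi> k y)" for t :: real
  define \<gamma> where "\<gamma> t = full_jet (\<zeta>t t) (\<psi>t t) x" for t
  define \<gamma>' where "\<gamma>' v = (case v of Zeta z s \<Rightarrow> pds s (\<delta>\<zeta> z) x | Psi k s \<Rightarrow> pds s (\<delta>\<psi> k) x | Inv p \<Rightarrow> 0)" for v
  have \<zeta>s: "smooth_on V (\<zeta> z)" for z using f by (simp add: fields_def admissible_smooth)
  have zt: "pds s (\<zeta>t t z) x = pds s (\<zeta> z) x + t * pds s (\<delta>\<zeta> z) x" for s t z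
    unfolding \<zeta>t_def by (rule pds_linear[OF open_V \<zeta>s \<delta>(1) x])
  have pt: "pds s (\<psi>t t k) x = pds s (\<psi> k) x + t * pds s (\<delta>\<psi> k) x" if "k < matter T" for s t k
    unfolding \<psi>t_def using that f by (intro pds_linear[OF open_V _ \<delta>(2) x]) (auto simp: fields_def)
  have \<gamma>0: "\<gamma> 0 = full_jet \<zeta> \<psi> x" by (simp add: \<gamma>_def \<zeta>t_def \<psi>t_def)
  have der: "((\<lambda>t. \<gamma> t v) has_derivative (\<lambda>h. h * \<gamma>' v)) (at 0)"
    if v: "v \<in> jvars (matter T) (n_invariants (setting T)) (deriv_order T)" for v
  proof (cases v)
    case (Zeta z s)
    have "((\<lambda>t. pds s (\<zeta> z) x + t * pds s (\<delta>\<zeta> z) x) has_derivative (\<lambda>h. h * pds s (\<delta>\<zeta> z) x)) (at 0)"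
      by (auto intro!: derivative_eq_intros)
    then show ?thesis using Zeta by (simp add: \<gamma>_def zt \<gamma>'_def)
  next
    case (Psi k s)
    have k: "k < matter T" using v Psi by (auto simp: jvars_def)
    have "((\<lambda>t. pds s (\<psi> k) x + t * pds s (\<delta>\<psi> k) x) has_derivative (\<lambda>h. h * pds s (\<delta>\<psi> k) x)) (at 0)"
      by (auto intro!: derivative_eq_intros)
    then show ?thesis using Psi by (simp add: \<gamma>_def pt[OF k] \<gamma>'_def)
  next
    case (Inv p)
    then have "p < n_invariants (setting T)" using v by (auto simp: jvars_def)
    then obtain Q I where I: "setting T = Invariants Q I" "p < Q" by (rule n_invariantsE)
    \<comment> \<open>\<open>local_invariant\<close> is phrased with vanishing matter fields, hence
      a second curve, written in the form to which \<open>variation\<close> unfolds.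
      \<open>I p\<close> sees only the variables of \<zeta> and takes the same values along both
      curves.\<close>
    define \<gamma>0 where "\<gamma>0 t = jet (\<zeta>t t) (\<lambda>k y. 0 + t * 0) x" for t
    have "((\<lambda>t. I p (\<gamma>0 t)) has_derivative
        (\<lambda>h. \<Sum>v\<in>jvars 0 0 (deriv_order T). jpd v (I p) (\<gamma>0 0) * (h * \<gamma>' v))) (at 0)"
    proof (rule jet_chain_rule[where \<gamma> = \<gamma>0 and y = 0, OF open_domain _ invariants_local(1,2)[OF I]])
      have "\<gamma>0 0 = jet \<zeta> (\<lambda>_ _. 0) x" by (simp add: \<gamma>0_def \<zeta>t_def)
      then show "\<gamma>0 0 \<in> jet_domain K" using f x by (simp add: fields_def admissible_domain)
      fix w :: "('z, 'd) jvar" assume "w \<in> jvars 0 0 (deriv_order T)"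
      then obtain z s where w: "w = Zeta z s" by (auto simp: jvars_def)
      have "((\<lambda>t. pds s (\<zeta> z) x + t * pds s (\<delta>\<zeta> z) x) has_derivative (\<lambda>h. h * pds s (\<delta>\<zeta> z) x)) (at 0)"
        by (auto intro!: derivative_eq_intros)
      then show "((\<lambda>t. \<gamma>0 t w) has_derivative (\<lambda>h. h * \<gamma>' w)) (at 0)"
        using w by (simp add: \<gamma>0_def zt \<gamma>'_def)
    qed simp
    \<comment> \<open>Differentiability must come first: \<open>deriv\<close> has a value for every
      function, so a vanishing \<open>deriv\<close> alone yields no derivative.\<close>
    then have "(\<lambda>t. I p (\<gamma>0 t)) differentiable at 0" by (auto simp: differentiable_def)
    then have "((\<lambda>t. I p (\<gamma>0 t)) has_real_derivative deriv (\<lambda>t. I p (\<gamma>0 t)) 0) (at 0)"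
      using DERIV_deriv_iff_real_differentiable by blast
    moreover have "deriv (\<lambda>t. I p (\<gamma>0 t)) 0 = 0"
      using inv[OF I] by (simp add: variation_def \<gamma>0_def \<zeta>t_def)
    moreover have "I p (\<gamma>0 t) = \<gamma> t (Inv p)" for t
      unfolding \<gamma>_def insert_invariants_Inv[OF I(1)]
      by (rule depends_only_on_zetaD[OF invariants_local(2)[OF I]]) (simp add: \<gamma>0_def)
    ultimately show ?thesis using Inv by (simp add: \<gamma>'_def has_field_derivative_def lambda_zero)
  qed
  have "((\<lambda>t. L_inv T (\<gamma> t)) has_derivative
      (\<lambda>h. \<Sum>v\<in>jvars (matter T) (n_invariants (setting T)) (deriv_order T).
        jpd v (L_inv T) (\<gamma> 0) * (h * \<gamma>' v))) (at 0)"
    by (rule jet_chain_rule[where \<gamma> = \<gamma> and y = 0, OF open_domain _ L_inv_local])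
      (use full_jet_domain[OF f x] der in \<open>simp_all add: \<gamma>0\<close>)
  moreover have "(\<Sum>v\<in>jvars (matter T) (n_invariants (setting T)) (deriv_order T).
        jpd v (L_inv T) (\<gamma> 0) * (h * \<gamma>' v)) =
     (\<Sum>v\<in>jvars (matter T) (n_invariants (setting T)) (deriv_order T).
        jpd v (L_inv T) (\<gamma> 0) * \<gamma>' v) * h" for h
    unfolding sum_distrib_right by (intro sum.cong refl) (simp add: mult_ac)
  ultimately have "((\<lambda>t. L_inv T (\<gamma> t)) has_real_derivative
      (\<Sum>v\<in>jvars (matter T) (n_invariants (setting T)) (deriv_order T).
        jpd v (L_inv T) (\<gamma> 0) * \<gamma>' v)) (at 0)"
    by (simp add: has_field_derivative_def mult_commute_abs)
  then have "variation (inv_density T) \<zeta> \<psi> \<delta>\<zeta> \<delta>\<psi> x =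
      (\<Sum>v\<in>jvars (matter T) (n_invariants (setting T)) (deriv_order T).
        jpd v (L_inv T) (\<gamma> 0) * \<gamma>' v)"
    unfolding variation_def inv_density_def \<gamma>_def \<zeta>t_def \<psi>t_def by (rule DERIV_imp_deriv)
  then show ?thesis by (simp add: sum_jvars \<gamma>0 \<gamma>'_def)
qed

text \<open>Integration by parts is applied to each jet variable separately, and the signs assemble
  into Euler derivatives. Stating the result as one difference with integral 0 avoids speaking of
  the integral of either part.\<close>

lemma first_variation:
  assumes f: "fields V K T \<zeta> \<psi>"
    and \<delta>: "\<And>z. smooth_on V (\<delta>\<zeta> z)" "\<And>k. k < matter T \<Longrightarrow> smooth_on V (\<delta>\<psi> k)"
    and X: "compact X" "X \<subseteq> V" "\<And>z x. x \<notin> X \<Longrightarrow> \<delta>\<zeta> z x = 0" "\<And>k x. x \<notin> X \<Longrightarrow> \<delta>\<psi> k x = 0"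
    and inv: "\<And>Q I p x. setting T = Invariants Q I \<Longrightarrow> p < Q \<Longrightarrow> x \<in> V \<Longrightarrow>
      variation (I p) \<zeta> (\<lambda>_ _. 0) \<delta>\<zeta> (\<lambda>_ _. 0) x = 0"
  shows "((\<lambda>x. variation (inv_density T) \<zeta> \<psi> \<delta>\<zeta> \<delta>\<psi> x
    - ((\<Sum>z\<in>UNIV. euler (deriv_order T) (L_inv T) (Zeta z) (full_jet \<zeta> \<psi>) x * \<delta>\<zeta> z x)
      + (\<Sum>k<matter T. euler (deriv_order T) (L_inv T) (Psi k) (full_jet \<zeta> \<psi>) x * \<delta>\<psi> k x))) has_integral 0) V"
proof -
  define P where "P v x = jpd v (L_inv T) (full_jet \<zeta> \<psi> x)" for v x
  define S :: "'d list set" where "S = {s. length s \<le> deriv_order T}"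
  have S: "finite S" by (simp add: S_def)
  have sm: "smooth_on V (P v)" for v unfolding P_def by (rule momentum_smooth[OF f])
  have "((\<lambda>x. (\<Sum>z\<in>UNIV. \<Sum>s\<in>S. P (Zeta z s) x * pds s (\<delta>\<zeta> z) x
        - (-1) ^ length s * pds s (P (Zeta z s)) x * \<delta>\<zeta> z x)
      + (\<Sum>k<matter T. \<Sum>s\<in>S. P (Psi k s) x * pds s (\<delta>\<psi> k) x
        - (-1) ^ length s * pds s (P (Psi k s)) x * \<delta>\<psi> k x)) has_integral
      (\<Sum>z\<in>(UNIV :: 'z set). \<Sum>s\<in>S. 0) + (\<Sum>k<matter T. \<Sum>s\<in>S. 0)) V"
    by (intro has_integral_add has_integral_sum S integral_by_parts_pds[OF open_V sm _ X(1,2)])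
      (use \<delta> X in auto)
  then show ?thesis
    by (rule has_integral_eq_rhs[OF has_integral_eq[rotated]])
      (use variation_formula[OF f _ \<delta>] inv in \<open>auto simp: euler_def P_def[abs_def] S_def
         sum_subtractf sum_distrib_right\<close>)
qed

text \<open>The first identity uses the invariance of the action under the joint transformation; the
  second holds for any transformation of \<psi> alone, because then the slots do not move. Neither
  uses a field equation, so both are available off-shell.\<close>

lemma invariance_identity:
  assumes f: "fields V K T \<zeta> \<psi>" and \<epsilon>: "test_param V \<epsilon>"
  shows "((\<lambda>x. (\<Sum>k<matter T. euler (deriv_order T) (L_inv T) (Psi k) (full_jet \<zeta> \<psi>) x * matter_tr T \<zeta> \<psi> \<epsilon> k x)
    - (\<Sum>a\<in>UNIV. \<epsilon> a x * covdiv K \<zeta> (current K T \<zeta> \<psi>) a x)) has_integral 0) V"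
    "((\<lambda>x. variation (inv_density T) \<zeta> \<psi> (\<lambda>_ _. 0) (matter_tr T \<zeta> \<psi> \<epsilon>) x -
      (\<Sum>k<matter T. euler (deriv_order T) (L_inv T) (Psi k) (full_jet \<zeta> \<psi>) x * matter_tr T \<zeta> \<psi> \<epsilon> k x))
      has_integral 0) V"
proof -
  obtain X where X: "compact X" "X \<subseteq> V" "\<And>a x. x \<notin> X \<Longrightarrow> \<epsilon> a x = 0" "\<And>a. smooth_on V (\<epsilon> a)"
    using test_paramE[OF \<epsilon>] by metis
  have cX: "closed X" by (rule compact_imp_closed[OF X(1)])
  have sp: "smooth_param V \<epsilon>" using X(4) by (simp add: smooth_param_def)
  have adm: "admissible K \<zeta>" using f by (simp add: fields_def)
  have ms: "smooth_on V (matter_tr T \<zeta> \<psi> \<epsilon> k)" if "k < matter T" for k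
    unfolding matter_tr_def[abs_def] using T f that X(4)
    by (intro smooth_on_intros open_V) (auto simp: invariant_theory_def)
  have m0: "matter_tr T \<zeta> \<psi> \<epsilon> k x = 0" if "x \<notin> X" for k x
    unfolding matter_tr_def using pds_outside[OF cX X(3) that] by simp
  show "((\<lambda>x. variation (inv_density T) \<zeta> \<psi> (\<lambda>_ _. 0) (matter_tr T \<zeta> \<psi> \<epsilon>) x -
      (\<Sum>k<matter T. euler (deriv_order T) (L_inv T) (Psi k) (full_jet \<zeta> \<psi>) x * matter_tr T \<zeta> \<psi> \<epsilon> k x))
      has_integral 0) V"
    using first_variation[OF f smooth_on_const ms X(1,2) refl m0] by (simp add: variation_def)
  have "((\<lambda>x. variation (inv_density T) \<zeta> \<psi> (zeta_tr K \<zeta> \<epsilon>) (matter_tr T \<zeta> \<psi> \<epsilon>) x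
    - ((\<Sum>z\<in>UNIV. euler (deriv_order T) (L_inv T) (Zeta z) (full_jet \<zeta> \<psi>) x * zeta_tr K \<zeta> \<epsilon> z x)
      + (\<Sum>k<matter T. euler (deriv_order T) (L_inv T) (Psi k) (full_jet \<zeta> \<psi>) x * matter_tr T \<zeta> \<psi> \<epsilon> k x)))
     has_integral 0) V"
    by (rule first_variation[OF f zeta_tr_smooth[OF adm sp] ms X(1,2) zeta_tr_support[OF cX X(3)] m0])
      (use invariants_local(3) adm sp in \<open>auto simp: local_invariant_def\<close>)
  note 1 = this
  have "(variation (inv_density T) \<zeta> \<psi> (zeta_tr K \<zeta> \<epsilon>) (matter_tr T \<zeta> \<psi> \<epsilon>) has_integral 0) V"
    using T f \<epsilon> by (simp add: invariant_theory_def invariant_action_def)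
  from has_integral_diff[OF this 1] have "((\<lambda>x. (\<Sum>z\<in>UNIV. euler (deriv_order T) (L_inv T) (Zeta z) (full_jet \<zeta> \<psi>) x * zeta_tr K \<zeta> \<epsilon> z x)
      + (\<Sum>k<matter T. euler (deriv_order T) (L_inv T) (Psi k) (full_jet \<zeta> \<psi>) x * matter_tr T \<zeta> \<psi> \<epsilon> k x))
      has_integral 0) V"
    by simp
  from has_integral_diff[OF this covdiv_adjoint[where \<epsilon> = \<epsilon> and X = X
      and n = "deriv_order T", OF adm X euler_smooth[OF f]]]
  show "((\<lambda>x. (\<Sum>k<matter T. euler (deriv_order T) (L_inv T) (Psi k) (full_jet \<zeta> \<psi>) x * matter_tr T \<zeta> \<psi> \<epsilon> k x)
    - (\<Sum>a\<in>UNIV. \<epsilon> a x * covdiv K \<zeta> (current K T \<zeta> \<psi>) a x)) has_integral 0) V"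
    by (simp add: current_def source_def)
qed

text \<open>Changing a matter variable commutes with filling the slots. For \<psi> it therefore
  makes no difference whether the invariants are held constant, and the matter equations of the
  whole theory are those of \<open>L_inv\<close>.\<close>

lemma jpd_Psi_total:
  assumes f: "fields V K T \<zeta> \<psi>" and y: "y \<in> V"
  shows "jpd (Psi k s) (total_density T) (jet \<zeta> \<psi> y) = jpd (Psi k s) (L_inv T) (full_jet \<zeta> \<psi> y)"
proof -
  let ?u = "jet \<zeta> \<psi> y" and ?v = "Psi k s :: ('z, 'd) jvar"
  obtain c where c: "(case setting T of Extra Lg \<Rightarrow> Lg (?u(?v := r)) | _ \<Rightarrow> 0) = c" for r
  proof (cases "setting T")
    case (Extra Lg)
    then have "depends_only_on (jvars 0 0 (deriv_order T)) Lg"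
      using T by (auto simp: invariant_theory_def proper_setting_def local_function_def)
    then have "Lg (?u(?v := r)) = Lg ?u" for r by (rule depends_only_on_zetaD) simp
    then show ?thesis using that[of "Lg ?u"] Extra by simp
  qed auto
  have "inv_density T (?u(?v := r)) = L_inv T ((full_jet \<zeta> \<psi> y)(?v := r))" for r
    unfolding inv_density_def
  proof (rule depends_only_onD[OF L_inv_local(2)])
    fix w :: "('z, 'd) jvar" assume w: "w \<in> jvars (matter T) (n_invariants (setting T)) (deriv_order T)"
    show "insert_invariants (setting T) (?u(?v := r)) w = ((full_jet \<zeta> \<psi> y)(?v := r)) w"
    proof (cases w)
      case (Inv p)
      then have "p < n_invariants (setting T)" using w by (auto simp: jvars_def)
      then obtain Q I where I: "setting T = Invariants Q I" "p < Q" by (rule n_invariantsE)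
      have "I p (?u(?v := r)) = I p ?u" by (rule depends_only_on_zetaD[OF invariants_local(2)[OF I]]) simp
      then show ?thesis using Inv I by (simp add: insert_invariants_Inv)
    qed auto
  qed
  then have eq: "total_density T (?u(?v := r)) = L_inv T ((full_jet \<zeta> \<psi> y)(?v := r)) + c" for r
    using c[of r] by (simp add: total_density_def)
  have "\<forall>u\<in>jet_domain K. \<forall>v. (\<lambda>r. L_inv T (u(v := r))) differentiable at (u v)"
    using spec[OF L_inv_local(1)[unfolded smooth_jet_function_def], of "[]"] by simp
  then have "(\<lambda>r. L_inv T ((full_jet \<zeta> \<psi> y)(?v := r))) differentiable at (full_jet \<zeta> \<psi> y ?v)"
    using full_jet_domain[OF f y] by blast
  from DERIV_add[OF jpd_has_derivative[OF this] DERIV_const[of c]]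
  have "((\<lambda>r. total_density T (?u(?v := r))) has_real_derivative
      jpd ?v (L_inv T) (full_jet \<zeta> \<psi> y)) (at (?u ?v))"
    by (simp only: eq insert_invariants_simps add_0_right)
  then show ?thesis by (rule jpd_eqI)
qed

lemma euler_Psi_total:
  assumes f: "fields V K T \<zeta> \<psi>" and x: "x \<in> V"
  shows "euler n (total_density T) (Psi k) (jet \<zeta> \<psi>) x = euler n (L_inv T) (Psi k) (full_jet \<zeta> \<psi>) x"
  unfolding euler_def
  by (intro sum.cong arg_cong2[where f = "(*)"] refl pds_cong_open[OF open_V _ x] jpd_Psi_total[OF f])

lemma conserved: "conserved_on_shell V K T"
  unfolding conserved_on_shell_def
proof (intro allI impI ballI)
  fix \<zeta> \<psi> a x
  assume conf: "configuration V K T \<zeta> \<psi>" and shell: "on_shell V K T \<zeta> \<psi>" and x: "x \<in> V"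
  have f: "fields V K T \<zeta> \<psi>" using conf by (simp add: configuration_def)
  then have adm: "admissible K \<zeta>" by (simp add: fields_def)
  have sm: "smooth_on V (covdiv K \<zeta> (current K T \<zeta> \<psi>) a)"
    unfolding current_def source_def by (rule covdiv_smooth[OF adm euler_smooth[OF f]])
  show "covdiv K \<zeta> (current K T \<zeta> \<psi>) a x = 0"
  proof (rule fundamental_lemma[OF open_V smooth_on_continuous_on[OF sm] x])
    fix \<eta> X assume \<eta>: "smooth_on UNIV \<eta>" "compact X" "X \<subseteq> V" "\<forall>x. x \<notin> X \<longrightarrow> \<eta> x = 0"
    \<comment> \<open>A parameter with the single component a isolates one component of the
      divergence.\<close>
    define \<epsilon> where "\<epsilon> = (\<lambda>b. if b = a then \<eta> else (\<lambda>_. 0))"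
    have "test_param V \<epsilon>"
      unfolding test_param_def smooth_param_def \<epsilon>_def using \<eta> smooth_on_subset[OF \<eta>(1), of V]
      by (auto intro!: exI[of _ X])
    from invariance_identity(1)[OF f this]
    have "((\<lambda>x. - (\<Sum>b\<in>UNIV. \<epsilon> b x * covdiv K \<zeta> (current K T \<zeta> \<psi>) b x)) has_integral 0) V"
      by (rule has_integral_eq[rotated])
        (use shell in \<open>auto simp: on_shell_def euler_Psi_total[OF f]\<close>)
    moreover have "(\<Sum>b\<in>UNIV. \<epsilon> b x * covdiv K \<zeta> (current K T \<zeta> \<psi>) b x)
        = (\<Sum>b\<in>UNIV. if b = a then \<eta> x * covdiv K \<zeta> (current K T \<zeta> \<psi>) b x else 0)" for x
      by (intro sum.cong) (auto simp: \<epsilon>_def)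
    ultimately have "((\<lambda>x. - (covdiv K \<zeta> (current K T \<zeta> \<psi>) a x * \<eta> x)) has_integral 0) V"
      by (simp add: mult.commute)
    from has_integral_neg[OF this]
    show "((\<lambda>x. covdiv K \<zeta> (current K T \<zeta> \<psi>) a x * \<eta> x) has_integral 0) V" by simp
  qed
qed

lemma not_divergence_identically_zero:
  assumes "\<not> invariant_under_matter_alone V K T"
  shows "\<not> divergence_identically_zero V K T"
proof
  assume div: "divergence_identically_zero V K T"
  have "invariant_under_matter_alone V K T"
    unfolding invariant_under_matter_alone_def
  proof (intro allI impI)
    fix \<zeta> \<psi> and \<epsilon> :: "('a, 'd) param" assume conf: "configuration V K T \<zeta> \<psi>" and \<epsilon>: "test_param V \<epsilon>"
    have f: "fields V K T \<zeta> \<psi>" using conf by (simp add: configuration_def)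
    \<comment> \<open>In the sum of the two identities the Euler terms of \<psi> cancel.\<close>
    have "((\<lambda>x. variation (inv_density T) \<zeta> \<psi> (\<lambda>_ _. 0) (matter_tr T \<zeta> \<psi> \<epsilon>) x -
        (\<Sum>a\<in>UNIV. \<epsilon> a x * covdiv K \<zeta> (current K T \<zeta> \<psi>) a x)) has_integral 0) V"
      using has_integral_add[OF invariance_identity[OF f \<epsilon>]] by (simp add: algebra_simps)
    then show "(variation (inv_density T) \<zeta> \<psi> (\<lambda>_ _. 0) (matter_tr T \<zeta> \<psi> \<epsilon>) has_integral 0) V"
      by (rule has_integral_eq[rotated]) (use div conf in \<open>auto simp: divergence_identically_zero_def\<close>)
  qed
  then show False using assms by simp
qed

text \<open>A vanishing current forces the source to vanish. On-shell the Euler derivative of the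
  total density vanishes as well, so nothing would remain for the extra terms to contribute.\<close>

lemma not_current_zero_on_shell:
  assumes "extra_terms_contribute V K T"
  shows "\<not> current_zero_on_shell V K T"
proof
  assume zero: "current_zero_on_shell V K T"
  obtain \<zeta> \<psi> z x where x: "x \<in> V" and conf: "configuration V K T \<zeta> \<psi>" and shell: "on_shell V K T \<zeta> \<psi>"
    and ne: "zeta_euler K (deriv_order T) (total_density T) (jet \<zeta> \<psi>) z x - source K T \<zeta> \<psi> z x \<noteq> 0"
    using assms unfolding extra_terms_contribute_def by blast
  have adm: "admissible K \<zeta>" using conf by (simp add: configuration_def fields_def)
  \<comment> \<open>For a background \<zeta> the total density is \<open>L_inv\<close> itself, so
    the extra contribution is identically 0 and the assumption excludes this setting.\<close>
  have nb: "\<not> is_Background (setting T)"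
  proof
    assume b: "is_Background (setting T)"
    then have "total_density T = L_inv T" "full_jet \<zeta> \<psi> = jet \<zeta> \<psi>"
      by (auto simp: total_density_def inv_density_def insert_invariants_def fun_eq_iff split: setting.splits)
    then show False using ne by (simp add: source_def)
  qed
  have "source K T \<zeta> \<psi> z x = 0"
    unfolding source_def using zero conf shell x
    by (intro make_current_inj[OF adm x])
      (auto simp: current_zero_on_shell_def current_def source_def)
  moreover have "zeta_euler K (deriv_order T) (total_density T) (jet \<zeta> \<psi>) z x = 0"
    using shell nb x by (simp add: on_shell_def)
  ultimately show False using ne by simp
qed

end

end

section \<open>Gauge connection and metric\<close>

definition lie_br :: "('a::finite \<Rightarrow> 'a \<Rightarrow> 'a \<Rightarrow> real) \<Rightarrow> ('a \<Rightarrow> real) \<Rightarrow> ('a \<Rightarrow> real) \<Rightarrow> 'a \<Rightarrow> real" where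
  "lie_br C x y a = (\<Sum>b\<in>UNIV. \<Sum>c\<in>UNIV. C a b c * x b * y c)"

lemma structure_constantsD:
  assumes "structure_constants C"
  shows "C a b c = - C b a c" "C a b c = - C a c b" "C a b c = - C c b a"
    "(\<Sum>e\<in>UNIV. C a b e * C e c d + C a c e * C e d b + C a d e * C e b c) = 0"
proof -
  have 1: "C a b c = - C b a c" for a b c using assms unfolding structure_constants_def by blast
  have 2: "C a b c = - C a c b" for a b c using assms unfolding structure_constants_def by blast
  show "C a b c = - C b a c" by (rule 1)
  show "C a b c = - C a c b" by (rule 2)
  show "C a b c = - C c b a" using 1[of a b c] 2[of b a c] 1[of b c a] by simp
  show "(\<Sum>e\<in>UNIV. C a b e * C e c d + C a c e * C e d b + C a d e * C e b c) = 0"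
    using assms unfolding structure_constants_def by blast
qed

lemma lie_br_add: "lie_br C (\<lambda>a. x a + y a) z a = lie_br C x z a + lie_br C y z a"
  "lie_br C z (\<lambda>a. x a + y a) a = lie_br C z x a + lie_br C z y a"
  by (simp_all add: lie_br_def algebra_simps sum.distrib)

lemma lie_br_scale: "lie_br C (\<lambda>a. r * x a) z a = r * lie_br C x z a"
  "lie_br C z (\<lambda>a. r * x a) a = r * lie_br C z x a"
  by (simp_all add: lie_br_def sum_distrib_left mult_ac)

lemma lie_br_antisym:
  assumes "structure_constants C" shows "lie_br C x y a = - lie_br C y x a"
proof -
  have "lie_br C x y a = (\<Sum>c\<in>UNIV. \<Sum>b\<in>UNIV. C a b c * x b * y c)"
    unfolding lie_br_def by (rule sum.swap)
  also have "\<dots> = (\<Sum>c\<in>UNIV. \<Sum>b\<in>UNIV. - (C a c b * y c * x b))"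
    by (intro sum.cong refl) (subst structure_constantsD(2)[OF assms], simp)
  finally show ?thesis by (simp add: lie_br_def sum_negf)
qed

text \<open>Exchanging the outer indices of C shows that bracketing with y is skew for the standard
  inner product. This is why parameters and currents share one covariant derivative, and why sums of
  squares of adjoint fields are invariant.\<close>

lemma dot_lie_br:
  assumes "structure_constants C"
  shows "(\<Sum>a\<in>UNIV. x a * lie_br C y z a) = - (\<Sum>a\<in>UNIV. z a * lie_br C y x a)"
proof -
  have "(\<Sum>a\<in>UNIV. x a * lie_br C y z a) = (\<Sum>a\<in>UNIV. \<Sum>b\<in>UNIV. \<Sum>c\<in>UNIV. C a b c * x a * y b * z c)"
    by (simp add: lie_br_def sum_distrib_left mult_ac)
  also have "\<dots> = (\<Sum>a\<in>UNIV. \<Sum>c\<in>UNIV. \<Sum>b\<in>UNIV. C a b c * x a * y b * z c)"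
    by (intro sum.cong refl sum.swap)
  also have "\<dots> = (\<Sum>c\<in>UNIV. \<Sum>a\<in>UNIV. \<Sum>b\<in>UNIV. C a b c * x a * y b * z c)" by (rule sum.swap)
  also have "\<dots> = (\<Sum>c\<in>UNIV. \<Sum>b\<in>UNIV. \<Sum>a\<in>UNIV. C a b c * x a * y b * z c)"
    by (intro sum.cong refl sum.swap)
  also have "\<dots> = (\<Sum>c\<in>UNIV. \<Sum>b\<in>UNIV. \<Sum>a\<in>UNIV. - (C c b a * x a * y b * z c))"
    by (intro sum.cong refl) (subst structure_constantsD(3)[OF assms], simp)
  finally show ?thesis by (simp add: lie_br_def sum_distrib_left sum_negf mult_ac)
qed

lemma dot_lie_br_self:
  assumes "structure_constants C" shows "(\<Sum>a\<in>UNIV. x a * lie_br C x y a) = 0"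
proof -
  have "(\<Sum>a\<in>UNIV. x a * lie_br C x y a) = (\<Sum>a\<in>UNIV. x a * - lie_br C y x a)"
    by (intro sum.cong refl arg_cong2[where f = "(*)"] lie_br_antisym[OF assms])
  then show ?thesis using dot_lie_br[OF assms, of x y x] by (simp add: sum_negf)
qed

lemma lie_br_jacobi:
  assumes "structure_constants C"
  shows "lie_br C x (lie_br C y z) a + lie_br C y (lie_br C z x) a + lie_br C z (lie_br C x y) a = 0"
proof -
  have e: "lie_br C x (lie_br C y z) a
      = (\<Sum>b\<in>UNIV. \<Sum>c\<in>UNIV. \<Sum>d\<in>UNIV. (\<Sum>e\<in>UNIV. C a b e * C e c d) * (x b * y c * z d))" for x y z
  proof -
    have "lie_br C x (lie_br C y z) a
      = (\<Sum>b\<in>UNIV. \<Sum>e\<in>UNIV. \<Sum>c\<in>UNIV. \<Sum>d\<in>UNIV. C a b e * C e c d * (x b * y c * z d))"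
      by (simp add: lie_br_def sum_distrib_left mult_ac)
    also have "\<dots> = (\<Sum>b\<in>UNIV. \<Sum>c\<in>UNIV. \<Sum>e\<in>UNIV. \<Sum>d\<in>UNIV. C a b e * C e c d * (x b * y c * z d))"
      by (intro sum.cong refl sum.swap)
    also have "\<dots> = (\<Sum>b\<in>UNIV. \<Sum>c\<in>UNIV. \<Sum>d\<in>UNIV. \<Sum>e\<in>UNIV. C a b e * C e c d * (x b * y c * z d))"
      by (intro sum.cong refl sum.swap)
    finally show ?thesis by (simp add: sum_distrib_right)
  qed
  \<comment> \<open>Cyclic relabelling of the summation indices gives the three double brackets the
    common factor \<open>x b * y c * z d\<close>, so that the Jacobi identity for C applies.\<close>
  have rot: "(\<Sum>b\<in>UNIV. \<Sum>c\<in>UNIV. \<Sum>d\<in>UNIV. F b c d)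
      = (\<Sum>b\<in>UNIV. \<Sum>c\<in>UNIV. \<Sum>d\<in>UNIV. F c d b)" for F :: "'a \<Rightarrow> 'a \<Rightarrow> 'a \<Rightarrow> real"
  proof -
    have "(\<Sum>b\<in>UNIV. \<Sum>c\<in>UNIV. \<Sum>d\<in>UNIV. F b c d) = (\<Sum>b\<in>UNIV. \<Sum>d\<in>UNIV. \<Sum>c\<in>UNIV. F b c d)"
      by (intro sum.cong refl sum.swap)
    also have "\<dots> = (\<Sum>d\<in>UNIV. \<Sum>b\<in>UNIV. \<Sum>c\<in>UNIV. F b c d)" by (rule sum.swap)
    finally show ?thesis .
  qed
  have 2: "lie_br C y (lie_br C z x) a
    = (\<Sum>b\<in>UNIV. \<Sum>c\<in>UNIV. \<Sum>d\<in>UNIV. (\<Sum>e\<in>UNIV. C a c e * C e d b) * (x b * y c * z d))"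
    unfolding e by (subst rot) (simp add: mult_ac)
  have 3: "lie_br C z (lie_br C x y) a
    = (\<Sum>b\<in>UNIV. \<Sum>c\<in>UNIV. \<Sum>d\<in>UNIV. (\<Sum>e\<in>UNIV. C a d e * C e b c) * (x b * y c * z d))"
    unfolding e by (subst rot, subst rot) (simp add: mult_ac)
  have "lie_br C x (lie_br C y z) a + lie_br C y (lie_br C z x) a + lie_br C z (lie_br C x y) a
    = (\<Sum>b\<in>UNIV. \<Sum>c\<in>UNIV. \<Sum>d\<in>UNIV.
        (\<Sum>e\<in>UNIV. C a b e * C e c d + C a c e * C e d b + C a d e * C e b c) * (x b * y c * z d))"
    unfolding 2 3 e[of x y z] by (simp add: sum.distrib distrib_right)
  then show ?thesis using structure_constantsD(4)[OF assms] by simp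
qed

section \<open>The laws for a gauge connection\<close>

lemma gauge_sector_simps [simp]:
  "admissible (gauge_sector V C g) A \<longleftrightarrow> (\<forall>z. smooth_on V (A z))"
  "jet_domain (gauge_sector V C g) = UNIV"
  "zeta_tr (gauge_sector V C g) A \<epsilon> (\<mu>, a) =
    (\<lambda>x. pd \<mu> (\<epsilon> a) x + g * lie_br C (\<lambda>b. A (\<mu>, b) x) (\<lambda>b. \<epsilon> b x) a)"
  "bracket (gauge_sector V C g) \<epsilon> \<eta> a = (\<lambda>x. g * lie_br C (\<lambda>b. \<epsilon> b x) (\<lambda>b. \<eta> b x) a)"
  "zeta_euler (gauge_sector V C g) n L \<Phi> z = euler n L (Zeta z) \<Phi>"
  "make_current (gauge_sector V C g) A E \<mu> a = E (\<mu>, a)"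
  "covdiv (gauge_sector V C g) A j a =
    (\<lambda>x. \<Sum>\<mu>\<in>UNIV. pd \<mu> (j \<mu> a) x + g * lie_br C (\<lambda>b. A (\<mu>, b) x) (\<lambda>b. j \<mu> b x) a)"
  by (auto simp: gauge_sector_def lie_br_def fun_eq_iff)

lemma smooth_on_lie_br:
  assumes "open V" "\<And>a. smooth_on V (x a)" "\<And>a. smooth_on V (y a)"
  shows "smooth_on V (\<lambda>p. lie_br C (\<lambda>b. x b p) (\<lambda>b. y b p) a)"
  unfolding lie_br_def by (intro smooth_on_intros smooth_on_const assms)

lemma lie_br_zero [simp]: "lie_br C x (\<lambda>b. 0) a = 0" "lie_br C (\<lambda>b. 0) x a = 0"
  by (simp_all add: lie_br_def)

lemma sum_UNIV_prod:
  fixes f :: "'i::finite \<times> 'k::finite \<Rightarrow> real"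
  shows "(\<Sum>z\<in>UNIV. f z) = (\<Sum>i\<in>UNIV. \<Sum>k\<in>UNIV. f (i, k))"
  using sum.cartesian_product[of "\<lambda>i k. f (i, k)" UNIV UNIV] by simp

text \<open>In the adjointness law the derivative terms combine into integrations by parts, while
  the terms containing the connection cancel pointwise by skewness of the bracket.\<close>

lemma gauge_sector_laws:
  fixes V :: "(real ^ 'd::finite) set" and C :: "'a::finite \<Rightarrow> 'a \<Rightarrow> 'a \<Rightarrow> real"
  assumes V: "open V" and C: "structure_constants C"
  shows "sector_laws V (gauge_sector V C g)"
proof
  fix A :: "('d \<times> 'a, 'd) zfield" and \<epsilon> :: "('a, 'd) param" and z :: "'d \<times> 'a"
  assume A: "admissible (gauge_sector V C g) A" and \<epsilon>: "smooth_param V \<epsilon>"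
  obtain \<mu> a where z: "z = (\<mu>, a)" by (cases z)
  show "smooth_on V (zeta_tr (gauge_sector V C g) A \<epsilon> z)"
    unfolding z gauge_sector_simps
    by (intro smooth_on_intros smooth_on_lie_br smooth_on_const V)
      (use A \<epsilon> in \<open>auto simp: smooth_param_def\<close>)
next
  fix A :: "('d \<times> 'a, 'd) zfield" and \<epsilon> :: "('a, 'd) param" and X x and z :: "'d \<times> 'a"
  assume X: "closed X" "\<And>a x. x \<notin> X \<Longrightarrow> \<epsilon> a x = 0" "x \<notin> X"
  show "zeta_tr (gauge_sector V C g) A \<epsilon> z x = 0"
    using X(2)[OF X(3)] pd_outside[OF X(1,2,3)] by (cases z) simp
next
  fix A :: "('d \<times> 'a, 'd) zfield" and \<epsilon> :: "('a, 'd) param" and X n L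
    and \<Phi> :: "real ^ 'd \<Rightarrow> ('d \<times> 'a, 'd) jet"
  assume A: "admissible (gauge_sector V C g) A" and X: "compact X" "X \<subseteq> V" "\<And>a x. x \<notin> X \<Longrightarrow> \<epsilon> a x = 0"
    and \<epsilon>: "\<And>a. smooth_on V (\<epsilon> a)" and sm: "\<And>z. smooth_on V (euler n L (Zeta z) \<Phi>)"
  define e where "e z = euler n L (Zeta z) \<Phi>" for z
  have "((\<lambda>x. \<Sum>\<mu>\<in>UNIV. \<Sum>a\<in>UNIV. e (\<mu>, a) x * pd \<mu> (\<epsilon> a) x + pd \<mu> (e (\<mu>, a)) x * \<epsilon> a x) has_integral
      (\<Sum>\<mu>\<in>(UNIV :: 'd set). \<Sum>a\<in>(UNIV :: 'a set). 0)) V"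
    by (intro has_integral_sum integral_by_parts[OF V _ \<epsilon> X(1,2)]) (use sm X(3) in \<open>auto simp: e_def\<close>)
  then have I: "((\<lambda>x. \<Sum>\<mu>\<in>UNIV. \<Sum>a\<in>UNIV. e (\<mu>, a) x * pd \<mu> (\<epsilon> a) x + pd \<mu> (e (\<mu>, a)) x * \<epsilon> a x)
      has_integral 0) V" by simp
  have eq: "(\<Sum>z\<in>UNIV. e z x * zeta_tr (gauge_sector V C g) A \<epsilon> z x)
    + (\<Sum>a\<in>UNIV. \<epsilon> a x * covdiv (gauge_sector V C g) A (\<lambda>\<mu> a. e (\<mu>, a)) a x)
    = (\<Sum>\<mu>\<in>UNIV. \<Sum>a\<in>UNIV. e (\<mu>, a) x * pd \<mu> (\<epsilon> a) x + pd \<mu> (e (\<mu>, a)) x * \<epsilon> a x)" for x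
  proof -
    have 1: "(\<Sum>z\<in>UNIV. e z x * zeta_tr (gauge_sector V C g) A \<epsilon> z x)
      = (\<Sum>\<mu>\<in>UNIV. \<Sum>a\<in>UNIV. e (\<mu>, a) x * pd \<mu> (\<epsilon> a) x
        + g * (e (\<mu>, a) x * lie_br C (\<lambda>b. A (\<mu>, b) x) (\<lambda>b. \<epsilon> b x) a))"
      by (simp add: sum_UNIV_prod algebra_simps)
    have 2: "(\<Sum>a\<in>UNIV. \<epsilon> a x * covdiv (gauge_sector V C g) A (\<lambda>\<mu> a. e (\<mu>, a)) a x)
      = (\<Sum>\<mu>\<in>UNIV. \<Sum>a\<in>UNIV. pd \<mu> (e (\<mu>, a)) x * \<epsilon> a x
        + g * (\<epsilon> a x * lie_br C (\<lambda>b. A (\<mu>, b) x) (\<lambda>b. e (\<mu>, b) x) a))"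
      by (subst sum.swap) (simp add: sum_distrib_left algebra_simps)
    have 3: "(\<Sum>a\<in>UNIV. e (\<mu>, a) x * lie_br C (\<lambda>b. A (\<mu>, b) x) (\<lambda>b. \<epsilon> b x) a)
      + (\<Sum>a\<in>UNIV. \<epsilon> a x * lie_br C (\<lambda>b. A (\<mu>, b) x) (\<lambda>b. e (\<mu>, b) x) a) = 0" for \<mu>
      by (subst dot_lie_br[OF C]) simp
    have 4: "(\<Sum>a\<in>UNIV. g * (e (\<mu>, a) x * lie_br C (\<lambda>b. A (\<mu>, b) x) (\<lambda>b. \<epsilon> b x) a)
      + g * (\<epsilon> a x * lie_br C (\<lambda>b. A (\<mu>, b) x) (\<lambda>b. e (\<mu>, b) x) a)) = 0" for \<mu>
      using arg_cong[OF 3[of \<mu>], of "\<lambda>r. g * r"]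
      by (simp add: sum.distrib distrib_left sum_distrib_left)
    have "(\<Sum>\<mu>\<in>UNIV. \<Sum>a\<in>UNIV. g * (e (\<mu>, a) x * lie_br C (\<lambda>b. A (\<mu>, b) x) (\<lambda>b. \<epsilon> b x) a))
      + (\<Sum>\<mu>\<in>UNIV. \<Sum>a\<in>UNIV. g * (\<epsilon> a x * lie_br C (\<lambda>b. A (\<mu>, b) x) (\<lambda>b. e (\<mu>, b) x) a)) = 0"
      unfolding sum.distrib[symmetric] 4 by simp
    then show ?thesis unfolding 1 2 by (simp add: sum.distrib)
  qed
  have mc: "make_current (gauge_sector V C g) A (zeta_euler (gauge_sector V C g) n L \<Phi>) = (\<lambda>\<mu> a. e (\<mu>, a))"
    by (simp add: fun_eq_iff e_def)
  show "((\<lambda>x. (\<Sum>z\<in>UNIV. euler n L (Zeta z) \<Phi> x * zeta_tr (gauge_sector V C g) A \<epsilon> z x)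
      + (\<Sum>a\<in>UNIV. \<epsilon> a x * covdiv (gauge_sector V C g) A
          (make_current (gauge_sector V C g) A (zeta_euler (gauge_sector V C g) n L \<Phi>)) a x)) has_integral 0) V"
    unfolding mc using I unfolding eq[symmetric] by (simp add: e_def)
next
  fix A :: "('d \<times> 'a, 'd) zfield" and n L a and \<Phi> :: "real ^ 'd \<Rightarrow> ('d \<times> 'a, 'd) jet"
  assume A: "admissible (gauge_sector V C g) A" and sm: "\<And>z. smooth_on V (euler n L (Zeta z) \<Phi>)"
  show "smooth_on V (covdiv (gauge_sector V C g) A
      (make_current (gauge_sector V C g) A (zeta_euler (gauge_sector V C g) n L \<Phi>)) a)"
    unfolding gauge_sector_simps
    by (intro smooth_on_intros smooth_on_lie_br smooth_on_const V) (use A sm in auto)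
next
  fix A :: "('d \<times> 'a, 'd) zfield" and n L x z and \<Phi> :: "real ^ 'd \<Rightarrow> ('d \<times> 'a, 'd) jet"
  assume "\<And>\<mu> a. make_current (gauge_sector V C g) A (zeta_euler (gauge_sector V C g) n L \<Phi>) \<mu> a x = 0"
  then show "zeta_euler (gauge_sector V C g) n L \<Phi> z x = 0" by (cases z) simp
qed (use V in auto)


section \<open>The laws for a metric\<close>

lemma metric_sector_simps [simp]:
  "admissible (metric_sector V) g \<longleftrightarrow> (\<forall>z. smooth_on V (g z)) \<and>
     (\<forall>x\<in>V. transpose (metric_matrix g x) = metric_matrix g x \<and> det (metric_matrix g x) \<noteq> 0)"
  "zeta_tr (metric_sector V) g \<epsilon> z = (\<lambda>x. - lie_metric g \<epsilon> z x)"
  "bracket (metric_sector V) \<epsilon> \<eta> \<mu> =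
    (\<lambda>x. \<Sum>\<nu>\<in>UNIV. \<epsilon> \<nu> x * pd \<nu> (\<eta> \<mu>) x - \<eta> \<nu> x * pd \<nu> (\<epsilon> \<mu>) x)"
  "zeta_euler (metric_sector V) n L \<Phi> (\<mu>, \<nu>) =
    (\<lambda>x. (euler n L (Zeta (\<mu>, \<nu>)) \<Phi> x + euler n L (Zeta (\<nu>, \<mu>)) \<Phi> x) / 2)"
  "make_current (metric_sector V) g E \<mu> \<nu> = (\<lambda>x. - 2 * (\<Sum>\<rho>\<in>UNIV. g (\<nu>, \<rho>) x * E (\<mu>, \<rho>) x))"
  "covdiv (metric_sector V) g j \<nu> = (\<lambda>x. \<Sum>\<mu>\<in>UNIV. covd_density g j \<mu> \<mu> \<nu> x)"
  by (auto simp: metric_sector_def fun_eq_iff)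

lemma admissible_metric_sym:
  assumes "admissible (metric_sector V) g" "x \<in> V" shows "g (\<mu>, \<nu>) x = g (\<nu>, \<mu>) x"
proof -
  have "transpose (metric_matrix g x) = metric_matrix g x" using assms by simp
  then have "transpose (metric_matrix g x) $ \<nu> $ \<mu> = metric_matrix g x $ \<nu> $ \<mu>" by simp
  then show ?thesis by (simp add: transpose_def metric_matrix_def)
qed

lemma pd_metric_sym:
  assumes "admissible (metric_sector V) g" "x \<in> V" "open V"
  shows "pd \<rho> (g (\<mu>, \<nu>)) x = pd \<rho> (g (\<nu>, \<mu>)) x"
  by (rule pd_cong_open[OF assms(3,2) admissible_metric_sym[OF assms(1)]])

lemma admissible_metric_inverse:
  assumes "admissible (metric_sector V) g" "x \<in> V"
  shows "(\<Sum>\<rho>\<in>UNIV. g (\<sigma>, \<rho>) x * matrix_inv (metric_matrix g x) $ \<rho> $ \<tau>) = (if \<sigma> = \<tau> then 1 else 0)"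
proof -
  have "invertible (metric_matrix g x)" using assms by (simp add: invertible_det_nz)
  then have "metric_matrix g x ** matrix_inv (metric_matrix g x) = mat 1"
    unfolding invertible_def matrix_inv_def by (rule someI2_ex) auto
  then have "(metric_matrix g x ** matrix_inv (metric_matrix g x)) $ \<sigma> $ \<tau> = mat 1 $ \<sigma> $ \<tau>" by simp
  then show ?thesis by (simp add: matrix_matrix_mult_def mat_def metric_matrix_def)
qed

text \<open>The current carries a factor g, which lowers the upper index of the Christoffel symbol
  and removes the inverse metric.\<close>

lemma christoffel_lower:
  fixes g :: "('d::finite \<times> 'd, 'd) zfield"
  assumes g: "admissible (metric_sector V) g" "x \<in> V"
  shows "(\<Sum>\<rho>\<in>UNIV. g (\<rho>, \<sigma>) x * christoffel g \<rho> \<mu> \<nu> x) =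
    1 / 2 * (pd \<mu> (g (\<nu>, \<sigma>)) x + pd \<nu> (g (\<mu>, \<sigma>)) x - pd \<sigma> (g (\<mu>, \<nu>)) x)"
proof -
  define h where "h \<sigma> = pd \<mu> (g (\<nu>, \<sigma>)) x + pd \<nu> (g (\<mu>, \<sigma>)) x - pd \<sigma> (g (\<mu>, \<nu>)) x" for \<sigma>
  have "(\<Sum>\<rho>\<in>UNIV. g (\<rho>, \<sigma>) x * christoffel g \<rho> \<mu> \<nu> x) = (\<Sum>\<rho>\<in>UNIV. \<Sum>\<tau>\<in>UNIV.
      g (\<sigma>, \<rho>) x * matrix_inv (metric_matrix g x) $ \<rho> $ \<tau> * (1 / 2 * h \<tau>))"
    unfolding christoffel_def h_def[symmetric] admissible_metric_sym[OF g, of _ \<sigma>]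
    by (simp add: sum_distrib_left mult_ac)
  also have "\<dots> = (\<Sum>\<tau>\<in>UNIV. \<Sum>\<rho>\<in>UNIV. g (\<sigma>, \<rho>) x * matrix_inv (metric_matrix g x) $ \<rho> $ \<tau> * (1 / 2 * h \<tau>))"
    by (rule sum.swap)
  also have "\<dots> = (\<Sum>\<tau>\<in>UNIV. (if \<sigma> = \<tau> then 1 else 0) * (1 / 2 * h \<tau>))"
    unfolding sum_distrib_right[symmetric] admissible_metric_inverse[OF g] ..
  also have "\<dots> = (\<Sum>\<tau>\<in>UNIV. if \<sigma> = \<tau> then 1 / 2 * h \<tau> else 0)" by (intro sum.cong) auto
  also have "\<dots> = 1 / 2 * h \<sigma>" by simp
  finally show ?thesis by (simp add: h_def)
qed

text \<open>The trace terms of the connection cancel because the current is a density; in the other one only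
  \<open>\<partial>\<^sub>\<nu> g\<close> survives the contraction with the symmetric \<open>S\<close>.\<close>

lemma metric_covdiv:
  fixes g :: "('d::finite \<times> 'd, 'd) zfield"
  assumes V: "open V" and g: "admissible (metric_sector V) g" "x \<in> V"
    and S: "\<And>\<mu> \<nu>. S (\<mu>, \<nu>) x = S (\<nu>, \<mu>) x"
  defines "j \<equiv> make_current (metric_sector V) g S"
  shows "covdiv (metric_sector V) g j \<nu> x = (\<Sum>\<mu>\<in>UNIV. pd \<mu> (j \<mu> \<nu>) x)
    + (\<Sum>\<mu>\<in>UNIV. \<Sum>\<sigma>\<in>UNIV. S (\<mu>, \<sigma>) x * pd \<nu> (g (\<mu>, \<sigma>)) x)"
proof -
  have trace: "(\<Sum>\<mu>\<in>UNIV. \<Sum>\<rho>\<in>UNIV. christoffel g \<mu> \<mu> \<rho> x * j \<rho> \<nu> x)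
      = (\<Sum>\<mu>\<in>UNIV. (\<Sum>\<rho>\<in>UNIV. christoffel g \<rho> \<rho> \<mu> x) * j \<mu> \<nu> x)"
    by (subst sum.swap) (simp add: sum_distrib_right)
  have inner: "(\<Sum>\<rho>\<in>UNIV. christoffel g \<rho> \<mu> \<nu> x * j \<mu> \<rho> x) =
      - (\<Sum>\<sigma>\<in>UNIV. S (\<mu>, \<sigma>) x * (pd \<mu> (g (\<nu>, \<sigma>)) x + pd \<nu> (g (\<mu>, \<sigma>)) x - pd \<sigma> (g (\<mu>, \<nu>)) x))" for \<mu>
  proof -
    have "(\<Sum>\<rho>\<in>UNIV. christoffel g \<rho> \<mu> \<nu> x * j \<mu> \<rho> x) =
        (\<Sum>\<rho>\<in>UNIV. \<Sum>\<sigma>\<in>UNIV. - 2 * S (\<mu>, \<sigma>) x * (g (\<rho>, \<sigma>) x * christoffel g \<rho> \<mu> \<nu> x))"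
      by (simp add: j_def sum_distrib_left mult_ac sum_negf)
    also have "\<dots> = (\<Sum>\<sigma>\<in>UNIV. \<Sum>\<rho>\<in>UNIV. - 2 * S (\<mu>, \<sigma>) x * (g (\<rho>, \<sigma>) x * christoffel g \<rho> \<mu> \<nu> x))"
      by (rule sum.swap)
    also have "\<dots> = (\<Sum>\<sigma>\<in>UNIV. - 2 * S (\<mu>, \<sigma>) x *
        (1 / 2 * (pd \<mu> (g (\<nu>, \<sigma>)) x + pd \<nu> (g (\<mu>, \<sigma>)) x - pd \<sigma> (g (\<mu>, \<nu>)) x)))"
      unfolding sum_distrib_left[symmetric] christoffel_lower[OF g] ..
    finally show ?thesis by (simp add: sum_negf)
  qed
  have "(\<Sum>\<mu>\<in>UNIV. \<Sum>\<sigma>\<in>UNIV. S (\<mu>, \<sigma>) x * pd \<sigma> (g (\<mu>, \<nu>)) x)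
      = (\<Sum>\<mu>\<in>UNIV. \<Sum>\<sigma>\<in>UNIV. S (\<mu>, \<sigma>) x * pd \<mu> (g (\<nu>, \<sigma>)) x)"
    by (subst sum.swap) (simp add: S[of _ "_ :: 'd"] pd_metric_sym[OF g V, of _ _ \<nu>] cong: sum.cong)
  then have "(\<Sum>\<mu>\<in>UNIV. \<Sum>\<rho>\<in>UNIV. christoffel g \<rho> \<mu> \<nu> x * j \<mu> \<rho> x) =
      - (\<Sum>\<mu>\<in>UNIV. \<Sum>\<sigma>\<in>UNIV. S (\<mu>, \<sigma>) x * pd \<nu> (g (\<mu>, \<sigma>)) x)"
    unfolding inner by (simp add: algebra_simps sum.distrib sum_subtractf sum_negf)
  then show ?thesis using trace
    by (simp add: covd_density_def sum.distrib sum_subtractf)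
qed

lemma lie_metric_sym:
  assumes "admissible (metric_sector V) g" "x \<in> V" "open V"
  shows "lie_metric g \<epsilon> (\<mu>, \<nu>) x = lie_metric g \<epsilon> (\<nu>, \<mu>) x"
  unfolding lie_metric_def
  by (simp add: pd_metric_sym[OF assms, of _ \<mu> \<nu>] admissible_metric_sym[OF assms(1,2), of \<mu>]
      admissible_metric_sym[OF assms(1,2), of _ \<nu>] algebra_simps)

text \<open>The part of the Lie derivative without derivatives of \<epsilon> cancels against the
  term in \<partial>g left in the divergence. The two parts with derivatives of \<epsilon> are equal
  by symmetry, each being -1/2 times \<open>j\<close> contracted with them, which explains the
  factor -2 in the current.\<close>

lemma metric_contraction:
  fixes g :: "('d::finite \<times> 'd, 'd) zfield"
  assumes V: "open V" and g: "admissible (metric_sector V) g" "x \<in> V"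
    and S: "\<And>\<mu> \<nu>. S (\<mu>, \<nu>) x = S (\<nu>, \<mu>) x"
  defines "j \<equiv> make_current (metric_sector V) g S"
  shows "- (\<Sum>z\<in>UNIV. S z x * lie_metric g \<epsilon> z x)
    + (\<Sum>\<nu>\<in>UNIV. \<epsilon> \<nu> x * covdiv (metric_sector V) g j \<nu> x)
    = (\<Sum>\<mu>\<in>UNIV. \<Sum>\<nu>\<in>UNIV. j \<mu> \<nu> x * pd \<mu> (\<epsilon> \<nu>) x + pd \<mu> (j \<mu> \<nu>) x * \<epsilon> \<nu> x)"
proof -
  have a: "(\<Sum>\<mu>\<in>UNIV. \<Sum>\<nu>\<in>UNIV. \<Sum>\<rho>\<in>UNIV. S (\<mu>, \<nu>) x * (\<epsilon> \<rho> x * pd \<rho> (g (\<mu>, \<nu>)) x))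
      = (\<Sum>\<rho>\<in>UNIV. \<epsilon> \<rho> x * (\<Sum>\<mu>\<in>UNIV. \<Sum>\<nu>\<in>UNIV. S (\<mu>, \<nu>) x * pd \<rho> (g (\<mu>, \<nu>)) x))"
  proof -
    have "(\<Sum>\<mu>\<in>UNIV. \<Sum>\<nu>\<in>UNIV. \<Sum>\<rho>\<in>UNIV. S (\<mu>, \<nu>) x * (\<epsilon> \<rho> x * pd \<rho> (g (\<mu>, \<nu>)) x))
      = (\<Sum>\<mu>\<in>UNIV. \<Sum>\<rho>\<in>UNIV. \<Sum>\<nu>\<in>UNIV. S (\<mu>, \<nu>) x * (\<epsilon> \<rho> x * pd \<rho> (g (\<mu>, \<nu>)) x))"
      by (intro sum.cong refl sum.swap)
    also have "\<dots> = (\<Sum>\<rho>\<in>UNIV. \<Sum>\<mu>\<in>UNIV. \<Sum>\<nu>\<in>UNIV. S (\<mu>, \<nu>) x * (\<epsilon> \<rho> x * pd \<rho> (g (\<mu>, \<nu>)) x))"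
      by (rule sum.swap)
    finally show ?thesis by (simp add: sum_distrib_left mult_ac)
  qed
  have b: "(\<Sum>\<mu>\<in>UNIV. \<Sum>\<nu>\<in>UNIV. \<Sum>\<rho>\<in>UNIV. S (\<mu>, \<nu>) x * (g (\<rho>, \<nu>) x * pd \<mu> (\<epsilon> \<rho>) x))
      = - (1 / 2) * (\<Sum>\<mu>\<in>UNIV. \<Sum>\<rho>\<in>UNIV. j \<mu> \<rho> x * pd \<mu> (\<epsilon> \<rho>) x)"
  proof -
    have "(\<Sum>\<mu>\<in>UNIV. \<Sum>\<nu>\<in>UNIV. \<Sum>\<rho>\<in>UNIV. S (\<mu>, \<nu>) x * (g (\<rho>, \<nu>) x * pd \<mu> (\<epsilon> \<rho>) x))
      = (\<Sum>\<mu>\<in>UNIV. \<Sum>\<rho>\<in>UNIV. \<Sum>\<nu>\<in>UNIV. S (\<mu>, \<nu>) x * (g (\<rho>, \<nu>) x * pd \<mu> (\<epsilon> \<rho>) x))"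
      by (intro sum.cong refl sum.swap)
    then show ?thesis by (simp add: j_def sum_distrib_left sum_distrib_right sum_negf mult_ac)
  qed
  have c: "(\<Sum>\<mu>\<in>UNIV. \<Sum>\<nu>\<in>UNIV. \<Sum>\<rho>\<in>UNIV. S (\<mu>, \<nu>) x * (g (\<mu>, \<rho>) x * pd \<nu> (\<epsilon> \<rho>) x))
      = (\<Sum>\<mu>\<in>UNIV. \<Sum>\<nu>\<in>UNIV. \<Sum>\<rho>\<in>UNIV. S (\<mu>, \<nu>) x * (g (\<rho>, \<nu>) x * pd \<mu> (\<epsilon> \<rho>) x))"
    by (subst sum.swap) (intro sum.cong refl arg_cong2[where f = "(*)"] S admissible_metric_sym[OF g])
  have "(\<Sum>z\<in>UNIV. S z x * lie_metric g \<epsilon> z x) =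
      (\<Sum>\<mu>\<in>UNIV. \<Sum>\<nu>\<in>UNIV. \<Sum>\<rho>\<in>UNIV. S (\<mu>, \<nu>) x * (\<epsilon> \<rho> x * pd \<rho> (g (\<mu>, \<nu>)) x))
      + (\<Sum>\<mu>\<in>UNIV. \<Sum>\<nu>\<in>UNIV. \<Sum>\<rho>\<in>UNIV. S (\<mu>, \<nu>) x * (g (\<rho>, \<nu>) x * pd \<mu> (\<epsilon> \<rho>) x))
      + (\<Sum>\<mu>\<in>UNIV. \<Sum>\<nu>\<in>UNIV. \<Sum>\<rho>\<in>UNIV. S (\<mu>, \<nu>) x * (g (\<mu>, \<rho>) x * pd \<nu> (\<epsilon> \<rho>) x))"
    by (simp add: sum_UNIV_prod lie_metric_def sum_distrib_left distrib_left sum.distrib)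
  also have "\<dots> =
      (\<Sum>\<rho>\<in>UNIV. \<epsilon> \<rho> x * (\<Sum>\<mu>\<in>UNIV. \<Sum>\<nu>\<in>UNIV. S (\<mu>, \<nu>) x * pd \<rho> (g (\<mu>, \<nu>)) x))
      - (\<Sum>\<mu>\<in>UNIV. \<Sum>\<rho>\<in>UNIV. j \<mu> \<rho> x * pd \<mu> (\<epsilon> \<rho>) x)"
    unfolding c a b by linarith
  finally have "(\<Sum>z\<in>UNIV. S z x * lie_metric g \<epsilon> z x) =
      (\<Sum>\<rho>\<in>UNIV. \<epsilon> \<rho> x * (\<Sum>\<mu>\<in>UNIV. \<Sum>\<nu>\<in>UNIV. S (\<mu>, \<nu>) x * pd \<rho> (g (\<mu>, \<nu>)) x))
      - (\<Sum>\<mu>\<in>UNIV. \<Sum>\<rho>\<in>UNIV. j \<mu> \<rho> x * pd \<mu> (\<epsilon> \<rho>) x)" .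
  moreover have "(\<Sum>\<nu>\<in>UNIV. \<epsilon> \<nu> x * covdiv (metric_sector V) g j \<nu> x)
      = (\<Sum>\<mu>\<in>UNIV. \<Sum>\<nu>\<in>UNIV. pd \<mu> (j \<mu> \<nu>) x * \<epsilon> \<nu> x)
      + (\<Sum>\<rho>\<in>UNIV. \<epsilon> \<rho> x * (\<Sum>\<mu>\<in>UNIV. \<Sum>\<nu>\<in>UNIV. S (\<mu>, \<nu>) x * pd \<rho> (g (\<mu>, \<nu>)) x))"
    unfolding j_def metric_covdiv[where S = S, OF V g S]
    by (simp only: distrib_left sum.distrib sum_distrib_left)
      (subst sum.swap, simp add: mult_ac)
  ultimately show ?thesis by (simp add: sum.distrib)
qed

lemma metric_sector_laws:
  fixes V :: "(real ^ 'd::finite) set"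
  assumes V: "open V"
  shows "sector_laws V (metric_sector V)"
proof
  \<comment> \<open>The determinant is a polynomial in finitely many coordinates of the jet, hence
    continuous in the product topology.\<close>
  have "continuous_on UNIV (\<lambda>u :: ('d \<times> 'd, 'd) jet.
      det ((\<chi> \<mu> \<nu>. (u (Zeta (\<mu>, \<nu>) []) + u (Zeta (\<nu>, \<mu>) [])) / 2) :: real ^ 'd ^ 'd))"
    unfolding det_def by (simp, intro continuous_intros) auto
  then show "open (jet_domain (metric_sector V :: ('d \<times> 'd, 'd, 'd) sector))"
    unfolding metric_sector_def by (simp add: open_Collect_neq)
next
  fix u w :: "('d \<times> 'd, 'd) jet"
  assume "u \<in> jet_domain (metric_sector V)" "\<And>z s. u (Zeta z s) = w (Zeta z s)"
  then show "w \<in> jet_domain (metric_sector V)" by (simp add: metric_sector_def)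
next
  fix g :: "('d \<times> 'd, 'd) zfield" and \<psi> x
  assume g: "admissible (metric_sector V) g" and x: "x \<in> V"
  \<comment> \<open>A symmetric metric coincides with the symmetric part whose determinant defines
    the domain.\<close>
  have "(\<chi> \<mu> \<nu>. (jet g \<psi> x (Zeta (\<mu>, \<nu>) []) + jet g \<psi> x (Zeta (\<nu>, \<mu>) [])) / 2) = metric_matrix g x"
    using admissible_metric_sym[OF g x] by (simp add: metric_matrix_def vec_eq_iff)
  then show "jet g \<psi> x \<in> jet_domain (metric_sector V)" using g x by (simp add: metric_sector_def)
next
  fix g :: "('d \<times> 'd, 'd) zfield" and \<epsilon> :: "('d, 'd) param" and z :: "'d \<times> 'd"
  assume "admissible (metric_sector V) g" and "smooth_param V \<epsilon>"
  then have s: "smooth_on V (g z)" "smooth_on V (\<epsilon> \<rho>)" for z \<rho>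
    unfolding metric_sector_simps smooth_param_def by blast+
  obtain \<mu> \<nu> where z: "z = (\<mu>, \<nu>)" by (cases z)
  show "smooth_on V (zeta_tr (metric_sector V) g \<epsilon> z)"
    unfolding z metric_sector_simps lie_metric_def prod.case
    by (intro smooth_on_intros V s)
next
  fix g :: "('d \<times> 'd, 'd) zfield" and \<epsilon> :: "('d, 'd) param" and X x and z :: "'d \<times> 'd"
  assume X: "closed X" "\<And>a x. x \<notin> X \<Longrightarrow> \<epsilon> a x = 0" "x \<notin> X"
  show "zeta_tr (metric_sector V) g \<epsilon> z x = 0"
    using X(2)[OF X(3)] pd_outside[OF X(1,2,3)] by (cases z) (simp add: lie_metric_def)
next
  fix g :: "('d \<times> 'd, 'd) zfield" and \<epsilon> :: "('d, 'd) param" and X n L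
    and \<Phi> :: "real ^ 'd \<Rightarrow> ('d \<times> 'd, 'd) jet"
  assume g: "admissible (metric_sector V) g" and X: "compact X" "X \<subseteq> V" "\<And>a x. x \<notin> X \<Longrightarrow> \<epsilon> a x = 0"
    and \<epsilon>: "\<And>a. smooth_on V (\<epsilon> a)" and sm: "\<And>z. smooth_on V (euler n L (Zeta z) \<Phi>)"
  define S where "S = zeta_euler (metric_sector V) n L \<Phi>"
  define j where "j = make_current (metric_sector V) g S"
  have S: "S (\<mu>, \<nu>) x = S (\<nu>, \<mu>) x" for \<mu> \<nu> x by (simp add: S_def)
  have gs: "smooth_on V (g z)" for z using g unfolding metric_sector_simps by blast
  have js: "smooth_on V (j \<mu> \<nu>)" for \<mu> \<nu>
    unfolding j_def S_def metric_sector_simps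
    by (intro smooth_on_intros smooth_on_const V gs sm)
  have "((\<lambda>x. \<Sum>\<mu>\<in>UNIV. \<Sum>\<nu>\<in>UNIV. j \<mu> \<nu> x * pd \<mu> (\<epsilon> \<nu>) x + pd \<mu> (j \<mu> \<nu>) x * \<epsilon> \<nu> x) has_integral
      (\<Sum>\<mu>\<in>(UNIV :: 'd set). \<Sum>\<nu>\<in>(UNIV :: 'd set). 0)) V"
    by (intro has_integral_sum integral_by_parts[OF V js \<epsilon> X(1,2)]) (use X(3) in auto)
  then have I: "((\<lambda>x. \<Sum>\<mu>\<in>UNIV. \<Sum>\<nu>\<in>UNIV. j \<mu> \<nu> x * pd \<mu> (\<epsilon> \<nu>) x + pd \<mu> (j \<mu> \<nu>) x * \<epsilon> \<nu> x)
      has_integral 0) V" by simp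
  show "((\<lambda>x. (\<Sum>z\<in>UNIV. euler n L (Zeta z) \<Phi> x * zeta_tr (metric_sector V) g \<epsilon> z x)
      + (\<Sum>a\<in>UNIV. \<epsilon> a x * covdiv (metric_sector V) g
          (make_current (metric_sector V) g (zeta_euler (metric_sector V) n L \<Phi>)) a x)) has_integral 0) V"
  proof (rule has_integral_eq[OF _ I])
    fix x assume x: "x \<in> V"
    let ?e = "\<lambda>\<mu> \<nu>. euler n L (Zeta (\<mu>, \<nu>)) \<Phi> x"
    \<comment> \<open>The variation of the metric is symmetric, so contracting it with the plain
      Euler derivative or with the symmetrized one gives the same result.\<close>
    have "(\<Sum>\<mu>\<in>UNIV. \<Sum>\<nu>\<in>UNIV. ?e \<nu> \<mu> * lie_metric g \<epsilon> (\<mu>, \<nu>) x)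
      = (\<Sum>\<mu>\<in>UNIV. \<Sum>\<nu>\<in>UNIV. ?e \<mu> \<nu> * lie_metric g \<epsilon> (\<mu>, \<nu>) x)"
      by (subst sum.swap) (intro sum.cong refl arg_cong2[where f = "(*)"] lie_metric_sym[OF g x V])
    then have "(\<Sum>z\<in>UNIV. euler n L (Zeta z) \<Phi> x * zeta_tr (metric_sector V) g \<epsilon> z x)
        = - (\<Sum>z\<in>UNIV. S z x * lie_metric g \<epsilon> z x)"
      by (simp add: sum_UNIV_prod S_def sum_negf add_divide_distrib distrib_right sum.distrib
          sum_divide_distrib[symmetric])
    then show "(\<Sum>\<mu>\<in>UNIV. \<Sum>\<nu>\<in>UNIV. j \<mu> \<nu> x * pd \<mu> (\<epsilon> \<nu>) x + pd \<mu> (j \<mu> \<nu>) x * \<epsilon> \<nu> x) =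
        (\<Sum>z\<in>UNIV. euler n L (Zeta z) \<Phi> x * zeta_tr (metric_sector V) g \<epsilon> z x)
      + (\<Sum>a\<in>UNIV. \<epsilon> a x * covdiv (metric_sector V) g
          (make_current (metric_sector V) g (zeta_euler (metric_sector V) n L \<Phi>)) a x)"
      using metric_contraction[where S = S, OF V g x S, of \<epsilon>] unfolding j_def S_def[symmetric] by simp
  qed
next
  fix g :: "('d \<times> 'd, 'd) zfield" and n L \<nu> and \<Phi> :: "real ^ 'd \<Rightarrow> ('d \<times> 'd, 'd) jet"
  assume g: "admissible (metric_sector V) g" and sm: "\<And>z. smooth_on V (euler n L (Zeta z) \<Phi>)"
  define S where "S = zeta_euler (metric_sector V) n L \<Phi>"
  define j where "j = make_current (metric_sector V) g S"
  have S: "S (\<mu>, \<nu>) x = S (\<nu>, \<mu>) x" for \<mu> \<nu> x by (simp add: S_def)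
  have gs: "smooth_on V (g z)" for z using g unfolding metric_sector_simps by blast
  have Ss: "smooth_on V (S (\<mu>, \<nu>))" for \<mu> \<nu>
    unfolding S_def metric_sector_simps by (intro smooth_on_intros V sm)
  have js: "smooth_on V (j \<mu> \<nu>)" for \<mu> \<nu>
    unfolding j_def metric_sector_simps by (intro smooth_on_intros smooth_on_const V gs Ss)
  \<comment> \<open>The form of the divergence without Christoffel symbols shows its smoothness,
    with no inverse matrix to differentiate.\<close>
  have "smooth_on V (\<lambda>x. (\<Sum>\<mu>\<in>UNIV. pd \<mu> (j \<mu> \<nu>) x)
      + (\<Sum>\<mu>\<in>UNIV. \<Sum>\<sigma>\<in>UNIV. S (\<mu>, \<sigma>) x * pd \<nu> (g (\<mu>, \<sigma>)) x))"
    by (intro smooth_on_intros V gs Ss js)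
  then show "smooth_on V (covdiv (metric_sector V) g
      (make_current (metric_sector V) g (zeta_euler (metric_sector V) n L \<Phi>)) \<nu>)"
    unfolding S_def[symmetric]
    by (rule smooth_on_cong[OF _ V]) (simp only: metric_covdiv[where S = S, OF V g _ S] j_def)
next
  fix g :: "('d \<times> 'd, 'd) zfield" and n L x and z :: "'d \<times> 'd" and \<Phi> :: "real ^ 'd \<Rightarrow> ('d \<times> 'd, 'd) jet"
  assume g: "admissible (metric_sector V) g" and x: "x \<in> V"
    and j0: "\<And>\<mu> a. make_current (metric_sector V) g (zeta_euler (metric_sector V) n L \<Phi>) \<mu> a x = 0"
  obtain \<mu> \<tau> where z: "z = (\<mu>, \<tau>)" by (cases z)
  define S where "S = zeta_euler (metric_sector V) n L \<Phi>"
  \<comment> \<open>Vanishing of the current puts every row of the Euler derivative into the kernel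
    of the metric, which is trivial.\<close>
  have "metric_matrix g x *v (\<chi> \<rho>. S (\<mu>, \<rho>) x) = 0"
    using j0[of \<mu>] unfolding S_def[symmetric]
    by (simp add: matrix_vector_mult_def metric_matrix_def vec_eq_iff)
  moreover have "invertible (metric_matrix g x)" using g x by (simp add: invertible_det_nz)
  ultimately have "(\<chi> \<rho>. S (\<mu>, \<rho>) x) = 0"
    using matrix_left_invertible_ker[of "metric_matrix g x"] unfolding invertible_def by blast
  then show "zeta_euler (metric_sector V) n L \<Phi> z x = 0"
    by (simp add: z S_def[symmetric] vec_eq_iff del: metric_sector_simps)
qed (use V in auto)

section \<open>Scalars coupled to a connection\<close>

definition idx :: "'i::finite \<Rightarrow> nat" where
  "idx = (SOME h. bij_betw h UNIV {..<CARD('i)})"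

text \<open>Matter components are numbered in a theory but labelled by algebra or tensor indices in
  the examples; an arbitrary enumeration translates. \<open>unidx\<close> is meaningful only below
  the cardinality of the type.\<close>

definition unidx :: "nat \<Rightarrow> 'i::finite" where
  "unidx = inv_into UNIV idx"

lemma bij_betw_idx: "bij_betw (idx :: 'i \<Rightarrow> nat) UNIV {..<CARD('i::finite)}"
proof -
  obtain h :: "'i \<Rightarrow> nat" where "bij_betw h UNIV {..<CARD('i)}"
    using ex_bij_betw_finite_nat[of "UNIV :: 'i set"] by (auto simp: lessThan_atLeast0)
  then show ?thesis unfolding idx_def by (rule someI[where P = "\<lambda>h. bij_betw h UNIV {..<CARD('i)}"])
qed

lemma idx_less [simp]: "idx (i :: 'i::finite) < CARD('i)"
  using bij_betw_idx bij_betwE by blast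

lemma unidx_idx [simp]: "unidx (idx (i :: 'i::finite)) = i"
  unfolding unidx_def using bij_betw_idx by (metis UNIV_I bij_betw_inv_into_left)

lemma idx_unidx: "k < CARD('i::finite) \<Longrightarrow> idx (unidx k :: 'i) = k"
  unfolding unidx_def using bij_betw_inv_into_right[OF bij_betw_idx] by simp

lemma idx_eq_iff [simp]: "idx i = idx j \<longleftrightarrow> i = j"
  by (metis unidx_idx)

lemma sum_strings_0 [simp]: "(\<Sum>s | s = []. f s) = f []"
  by simp

lemma sum_strings_1:
  fixes f :: "'d::finite list \<Rightarrow> 'b::comm_monoid_add"
  shows "(\<Sum>s | length s \<le> 1. f s) = f [] + (\<Sum>\<mu>\<in>UNIV. f [\<mu>])"
proof -
  have "{s :: 'd list. length s \<le> 1} = insert [] (range (\<lambda>\<mu>. [\<mu>]))"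
    by (auto simp: image_iff le_Suc_eq length_Suc_conv)
  moreover have "(\<Sum>s\<in>range (\<lambda>\<mu>. [\<mu>]). f s) = (\<Sum>\<mu>\<in>UNIV. f [\<mu>])"
    by (subst sum.reindex) (auto simp: inj_on_def)
  ultimately show ?thesis by (simp add: image_iff)
qed

text \<open>All example densities have order one. \<open>Suc 0\<close> is the form in which the
  simplifier presents that order.\<close>

lemma euler_1:
  "euler (Suc 0) L c \<Phi> x = jpd (c []) L (\<Phi> x) - (\<Sum>\<mu>\<in>UNIV. pd \<mu> (\<lambda>y. jpd (c [\<mu>]) L (\<Phi> y)) x)"
  using sum_strings_1[of "\<lambda>s. (- 1) ^ length s * pds s (\<lambda>y. jpd (c s) L (\<Phi> y)) x"]
  by (simp add: euler_def sum_negf)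

text \<open>Suited to the gauge examples, whose densities are strictly invariant. The fluid density
  changes by a divergence and is treated by integration.\<close>

lemma invariant_actionI:
  assumes "\<And>\<zeta> \<psi> \<epsilon> x. fields V K T \<zeta> \<psi> \<Longrightarrow> smooth_param V \<epsilon> \<Longrightarrow> x \<in> V \<Longrightarrow>
    variation (inv_density T) \<zeta> \<psi> (zeta_tr K \<zeta> \<epsilon>) (matter_tr T \<zeta> \<psi> \<epsilon>) x = 0"
  shows "invariant_action V K T"
  unfolding invariant_action_def test_param_def
  using assms by (blast intro: has_integral_is_0)

lemma poly_lie_br:
  "(\<And>a. poly_jet (x a)) \<Longrightarrow> (\<And>a. poly_jet (y a)) \<Longrightarrow>
    poly_jet (\<lambda>u. lie_br C (\<lambda>b. x b u) (\<lambda>b. y b u) a)"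
  unfolding lie_br_def by (intro poly_intros)

lemma jpd_lie_br:
  assumes "\<And>a. poly_jet (x a)" "\<And>a. poly_jet (y a)"
  shows "jpd v (\<lambda>u. lie_br C (\<lambda>b. x b u) (\<lambda>b. y b u) a) =
    (\<lambda>u. lie_br C (\<lambda>b. jpd v (x b) u) (\<lambda>b. y b u) a + lie_br C (\<lambda>b. x b u) (\<lambda>b. jpd v (y b) u) a)"
  unfolding lie_br_def
  by (simp add: jpd_sum jpd_mult jpd_cmult poly_intros assms sum.distrib algebra_simps)

lemma jpd_square:
  "poly_jet F \<Longrightarrow> jpd v (\<lambda>u. (F u)\<^sup>2) = (\<lambda>u. 2 * F u * jpd v F u)"
  by (simp add: power2_eq_square jpd_mult) (simp add: fun_eq_iff)

lemma pd_lie_br: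
  fixes X Y :: "'a::finite \<Rightarrow> 'd::finite scalar"
  assumes "\<And>a. X a differentiable at p" "\<And>a. Y a differentiable at p"
  shows "pd \<mu> (\<lambda>p. lie_br C (\<lambda>b. X b p) (\<lambda>b. Y b p) a) p =
    lie_br C (\<lambda>b. pd \<mu> (X b) p) (\<lambda>b. Y b p) a + lie_br C (\<lambda>b. X b p) (\<lambda>b. pd \<mu> (Y b) p) a"
  unfolding lie_br_def
  by (simp add: pd_sum pd_mult pd_cmult assms sum.distrib algebra_simps)

lemma lie_br_derivative:
  "((\<lambda>t. lie_br C (\<lambda>b. x b + t * x' b) (\<lambda>b. y b + t * y' b) a) has_real_derivative
    lie_br C x' y a + lie_br C x y' a) (at 0)"
  unfolding lie_br_def
  by (auto intro!: derivative_eq_intros simp: sum.distrib algebra_simps)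

lemma lie_br_minus:
  "lie_br C (\<lambda>b. - x b) y a = - lie_br C x y a" "lie_br C y (\<lambda>b. - x b) a = - lie_br C y x a"
  by (simp_all add: lie_br_def sum_negf)

text \<open>Jacobi in the form used for covariance: bracketing with z is a derivation of the
  bracket.\<close>

lemma lie_br_leibniz:
  assumes "structure_constants C"
  shows "lie_br C (lie_br C x z) y a + lie_br C x (lie_br C y z) a = lie_br C (lie_br C x y) z a"
proof -
  have "lie_br C x (lie_br C y z) a + lie_br C y (lie_br C z x) a + lie_br C z (lie_br C x y) a = 0"
    by (rule lie_br_jacobi[OF assms])
  moreover have "lie_br C y (lie_br C z x) a = lie_br C (lie_br C x z) y a"
  proof -
    have "lie_br C z x = (\<lambda>b. - lie_br C x z b)" using lie_br_antisym[OF assms, of z x] by blast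
    then show ?thesis using lie_br_antisym[OF assms, of y "lie_br C x z"] by (simp add: lie_br_minus)
  qed
  moreover have "lie_br C z (lie_br C x y) a = - lie_br C (lie_br C x y) z a"
    by (rule lie_br_antisym[OF assms])
  ultimately show ?thesis by simp
qed

text \<open>For \<open>w = 0\<close> this is the adjoint covariant derivative; for
  \<open>w = 1\<close> and vanishing \<open>g * C\<close> it is the Stueckelberg combination,
  gradient of the scalar minus connection.\<close>

definition cov_scalar :: "('a::finite \<Rightarrow> 'a \<Rightarrow> 'a \<Rightarrow> real) \<Rightarrow> real \<Rightarrow> real \<Rightarrow> 'd::finite \<Rightarrow> 'a \<Rightarrow>
    ('d \<times> 'a, 'd) jet \<Rightarrow> real" where
  "cov_scalar C g w \<mu> a u = u (Psi (idx a) [\<mu>])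
     + g * lie_br C (\<lambda>b. u (Zeta (\<mu>, b) [])) (\<lambda>b. u (Psi (idx b) [])) a - w * u (Zeta (\<mu>, a) [])"

definition scalar_density :: "('a::finite \<Rightarrow> 'a \<Rightarrow> 'a \<Rightarrow> real) \<Rightarrow> real \<Rightarrow> real \<Rightarrow>
    ('d::finite \<times> 'a, 'd) jet \<Rightarrow> real" where
  "scalar_density C g w u = (\<Sum>\<mu>\<in>UNIV. \<Sum>a\<in>UNIV. (cov_scalar C g w \<mu> a u)\<^sup>2) / 2"

text \<open>The components \<open>\<phi>\<^sub>a\<close> transform by \<open>\<delta>\<phi> = g [\<phi>, \<epsilon>] + w \<epsilon>\<close>. For \<open>w = 0\<close> these are adjoint scalars;
  if the adjoint representation is trivial (\<open>g C = 0\<close>), the shift \<open>w = 1\<close> is used instead.\<close>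

definition scalar_theory :: "('a::finite \<Rightarrow> 'a \<Rightarrow> 'a \<Rightarrow> real) \<Rightarrow> real \<Rightarrow> real \<Rightarrow>
    ('d \<times> 'a, 'd) setting \<Rightarrow> ('d::finite \<times> 'a, 'd, 'a) field_theory" where
  "scalar_theory C g w st = \<lparr>
     matter = CARD('a), deriv_order = 1, L_inv = scalar_density C g w, tr_order = 0,
     tr_coeff = (\<lambda>k a s x u. if s = [] then g * (\<Sum>b\<in>UNIV. C (unidx k) b a * u (Psi (idx b) []))
       + (if unidx k = a then w else 0) else 0),
     setting = st \<rparr>"

lemma scalar_theory_simps [simp]:
  fixes C :: "'a::finite \<Rightarrow> 'a \<Rightarrow> 'a \<Rightarrow> real"
  shows
  "matter (scalar_theory C g w st) = CARD('a)" "deriv_order (scalar_theory C g w st) = 1"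
  "L_inv (scalar_theory C g w st) = scalar_density C g w" "setting (scalar_theory C g w st) = st"
  "tr_order (scalar_theory C g w st) = 0"
  by (simp_all add: scalar_theory_def)

lemma scalar_matter_tr:
  fixes C :: "'a::finite \<Rightarrow> 'a \<Rightarrow> 'a \<Rightarrow> real" and \<epsilon> :: "('a, 'd::finite) param"
  shows "matter_tr (scalar_theory C g w st) A \<psi> \<epsilon> k =
    (\<lambda>x. g * lie_br C (\<lambda>b. \<psi> (idx b) x) (\<lambda>a. \<epsilon> a x) (unidx k) + w * \<epsilon> (unidx k) x)"
proof
  fix x
  have "matter_tr (scalar_theory C g w st) A \<psi> \<epsilon> k x =
     (\<Sum>a\<in>UNIV. (g * (\<Sum>b\<in>UNIV. C (unidx k) b a * \<psi> (idx b) x) + (if unidx k = a then w else 0)) * \<epsilon> a x)"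
    by (simp add: matter_tr_def) (simp add: scalar_theory_def)
  also have "\<dots> = (\<Sum>a\<in>UNIV. (\<Sum>b\<in>UNIV. g * (C (unidx k) b a * \<psi> (idx b) x * \<epsilon> a x)) +
      (if unidx k = a then w * \<epsilon> a x else 0))"
    by (intro sum.cong refl) (auto simp: algebra_simps sum_distrib_left)
  also have "\<dots> = (\<Sum>a\<in>UNIV. \<Sum>b\<in>UNIV. g * (C (unidx k) b a * \<psi> (idx b) x * \<epsilon> a x)) + w * \<epsilon> (unidx k) x"
    by (simp add: sum.distrib)
  also have "(\<Sum>a\<in>UNIV. \<Sum>b\<in>UNIV. g * (C (unidx k) b a * \<psi> (idx b) x * \<epsilon> a x))
      = (\<Sum>b\<in>UNIV. \<Sum>a\<in>UNIV. g * (C (unidx k) b a * \<psi> (idx b) x * \<epsilon> a x))"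
    by (rule sum.swap)
  finally show "matter_tr (scalar_theory C g w st) A \<psi> \<epsilon> k x =
    g * lie_br C (\<lambda>b. \<psi> (idx b) x) (\<lambda>a. \<epsilon> a x) (unidx k) + w * \<epsilon> (unidx k) x"
    by (simp add: lie_br_def sum_distrib_left)
qed

lemma poly_cov_scalar: "poly_jet (cov_scalar C g w \<mu> a)"
  unfolding cov_scalar_def[abs_def] by (intro poly_intros poly_lie_br)

lemma poly_scalar_density: "poly_jet (scalar_density C g w)"
  unfolding scalar_density_def[abs_def] divide_inverse by (intro poly_intros poly_cov_scalar)

text \<open>At vanishing connection, with \<open>\<phi> = U + (\<alpha> x\<^sub>m + \<beta> x\<^sub>m\<^sup>2) W\<close>, the current is
  \<open>-(\<alpha> + 2 \<beta> x\<^sub>m)\<close> times \<open>scalar_charge\<close> in the direction \<open>m\<close>.\<close>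

definition scalar_charge :: "('a::finite \<Rightarrow> 'a \<Rightarrow> 'a \<Rightarrow> real) \<Rightarrow> real \<Rightarrow> real \<Rightarrow>
    ('a \<Rightarrow> real) \<Rightarrow> ('a \<Rightarrow> real) \<Rightarrow> 'a \<Rightarrow> real" where
  "scalar_charge C g w U W c = g * lie_br C W U c + w * W c"

text \<open>The linear profile solves the field equations and carries a constant current. The
  quadratic one is used off-shell: its current grows linearly along m and so has constant
  divergence.\<close>

definition profile :: "'d::finite \<Rightarrow> ('a::finite \<Rightarrow> real) \<Rightarrow> ('a \<Rightarrow> real) \<Rightarrow> real \<Rightarrow> real \<Rightarrow> 'd mfield" where
  "profile m U W \<alpha> \<beta> k x = U (unidx k) + (\<alpha> * x $ m + \<beta> * (x $ m)\<^sup>2) * W (unidx k)"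

lemma smooth_on_differentiable_UNIV: "smooth_on UNIV f \<Longrightarrow> f differentiable at x"
  by (rule smooth_on_differentiable) auto

lemma profile_smooth: "smooth_on UNIV (profile m U W \<alpha> \<beta> k)"
  unfolding profile_def[abs_def] by (intro smooth_on_intros smooth_on_const smooth_on_component) auto

lemma pd_quadratic:
  "pd \<mu> (\<lambda>x :: real ^ 'd::finite. \<alpha> * x $ m + \<beta> * (x $ m)\<^sup>2) = (\<lambda>x. if \<mu> = m then \<alpha> + 2 * \<beta> * x $ m else 0)"
proof
  fix x :: "real ^ 'd"
  have d: "(\<lambda>x :: real ^ 'd. x $ m) differentiable at x" by (rule smooth_on_differentiable_UNIV) simp
  show "pd \<mu> (\<lambda>x :: real ^ 'd. \<alpha> * x $ m + \<beta> * (x $ m)\<^sup>2) x = (if \<mu> = m then \<alpha> + 2 * \<beta> * x $ m else 0)"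
    by (simp add: pd_add pd_cmult pd_mult d power2_eq_square pd_component)
qed

lemma pd_profile:
  "pd \<mu> (profile (m :: 'd::finite) U W \<alpha> \<beta> k) = (\<lambda>x. (if \<mu> = m then \<alpha> + 2 * \<beta> * x $ m else 0) * W (unidx k))"
proof
  fix x :: "real ^ 'd"
  have d: "(\<lambda>x :: real ^ 'd. \<alpha> * x $ m + \<beta> * (x $ m)\<^sup>2) differentiable at x"
    by (rule smooth_on_differentiable_UNIV) (intro smooth_on_intros smooth_on_const smooth_on_component open_UNIV)
  have "pd \<mu> (profile m U W \<alpha> \<beta> k) x
      = pd \<mu> (\<lambda>x. W (unidx k) * (\<alpha> * x $ m + \<beta> * (x $ m)\<^sup>2) + U (unidx k)) x"
    by (rule arg_cong[where f = "\<lambda>f. pd \<mu> f x"]) (simp add: profile_def fun_eq_iff algebra_simps)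
  also have "\<dots> = (if \<mu> = m then \<alpha> + 2 * \<beta> * x $ m else 0) * W (unidx k)"
    using d by (simp add: pd_add pd_cmult pd_quadratic del: distrib_left)
  finally show "pd \<mu> (profile m U W \<alpha> \<beta> k) x = (if \<mu> = m then \<alpha> + 2 * \<beta> * x $ m else 0) * W (unidx k)" .
qed

lemma pd_pd_profile:
  "pd \<nu> (\<lambda>x. (if \<mu> = m then \<alpha> + 2 * \<beta> * x $ m else 0) * K) = (\<lambda>x :: real ^ 'd::finite. if \<mu> = m \<and> \<nu> = m then 2 * \<beta> * K else 0)"
proof (cases "\<mu> = m")
  case True
  show ?thesis
  proof
    fix x :: "real ^ 'd"
    have d: "(\<lambda>x :: real ^ 'd. x $ m) differentiable at x" by (rule smooth_on_differentiable_UNIV) simp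
    have "pd \<nu> (\<lambda>x. (if \<mu> = m then \<alpha> + 2 * \<beta> * x $ m else 0) * K) x = pd \<nu> (\<lambda>x. (2 * \<beta> * K) * x $ m + \<alpha> * K) x"
      by (rule arg_cong[where f = "\<lambda>f. pd \<nu> f x"]) (simp add: True fun_eq_iff algebra_simps)
    also have "\<dots> = (if \<mu> = m \<and> \<nu> = m then 2 * \<beta> * K else 0)"
      using d True by (simp add: pd_add pd_cmult pd_component)
    finally show "pd \<nu> (\<lambda>x. (if \<mu> = m then \<alpha> + 2 * \<beta> * x $ m else 0) * K) x = (if \<mu> = m \<and> \<nu> = m then 2 * \<beta> * K else 0)" .
  qed
qed simp

lemma cov_scalar_profile:
  "cov_scalar C g w \<mu> a (jet (\<lambda>_ _. 0) (profile (m :: 'd::finite) U W \<alpha> \<beta>) x) = (if \<mu> = m then \<alpha> + 2 * \<beta> * x $ m else 0) * W a"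
  by (simp add: cov_scalar_def pd_profile)

context
  fixes V :: "(real ^ 'd::finite) set" and C :: "'a::finite \<Rightarrow> 'a \<Rightarrow> 'a \<Rightarrow> real" and g w :: real
  assumes V: "open V" and C: "structure_constants C" and w: "\<And>a b c. w * (g * C a b c) = 0"
begin

text \<open>Either the shift or the bracket is switched off, so terms containing both
  disappear.\<close>

lemma shift_lie_br: "w * (g * lie_br C x y a) = 0"
proof -
  have "w * (g * lie_br C x y a) = (\<Sum>b\<in>UNIV. \<Sum>c\<in>UNIV. w * (g * C a b c) * (x b * y c))"
    by (simp add: lie_br_def sum_distrib_left mult_ac)
  then show ?thesis by (simp only: w) simp
qed

text \<open>The covariant derivative \<open>D \<mu>\<close> varies by its bracket with \<epsilon>,
  which is orthogonal to \<open>D \<mu>\<close>, so its square does not change to first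
  order.\<close>

lemma scalar_variation:
  fixes A :: "('d \<times> 'a, 'd) zfield"
  assumes f: "fields V (gauge_sector V C g) (scalar_theory C g w st) A \<psi>"
    and \<epsilon>: "smooth_param V \<epsilon>" and x: "x \<in> V"
  defines "T \<equiv> scalar_theory C g w st"
  shows "variation (scalar_density C g w) A \<psi> (zeta_tr (gauge_sector V C g) A \<epsilon>) (matter_tr T A \<psi> \<epsilon>) x = 0"
proof -
  have As: "smooth_on V (A z)" and \<psi>s: "smooth_on V (\<psi> (idx a))" and \<epsilon>s: "smooth_on V (\<epsilon> a)" for z and a :: 'a
    using f \<epsilon> unfolding fields_def smooth_param_def gauge_sector_simps by (auto simp del: split_paired_All)
  have ds: "smooth_on V (matter_tr T A \<psi> \<epsilon> (idx a))" for a :: 'a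
    unfolding T_def scalar_matter_tr
    by (intro smooth_on_intros smooth_on_lie_br smooth_on_const V \<psi>s \<epsilon>s)
  define U where "U t = jet (\<lambda>z y. A z y + t * zeta_tr (gauge_sector V C g) A \<epsilon> z y)
      (\<lambda>k y. \<psi> k y + t * matter_tr T A \<psi> \<epsilon> k y) x" for t
  define D where "D \<mu> a = cov_scalar C g w \<mu> a (U 0)" for \<mu> a
  have dD: "((\<lambda>t. cov_scalar C g w \<mu> a (U t)) has_real_derivative
      g * lie_br C (D \<mu>) (\<lambda>b. \<epsilon> b x) a) (at 0)" for \<mu> a
  proof -
    let ?A = "\<lambda>b. A (\<mu>, b) x" and ?\<phi> = "\<lambda>b. \<psi> (idx b) x" and ?e = "\<lambda>b. \<epsilon> b x"
    let ?dA = "\<lambda>b. zeta_tr (gauge_sector V C g) A \<epsilon> (\<mu>, b) x" and ?d\<phi> = "\<lambda>b. matter_tr T A \<psi> \<epsilon> (idx b) x"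
    let ?p = "\<lambda>b. pd \<mu> (\<psi> (idx b)) x" and ?q = "\<lambda>b. pd \<mu> (\<epsilon> b) x"
    have pt: "pd \<mu> (\<lambda>y. \<psi> (idx a) y + t * matter_tr T A \<psi> \<epsilon> (idx a) y) x
        = ?p a + t * pd \<mu> (matter_tr T A \<psi> \<epsilon> (idx a)) x" for t
      using pds_linear[OF V \<psi>s ds x, of "[\<mu>]"] by simp
    have pdm: "pd \<mu> (matter_tr T A \<psi> \<epsilon> (idx a)) x = g * (lie_br C ?p ?e a + lie_br C ?\<phi> ?q a) + w * ?q a"
    proof -
      have d: "(\<lambda>y. lie_br C (\<lambda>b. \<psi> (idx b) y) (\<lambda>b. \<epsilon> b y) a) differentiable at x"
        by (rule smooth_on_differentiable[OF smooth_on_lie_br V x]) (intro V \<psi>s \<epsilon>s)+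
      then show ?thesis unfolding T_def scalar_matter_tr
        using smooth_on_differentiable[OF \<psi>s V x] smooth_on_differentiable[OF \<epsilon>s V x]
        by (simp add: pd_add pd_cmult pd_lie_br)
    qed
    have "cov_scalar C g w \<mu> a (U t) = (?p a + t * pd \<mu> (matter_tr T A \<psi> \<epsilon> (idx a)) x)
        + g * lie_br C (\<lambda>b. ?A b + t * ?dA b) (\<lambda>b. ?\<phi> b + t * ?d\<phi> b) a - w * (?A a + t * ?dA a)" for t
      unfolding cov_scalar_def U_def jet_simps pds.simps pt ..
    moreover have "((\<lambda>t. (?p a + t * pd \<mu> (matter_tr T A \<psi> \<epsilon> (idx a)) x)
        + g * lie_br C (\<lambda>b. ?A b + t * ?dA b) (\<lambda>b. ?\<phi> b + t * ?d\<phi> b) a - w * (?A a + t * ?dA a))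
      has_real_derivative
        pd \<mu> (matter_tr T A \<psi> \<epsilon> (idx a)) x + g * (lie_br C ?dA ?\<phi> a + lie_br C ?A ?d\<phi> a) - w * ?dA a) (at 0)"
      by (rule derivative_eq_intros lie_br_derivative refl | simp)+
    \<comment> \<open>Derivatives of \<epsilon> cancel by antisymmetry together with the shift term,
      the terms of second order in g combine by the derivation rule, and the mixed terms in w
      vanish.\<close>
    moreover have "pd \<mu> (matter_tr T A \<psi> \<epsilon> (idx a)) x + g * (lie_br C ?dA ?\<phi> a + lie_br C ?A ?d\<phi> a) - w * ?dA a
        = g * lie_br C (D \<mu>) ?e a"
    proof -
      have D: "D \<mu> = (\<lambda>b. ?p b + (g * lie_br C ?A ?\<phi> b + - w * ?A b))"
        by (simp add: D_def cov_scalar_def U_def fun_eq_iff)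
      have "lie_br C (lie_br C ?A ?e) ?\<phi> a + lie_br C ?A (lie_br C ?\<phi> ?e) a = lie_br C (lie_br C ?A ?\<phi>) ?e a"
        by (rule lie_br_leibniz[OF C])
      then have "g * (lie_br C (lie_br C ?A ?e) ?\<phi> a + lie_br C ?A (lie_br C ?\<phi> ?e) a)
        = g * lie_br C (lie_br C ?A ?\<phi>) ?e a" by simp
      moreover have "lie_br C ?q ?\<phi> a = - lie_br C ?\<phi> ?q a" by (rule lie_br_antisym[OF C])
      ultimately show ?thesis unfolding pdm D lie_br_add lie_br_scale
        using shift_lie_br[of ?A ?e a]
        by (auto simp: T_def scalar_matter_tr lie_br_add lie_br_scale algebra_simps)
    qed
    ultimately show ?thesis by simp
  qed
  have "((\<lambda>t. scalar_density C g w (U t)) has_real_derivative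
      (\<Sum>\<mu>\<in>UNIV. \<Sum>a\<in>UNIV. 2 * (g * lie_br C (D \<mu>) (\<lambda>b. \<epsilon> b x) a * D \<mu> a)) / 2) (at 0)"
    unfolding scalar_density_def
    by (rule derivative_eq_intros dD refl | simp add: D_def)+
  moreover have "(\<Sum>a\<in>UNIV. 2 * (g * lie_br C (D \<mu>) (\<lambda>b. \<epsilon> b x) a * D \<mu> a)) = 0" for \<mu>
    using arg_cong[OF dot_lie_br_self[OF C, of "D \<mu>" "\<lambda>b. \<epsilon> b x"], of "\<lambda>r. 2 * g * r"]
    by (simp add: sum_distrib_left mult_ac)
  ultimately show ?thesis
    unfolding variation_def U_def[symmetric] by (simp add: DERIV_imp_deriv)
qed

lemma scalar_represents_algebra:
  "represents_algebra V (gauge_sector V C g) (scalar_theory C g w st)"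
  unfolding represents_algebra_def
proof (intro allI impI ballI)
  fix A :: "('d \<times> 'a, 'd) zfield" and \<psi> :: "'d mfield" and \<epsilon> \<eta> :: "('a, 'd) param" and k x
  let ?T = "scalar_theory C g w st" and ?c = "unidx k :: 'a"
  let ?\<phi> = "\<lambda>b. \<psi> (idx b) x" and ?e = "\<lambda>b. \<epsilon> b x" and ?h = "\<lambda>b. \<eta> b x"
  \<comment> \<open>\<open>A'\<close> is arbitrary because the transformation of the scalars does
    not involve the connection.\<close>
  have d: "deriv (\<lambda>t. matter_tr ?T (A' t) (\<lambda>l y. \<psi> l y + t * matter_tr ?T A \<psi> \<epsilon> l y) \<eta> k x) 0
      = g * (g * lie_br C (lie_br C ?\<phi> (\<lambda>b. \<epsilon> b x)) (\<lambda>b. \<eta> b x) ?c)" for A' \<epsilon> \<eta>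
  proof (rule DERIV_imp_deriv)
    let ?e = "\<lambda>b. \<epsilon> b x" and ?h = "\<lambda>b. \<eta> b x"
    have "((\<lambda>t. g * lie_br C (\<lambda>b. ?\<phi> b + t * matter_tr ?T A \<psi> \<epsilon> (idx b) x) (\<lambda>b. ?h b + t * 0) ?c + w * ?h ?c)
       has_real_derivative g * (lie_br C (\<lambda>b. matter_tr ?T A \<psi> \<epsilon> (idx b) x) ?h ?c + lie_br C ?\<phi> (\<lambda>b. 0) ?c)) (at 0)"
      by (rule derivative_eq_intros lie_br_derivative refl | simp)+
    moreover have "g * (lie_br C (\<lambda>b. matter_tr ?T A \<psi> \<epsilon> (idx b) x) ?h ?c + lie_br C ?\<phi> (\<lambda>b. 0) ?c)
        = g * (g * lie_br C (lie_br C ?\<phi> ?e) ?h ?c)"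
      using shift_lie_br[of ?e ?h ?c]
      by (auto simp: scalar_matter_tr lie_br_add lie_br_scale algebra_simps)
    moreover have "(\<lambda>t. matter_tr ?T (A' t) (\<lambda>l y. \<psi> l y + t * matter_tr ?T A \<psi> \<epsilon> l y) \<eta> k x) =
       (\<lambda>t. g * lie_br C (\<lambda>b. ?\<phi> b + t * matter_tr ?T A \<psi> \<epsilon> (idx b) x) (\<lambda>b. ?h b + t * 0) ?c + w * ?h ?c)"
      by (simp add: scalar_matter_tr)
    ultimately show "((\<lambda>t. matter_tr ?T (A' t) (\<lambda>l y. \<psi> l y + t * matter_tr ?T A \<psi> \<epsilon> l y) \<eta> k x)
       has_real_derivative g * (g * lie_br C (lie_br C ?\<phi> ?e) ?h ?c)) (at 0)"
      by (simp only:)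
  qed
  \<comment> \<open>The commutator of two adjoint actions is the adjoint action of the
    bracket.\<close>
  have "lie_br C (lie_br C ?\<phi> ?h) ?e ?c + lie_br C ?\<phi> (lie_br C ?e ?h) ?c = lie_br C (lie_br C ?\<phi> ?e) ?h ?c"
    by (rule lie_br_leibniz[OF C])
  then have "g * (g * lie_br C (lie_br C ?\<phi> ?e) ?h ?c) - g * (g * lie_br C (lie_br C ?\<phi> ?h) ?e ?c)
      = g * (g * lie_br C ?\<phi> (lie_br C ?e ?h) ?c)"
    by (simp add: algebra_simps flip: distrib_left)
  then show "deriv (\<lambda>t. matter_tr ?T (\<lambda>z y. A z y + t * zeta_tr (gauge_sector V C g) A \<epsilon> z y)
        (\<lambda>l y. \<psi> l y + t * matter_tr ?T A \<psi> \<epsilon> l y) \<eta> k x) 0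
     - deriv (\<lambda>t. matter_tr ?T (\<lambda>z y. A z y + t * zeta_tr (gauge_sector V C g) A \<eta> z y)
        (\<lambda>l y. \<psi> l y + t * matter_tr ?T A \<psi> \<eta> l y) \<epsilon> k x) 0
     = matter_tr ?T A \<psi> (bracket (gauge_sector V C g) \<epsilon> \<eta>) k x"
    unfolding d using shift_lie_br[of ?e ?h ?c]
    by (simp add: scalar_matter_tr lie_br_scale)
qed

lemma scalar_invariant_theory:
  assumes st: "\<not> is_Invariants st" and p: "proper_setting V (gauge_sector V C g) (scalar_theory C g w st)"
  shows "invariant_theory V (gauge_sector V C g) (scalar_theory C g w st)"
proof -
  let ?T = "scalar_theory C g w st"
  have "n_invariants st = 0" using st by (cases st) (auto simp: n_invariants_def)
  moreover have "depends_only_on (jvars CARD('a) Q 1) (scalar_density C g w :: ('d \<times> 'a, 'd) jet \<Rightarrow> real)" for Q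
    unfolding depends_only_on_def
  proof (intro allI impI)
    fix u v :: "('d \<times> 'a, 'd) jet" assume "\<forall>i\<in>jvars CARD('a) Q 1. u i = v i"
    then have "u (Psi (idx a) [\<mu>]) = v (Psi (idx a) [\<mu>])" "u (Psi (idx a) []) = v (Psi (idx a) [])"
      "u (Zeta (\<mu>, a) []) = v (Zeta (\<mu>, a) [])" for \<mu> and a :: 'a
      by (auto simp: jvars_def)
    then show "scalar_density C g w u = scalar_density C g w v"
      by (simp add: scalar_density_def cov_scalar_def)
  qed
  ultimately have 1: "local_function (jet_domain (gauge_sector V C g)) (matter ?T)
    (n_invariants (setting ?T)) (deriv_order ?T) (L_inv ?T)"
    by (simp add: local_function_def poly_smooth poly_scalar_density)
  have tc: "tr_coeff ?T k a s x = (\<lambda>u. if s = [] then g * (\<Sum>b\<in>UNIV. C (unidx k) b a * u (Psi (idx b) []))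
       + (if unidx k = a then w else 0) else 0)" for k a s x
    by (simp add: scalar_theory_def)
  have 2: "depends_only_on (jvars (matter ?T) 0 0) (tr_coeff ?T k a s x)" for k a s x
    unfolding tc depends_only_on_def by (auto simp: jvars_def intro!: sum.cong)
  have 3: "smooth_on V (\<lambda>x. tr_coeff ?T k a s x (jet A \<psi> x))"
    if f: "fields V (gauge_sector V C g) ?T A \<psi>" for A \<psi> k a s
  proof (cases "s = []")
    case True
    have \<psi>s: "smooth_on V (\<psi> (idx a))" for a :: 'a using f by (simp add: fields_def)
    have "smooth_on V (\<lambda>x. g * (\<Sum>b\<in>UNIV. C (unidx k) b a * \<psi> (idx b) x) + (if unidx k = a then w else 0))"
      by (intro smooth_on_intros smooth_on_const V \<psi>s)
    then show ?thesis using True by (simp add: tc)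
  qed (simp add: tc)
  have "inv_density ?T = scalar_density C g w"
    using st by (simp add: inv_density_def insert_not_Invariants fun_eq_iff)
  then have 4: "invariant_action V (gauge_sector V C g) ?T"
    using scalar_variation by (intro invariant_actionI) simp
  show ?thesis unfolding invariant_theory_def
    by (intro conjI allI impI exI[of _ 0] 1 2 3 4 p) simp_all
qed

lemma jpd_cov_scalar:
  "jpd v (cov_scalar C g w \<mu> a) u = (if v = Psi (idx a) [\<mu>] then 1 else 0)
    + g * (lie_br C (\<lambda>b. if v = Zeta (\<mu>, b) [] then 1 else 0) (\<lambda>b. u (Psi (idx b) [])) a
      + lie_br C (\<lambda>b. u (Zeta (\<mu>, b) [])) (\<lambda>b. if v = Psi (idx b) [] then 1 else 0) a)
    - w * (if v = Zeta (\<mu>, a) [] then 1 else 0)"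
  unfolding cov_scalar_def[abs_def]
  by (simp add: jpd_add jpd_diff jpd_cmult jpd_lie_br jpd_var poly_intros poly_lie_br)

lemma jpd_scalar_density:
  "jpd v (scalar_density C g w) u = (\<Sum>\<mu>\<in>UNIV. \<Sum>a\<in>UNIV. cov_scalar C g w \<mu> a u * jpd v (cov_scalar C g w \<mu> a) u)"
proof -
  have "jpd v (scalar_density C g w) u = jpd v (\<lambda>u. 1 / 2 * (\<Sum>\<mu>\<in>UNIV. \<Sum>a\<in>UNIV. (cov_scalar C g w \<mu> a u)\<^sup>2)) u"
    by (simp add: scalar_density_def[abs_def])
  also have "\<dots> = 1 / 2 * (\<Sum>\<mu>\<in>UNIV. \<Sum>a\<in>UNIV. 2 * cov_scalar C g w \<mu> a u * jpd v (cov_scalar C g w \<mu> a) u)"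
    by (simp add: jpd_cmult jpd_sum jpd_square poly_intros poly_cov_scalar del: times_divide_eq_left)
  finally show ?thesis by (simp add: sum_distrib_left mult.assoc)
qed

lemma jpd_scalar_density_profile:
  fixes m :: 'd and U W :: "'a \<Rightarrow> real" and \<alpha> \<beta> :: real
  defines "J \<equiv> jet (\<lambda>_ _. 0) (profile m U W \<alpha> \<beta>)"
  shows "jpd (Psi (idx c) []) (scalar_density C g w) (J x) = 0"
    "jpd (Psi (idx c) [\<nu>]) (scalar_density C g w) (J x) = (if \<nu> = m then \<alpha> + 2 * \<beta> * x $ m else 0) * W c"
    "jpd (Zeta (\<nu>, c) []) (scalar_density C g w) (J x) = - ((if \<nu> = m then \<alpha> + 2 * \<beta> * x $ m else 0) * scalar_charge C g w U W c)"
    "jpd (Zeta z [\<nu>]) (scalar_density C g w) (J x) = 0"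
proof -
  let ?q = "\<lambda>\<mu>. if \<mu> = m then \<alpha> + 2 * \<beta> * x $ m else 0"
  have cs: "cov_scalar C g w \<mu> a (J x) = ?q \<mu> * W a" for \<mu> a
    unfolding J_def by (rule cov_scalar_profile)
  have J0: "J x (Zeta z s) = 0" for z s
    using pds_outside[of "{}" "\<lambda>_. 0" x s] by (simp add: J_def)
  show "jpd (Psi (idx c) []) (scalar_density C g w) (J x) = 0"
    by (simp add: jpd_scalar_density jpd_cov_scalar J0)
  have "jpd (Psi (idx c) [\<nu>]) (scalar_density C g w) (J x)
      = (\<Sum>\<mu>\<in>UNIV. \<Sum>a\<in>UNIV. if a = c then (if \<mu> = \<nu> then ?q \<mu> * W c else 0) else 0)"
    unfolding jpd_scalar_density jpd_cov_scalar cs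
    by (intro sum.cong refl) (auto simp: J0)
  then show "jpd (Psi (idx c) [\<nu>]) (scalar_density C g w) (J x) = ?q \<nu> * W c" by simp
  show "jpd (Zeta z [\<nu>]) (scalar_density C g w) (J x) = 0"
    by (simp add: jpd_scalar_density jpd_cov_scalar J0)
  have br: "lie_br C (\<lambda>b. if b = c then 1 else 0) \<phi> a = (\<Sum>d\<in>UNIV. C a c d * \<phi> d)" for \<phi> a
  proof -
    have "lie_br C (\<lambda>b. if b = c then 1 else 0) \<phi> a = (\<Sum>b\<in>UNIV. if b = c then \<Sum>d\<in>UNIV. C a b d * \<phi> d else 0)"
      unfolding lie_br_def by (intro sum.cong refl) auto
    then show ?thesis by simp
  qed
  have "jpd (Zeta (\<nu>, c) []) (scalar_density C g w) (J x)
    = (\<Sum>\<mu>\<in>UNIV. if \<mu> = \<nu> then \<Sum>a\<in>UNIV. ?q \<mu> * W a *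
      (g * lie_br C (\<lambda>b. if b = c then 1 else 0) (\<lambda>b. J x (Psi (idx b) [])) a - w * (if a = c then 1 else 0)) else 0)"
    unfolding jpd_scalar_density jpd_cov_scalar cs
    by (intro sum.cong refl) (auto simp: J0 eq_commute[of _ c] intro!: sum.cong)
  also have "\<dots> = ?q \<nu> * (g * (\<Sum>a\<in>UNIV. W a * lie_br C (\<lambda>b. if b = c then 1 else 0) (\<lambda>b. J x (Psi (idx b) [])) a) - w * W c)"
  proof -
    have "(\<Sum>a\<in>UNIV. ?q \<nu> * W a * (g * B a - w * (if a = c then 1 else 0)))
        = (\<Sum>a\<in>UNIV. ?q \<nu> * (g * (W a * B a)) - (if a = c then ?q \<nu> * (w * W a) else 0))" for B
      by (intro sum.cong refl) (auto simp: algebra_simps)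
    then show ?thesis by (simp add: sum_subtractf sum_distrib_left right_diff_distrib)
  qed
  also have "(\<Sum>a\<in>UNIV. W a * lie_br C (\<lambda>b. if b = c then 1 else 0) (\<lambda>b. J x (Psi (idx b) [])) a)
      = - lie_br C W (\<lambda>b. J x (Psi (idx b) [])) c"
    unfolding br
    by (subst structure_constantsD(1)[OF C]) (simp add: lie_br_def sum_distrib_left sum_negf mult_ac)
  \<comment> \<open>The part of the profile along W drops out because W commutes with itself. The
    charge is therefore the same at every point.\<close>
  also have "lie_br C W (\<lambda>b. J x (Psi (idx b) [])) c = lie_br C W U c"
  proof -
    have "(\<lambda>b. J x (Psi (idx b) [])) = (\<lambda>b. U b + (\<alpha> * x $ m + \<beta> * (x $ m)\<^sup>2) * W b)"
      by (simp add: J_def profile_def fun_eq_iff)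
    moreover have "lie_br C W W c = 0" using lie_br_antisym[OF C, of W W c] by simp
    ultimately show ?thesis by (simp add: lie_br_add lie_br_scale)
  qed
  finally show "jpd (Zeta (\<nu>, c) []) (scalar_density C g w) (J x) = - (?q \<nu> * scalar_charge C g w U W c)"
    by (simp add: scalar_charge_def algebra_simps)
qed

text \<open>The coefficients of \<open>Lg\<close> are the charges: its Euler derivative is the exact
  opposite of the constant current of the profile with \<alpha> = 1, \<beta> = 0. The profile with
  \<alpha> = 0, \<beta> = 1 has nonzero divergence, which at zero connection is the ordinary
  one.\<close>

lemma scalar_theory_nontrivial:
  fixes m :: 'd
  assumes ne: "V \<noteq> {}" and K: "scalar_charge C g w U W c \<noteq> 0"
  defines "Lg \<equiv> (\<lambda>u. \<Sum>a\<in>UNIV. scalar_charge C g w U W a * u (Zeta (m, a) []))"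
  assumes st: "st = Background (\<lambda>_ _. 0) \<or> st = Extra Lg"
  defines "T \<equiv> scalar_theory C g w st"
  shows "invariant_theory V (gauge_sector V C g) T"
    "\<not> divergence_identically_zero V (gauge_sector V C g) T"
    "\<not> current_zero_on_shell V (gauge_sector V C g) T"
proof -
  let ?K = "gauge_sector V C g"
  let ?J = "\<lambda>\<alpha> \<beta>. jet (\<lambda>_ _. 0) (profile m U W \<alpha> \<beta>)"
  have pL: "poly_jet Lg" unfolding Lg_def by (intro poly_intros)
  have "depends_only_on (jvars 0 0 1) Lg"
    unfolding depends_only_on_def Lg_def by (auto simp: jvars_def intro!: sum.cong)
  then have "proper_setting V ?K T"
    using st by (auto simp: proper_setting_def T_def local_function_def poly_smooth[OF pL])
  then show "invariant_theory V ?K T"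
    unfolding T_def using st by (intro scalar_invariant_theory) auto
  have conf: "configuration V ?K T (\<lambda>_ _. 0) (profile m U W \<alpha> \<beta>)" for \<alpha> \<beta>
    using st smooth_on_subset[OF profile_smooth subset_UNIV]
    by (auto simp: configuration_def fields_def T_def)
  have dT: "deriv_order T = Suc 0" by (simp add: T_def)
  have ins: "insert_invariants (setting T) u = u" for u
    using st by (auto simp: T_def insert_invariants_def)
  have cur: "current ?K T (\<lambda>_ _. 0) (profile m U W \<alpha> \<beta>) \<nu> a
      = (\<lambda>x. (if \<nu> = m then \<alpha> + 2 * \<beta> * x $ m else 0) * - scalar_charge C g w U W a)" for \<alpha> \<beta> \<nu> a
    unfolding current_def source_def ins
    by (simp add: T_def fun_eq_iff euler_1 jpd_scalar_density_profile)
  show "\<not> divergence_identically_zero V ?K T"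
  proof
    assume "divergence_identically_zero V ?K T"
    moreover obtain x where x: "x \<in> V" using ne by blast
    ultimately have "covdiv ?K (\<lambda>_ _. 0) (current ?K T (\<lambda>_ _. 0) (profile m U W 0 1)) c x = 0"
      using conf by (auto simp: divergence_identically_zero_def simp del: gauge_sector_simps)
    then have "(\<Sum>\<mu>\<in>UNIV. if \<mu> = m then 2 * - scalar_charge C g w U W c else 0) = 0"
      unfolding gauge_sector_simps cur pd_pd_profile by simp
    then show False using K by simp
  qed
  define L where "L = (if is_Background st then (\<lambda>_. 0) else Lg)"
  have L: "total_density T = (\<lambda>u. scalar_density C g w u + L u)"
    using st unfolding total_density_def inv_density_def ins
    by (auto simp: T_def L_def fun_eq_iff)
  have jL: "jpd v L u = (if is_Background st then 0 else \<Sum>a\<in>UNIV. scalar_charge C g w U W a * (if v = Zeta (m, a) [] then 1 else 0))" for v u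
    by (simp add: L_def Lg_def jpd_sum jpd_cmult jpd_var poly_intros)
  have jt: "jpd v (total_density T) u = jpd v (scalar_density C g w) u + jpd v L u" for v u
    unfolding L by (simp add: jpd_add poly_scalar_density L_def poly_const pL)
  have "on_shell V ?K T (\<lambda>_ _. 0) (profile m U W 1 0)"
    unfolding on_shell_def
  proof (intro conjI impI allI ballI)
    fix k x assume "k < matter T"
    then have k: "k = idx (unidx k :: 'a)" by (simp add: T_def idx_unidx)
    show "euler (deriv_order T) (total_density T) (Psi k) (?J 1 0) x = 0"
      by (subst k) (simp add: dT euler_1 jt jL jpd_scalar_density_profile pd_pd_profile)
  next
    fix z :: "'d \<times> 'a" and x assume b: "\<not> is_Background (setting T)"
    obtain \<nu> a where z: "z = (\<nu>, a)" by (cases z)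
    have nb: "\<not> is_Background st" using b by (simp add: T_def)
    have "jpd (Zeta (\<nu>, a) []) L u = (if \<nu> = m then scalar_charge C g w U W a else 0)" for u
      unfolding jL using nb by (simp add: if_distrib[of "\<lambda>r. _ * r"] cong: if_cong)
    moreover have "jpd (Zeta (\<nu>, a) [\<mu>]) L u = 0" for \<mu> u by (simp add: jL)
    ultimately show "zeta_euler ?K (deriv_order T) (total_density T) (?J 1 0) z x = 0"
      unfolding z gauge_sector_simps
      by (simp add: dT euler_1 jt jpd_scalar_density_profile)
  qed
  moreover obtain x where "x \<in> V" using ne by blast
  moreover have "current ?K T (\<lambda>_ _. 0) (profile m U W 1 0) m c x \<noteq> 0" using K by (simp add: cur)
  ultimately show "\<not> current_zero_on_shell V ?K T"
    using conf[of 1 0] unfolding current_zero_on_shell_def by blast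
qed

end

lemma gauge_Background_Extra:
  fixes V :: "(real ^ 'd::finite) set" and C :: "'a::finite \<Rightarrow> 'a \<Rightarrow> 'a \<Rightarrow> real"
  assumes V: "open V" "V \<noteq> {}" and C: "structure_constants C"
  shows "\<exists>T. is_Background (setting T) \<and>
      invariant_theory V (gauge_sector V C g) T \<and> represents_algebra V (gauge_sector V C g) T \<and>
      \<not> divergence_identically_zero V (gauge_sector V C g) T \<and>
      \<not> current_zero_on_shell V (gauge_sector V C g) T"
    "\<exists>T. is_Extra (setting T) \<and>
      invariant_theory V (gauge_sector V C g) T \<and> represents_algebra V (gauge_sector V C g) T \<and>
      \<not> divergence_identically_zero V (gauge_sector V C g) T \<and>
      \<not> current_zero_on_shell V (gauge_sector V C g) T"
proof -
  have "\<exists>w U W c. (\<forall>a b c. w * (g * C a b c) = 0) \<and> scalar_charge C g w U W c \<noteq> 0"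
  proof (cases "\<exists>a b c. g * C a b c \<noteq> 0")
    case True
    then obtain a b c where ne: "g * C a b c \<noteq> 0" by blast
    \<comment> \<open>For these basis vectors the bracket has component \<open>C a b c\<close>. If
      \<open>g * C\<close> vanishes identically, the shift with W = 1 supplies a unit charge
      instead.\<close>
    define U W :: "'a \<Rightarrow> real" where "U = (\<lambda>i. if i = c then 1 else 0)" and "W = (\<lambda>i. if i = b then 1 else 0)"
    have "lie_br C W U a = C a b c"
      by (simp add: lie_br_def U_def W_def if_distrib[of "\<lambda>r. r * _"] if_distrib[of "\<lambda>r. _ * r"] cong: if_cong)
    then have "scalar_charge C g 0 U W a \<noteq> 0" using ne by (simp add: scalar_charge_def)
    then show ?thesis by (intro exI[of _ 0] exI[of _ U] exI[of _ W] exI[of _ a]) simp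
  next
    case False
    then show ?thesis
      by (intro exI[of _ 1] exI[of _ "\<lambda>_. 0"] exI[of _ "\<lambda>_. 1"] exI[of _ undefined]) (auto simp: scalar_charge_def)
  qed
  then obtain w U W c where w: "\<And>a b c. w * (g * C a b c) = 0" and K: "scalar_charge C g w U W c \<noteq> 0" by blast
  let ?Lg = "\<lambda>u :: ('d \<times> 'a, 'd) jet. \<Sum>a\<in>UNIV. scalar_charge C g w U W a * u (Zeta (undefined, a) [])"
  note * = scalar_theory_nontrivial[OF V(1) C w V(2) K, where m = undefined] scalar_represents_algebra[OF V(1) C w]
  show "\<exists>T. is_Background (setting T) \<and>
      invariant_theory V (gauge_sector V C g) T \<and> represents_algebra V (gauge_sector V C g) T \<and>
      \<not> divergence_identically_zero V (gauge_sector V C g) T \<and>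
      \<not> current_zero_on_shell V (gauge_sector V C g) T"
    by (rule exI[of _ "scalar_theory C g w (Background (\<lambda>_ _. 0))"])
      (use * [where st = "Background (\<lambda>_ _. 0)"] in simp)
  show "\<exists>T. is_Extra (setting T) \<and>
      invariant_theory V (gauge_sector V C g) T \<and> represents_algebra V (gauge_sector V C g) T \<and>
      \<not> divergence_identically_zero V (gauge_sector V C g) T \<and>
      \<not> current_zero_on_shell V (gauge_sector V C g) T"
    by (rule exI[of _ "scalar_theory C g w (Extra ?Lg)"])
      (use *[where st = "Extra ?Lg"] in simp)
qed

section \<open>Two connections\<close>

text \<open>The map \<open>X\<close> names the jet variables of a connection, so that one
  computation serves both the field \<zeta> and the second connection among the matter
  fields.\<close>

definition field_strength :: "('a::finite \<Rightarrow> 'a \<Rightarrow> 'a \<Rightarrow> real) \<Rightarrow> real \<Rightarrow>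
    ('d \<Rightarrow> 'a \<Rightarrow> 'd list \<Rightarrow> ('z, 'd) jvar) \<Rightarrow> 'd \<Rightarrow> 'd \<Rightarrow> 'a \<Rightarrow> ('z, 'd) jet \<Rightarrow> real" where
  "field_strength C g X m n a u = u (X n a [m]) - u (X m a [n])
     + g * lie_br C (\<lambda>b. u (X m b [])) (\<lambda>b. u (X n b [])) a"

abbreviation connection_var :: "'d \<Rightarrow> 'a \<Rightarrow> 'd list \<Rightarrow> ('d \<times> 'a, 'd) jvar" where
  "connection_var \<mu> a \<equiv> Zeta (\<mu>, a)"

abbreviation vector_var :: "'d::finite \<Rightarrow> 'a::finite \<Rightarrow> 'd list \<Rightarrow> ('d \<times> 'a, 'd) jvar" where
  "vector_var \<mu> a \<equiv> Psi (idx (\<mu>, a))"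

lemma idx_less_prod: "idx (z :: 'd::finite \<times> 'a::finite) < CARD('d) * CARD('a)"
  using idx_less[of z] by simp

lemma poly_field_strength: "poly_jet (field_strength C g X m n a)"
  unfolding field_strength_def[abs_def] by (intro poly_intros poly_lie_br)

lemma jpd_field_strength:
  "jpd v (field_strength C g X m n a) u = (if v = X n a [m] then 1 else 0) - (if v = X m a [n] then 1 else 0)
    + g * (lie_br C (\<lambda>b. if v = X m b [] then 1 else 0) (\<lambda>b. u (X n b [])) a
      + lie_br C (\<lambda>b. u (X m b [])) (\<lambda>b. if v = X n b [] then 1 else 0) a)"
  unfolding field_strength_def[abs_def]
  by (simp add: jpd_add jpd_diff jpd_cmult jpd_lie_br jpd_var poly_intros poly_lie_br)

definition curvature_square :: "('a::finite \<Rightarrow> 'a \<Rightarrow> 'a \<Rightarrow> real) \<Rightarrow> real \<Rightarrow>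
    ('d \<Rightarrow> 'a \<Rightarrow> 'd list \<Rightarrow> ('z, 'd) jvar) \<Rightarrow> 'd \<Rightarrow> 'd \<Rightarrow> ('z, 'd) jet \<Rightarrow> real" where
  "curvature_square C g X m n u = (\<Sum>a\<in>UNIV. (field_strength C g X m n a u)\<^sup>2)"

lemma poly_curvature_square: "poly_jet (curvature_square C g X m n)"
  unfolding curvature_square_def[abs_def] by (intro poly_intros poly_field_strength)

lemma jpd_curvature_square:
  "jpd v (curvature_square C g X m n) u =
    2 * (\<Sum>a\<in>UNIV. field_strength C g X m n a u * jpd v (field_strength C g X m n a) u)"
  unfolding curvature_square_def[abs_def]
  by (simp add: jpd_sum jpd_square poly_intros poly_field_strength sum_distrib_left mult.assoc)

text \<open>Covariance of the curvature: second derivatives of \<epsilon> cancel because they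
  commute, brackets of its first derivatives with the connection cancel by antisymmetry, and the
  double brackets combine by the derivation rule.\<close>

lemma field_strength_derivative:
  fixes g :: real and A :: "'d::finite \<Rightarrow> 'a::finite \<Rightarrow> 'd scalar" and \<epsilon> :: "('a, 'd) param"
  assumes C: "structure_constants C" and V: "open V" "x \<in> V"
    and A: "\<And>\<mu> a. smooth_on V (A \<mu> a)" and \<epsilon>: "\<And>a. smooth_on V (\<epsilon> a)"
  defines "dA \<equiv> (\<lambda>\<mu> a y. pd \<mu> (\<epsilon> a) y + g * lie_br C (\<lambda>b. A \<mu> b y) (\<lambda>b. \<epsilon> b y) a)"
  assumes U: "\<And>t \<mu> a. U t (X \<mu> a []) = A \<mu> a x + t * dA \<mu> a x"
    "\<And>t \<mu> a \<nu>. U t (X \<mu> a [\<nu>]) = pd \<nu> (A \<mu> a) x + t * pd \<nu> (dA \<mu> a) x"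
  shows "((\<lambda>t. field_strength C g X m n a (U t)) has_real_derivative
    g * lie_br C (\<lambda>b. field_strength C g X m n b (U 0)) (\<lambda>b. \<epsilon> b x) a) (at 0)"
proof -
  let ?A = "\<lambda>\<mu> b. A \<mu> b x" and ?e = "\<lambda>b. \<epsilon> b x" and ?E = "\<lambda>\<mu> b. pd \<mu> (\<epsilon> b) x"
    and ?P = "\<lambda>\<nu> \<mu> b. pd \<nu> (A \<mu> b) x"
  have pdA: "pd \<nu> (dA \<mu> a) x = pd \<nu> (pd \<mu> (\<epsilon> a)) x + g * (lie_br C (?P \<nu> \<mu>) ?e a + lie_br C (?A \<mu>) (?E \<nu>) a)"
    for \<mu> \<nu> a
  proof -
    have "(\<lambda>y. lie_br C (\<lambda>b. A \<mu> b y) (\<lambda>b. \<epsilon> b y) a) differentiable at x"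
      by (rule smooth_on_differentiable[OF smooth_on_lie_br V]) (intro V A \<epsilon>)+
    then show ?thesis
      unfolding dA_def using smooth_on_differentiable[OF A V] smooth_on_differentiable[OF \<epsilon> V]
        smooth_on_differentiable[OF smooth_on_pd[OF \<epsilon>] V]
      by (simp add: pd_add pd_cmult pd_lie_br)
  qed
  have "((\<lambda>t. field_strength C g X m n a (U t)) has_real_derivative
      pd m (dA n a) x - pd n (dA m a) x
      + g * (lie_br C (\<lambda>b. dA m b x) (?A n) a + lie_br C (?A m) (\<lambda>b. dA n b x) a)) (at 0)"
    unfolding field_strength_def U
    by (rule derivative_eq_intros lie_br_derivative refl | simp)+
  moreover have "pd m (dA n a) x - pd n (dA m a) x
      + g * (lie_br C (\<lambda>b. dA m b x) (?A n) a + lie_br C (?A m) (\<lambda>b. dA n b x) a)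
    = g * lie_br C (\<lambda>b. field_strength C g X m n b (U 0)) ?e a"
  proof -
    have "lie_br C (lie_br C (?A m) ?e) (?A n) a + lie_br C (?A m) (lie_br C (?A n) ?e) a
        = lie_br C (lie_br C (?A m) (?A n)) ?e a" by (rule lie_br_leibniz[OF C])
    then have jac: "g * (g * lie_br C (lie_br C (?A m) ?e) (?A n) a) + g * (g * lie_br C (?A m) (lie_br C (?A n) ?e) a)
        = g * (g * lie_br C (lie_br C (?A m) (?A n)) ?e a)" by (simp flip: distrib_left)
    have F: "(\<lambda>b. field_strength C g X m n b (U 0)) =
        (\<lambda>b. ?P m n b + (- 1 * ?P n m b + g * lie_br C (?A m) (?A n) b))"
      by (simp add: field_strength_def U fun_eq_iff)
    have "lie_br C (?E m) (?A n) a = - lie_br C (?A n) (?E m) a" by (rule lie_br_antisym[OF C])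
    moreover have "pd m (pd n (\<epsilon> a)) x = pd n (pd m (\<epsilon> a)) x" by (rule pd_commute[OF \<epsilon> V])
    ultimately show ?thesis
      unfolding F lie_br_add lie_br_scale pdA using jac
      by (simp add: dA_def lie_br_add lie_br_scale algebra_simps)
  qed
  ultimately show ?thesis by simp
qed

lemma curvature_square_derivative:
  assumes C: "structure_constants C"
    and F: "\<And>a. ((\<lambda>t. field_strength C g X m n a (U t)) has_real_derivative
      g * lie_br C (\<lambda>b. field_strength C g X m n b (U 0)) e a) (at 0)"
  shows "((\<lambda>t. curvature_square C g X m n (U t)) has_real_derivative 0) (at 0)"
proof -
  let ?F = "\<lambda>a. field_strength C g X m n a (U 0)"
  have "((\<lambda>t. curvature_square C g X m n (U t)) has_real_derivative
      (\<Sum>a\<in>UNIV. 2 * (g * lie_br C ?F e a * ?F a))) (at 0)"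
    unfolding curvature_square_def by (rule derivative_eq_intros F refl | simp)+
  moreover have "(\<Sum>a\<in>UNIV. 2 * (g * lie_br C ?F e a * ?F a)) = 0"
    using arg_cong[OF dot_lie_br_self[OF C, of ?F e], of "\<lambda>r. 2 * g * r"]
    by (simp add: sum_distrib_left mult_ac)
  ultimately show ?thesis by simp
qed

definition mass_square :: "('d::finite \<times> 'a::finite, 'd) jet \<Rightarrow> real" where
  "mass_square u = (\<Sum>z\<in>UNIV. (u (Zeta z []) - u (Psi (idx z) []))\<^sup>2)"

lemma poly_mass_square: "poly_jet mass_square"
  unfolding mass_square_def[abs_def] by (intro poly_intros)

lemma jpd_mass_square:
  "jpd v mass_square u = 2 * (\<Sum>z\<in>UNIV. (u (Zeta z []) - u (Psi (idx z) [])) *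
    ((if v = Zeta z [] then 1 else 0) - (if v = Psi (idx z) [] then 1 else 0)))"
  unfolding mass_square_def[abs_def] sum_distrib_left
  by (simp add: jpd_sum jpd_square jpd_diff jpd_var poly_intros)
    (intro sum.cong refl, simp add: algebra_simps)

text \<open>The matter field is a second connection \<open>B\<close>, so that \<open>A - B\<close> transforms in the adjoint
  representation. The invariant \<open>|F\<^sub>m\<^sub>n(A)|\<^sup>2\<close> fills the slot \<open>Inv 0\<close>. A component in a single
  direction of the Lie algebra makes the field equations linear.\<close>

definition vector_density :: "('a::finite \<Rightarrow> 'a \<Rightarrow> 'a \<Rightarrow> real) \<Rightarrow> real \<Rightarrow> 'd \<Rightarrow> 'd \<Rightarrow>
    ('d::finite \<times> 'a, 'd) jet \<Rightarrow> real" where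
  "vector_density C g m n u = 1 / 2 * (mass_square u + u (Inv 0) - curvature_square C g vector_var m n u)"

definition vector_theory :: "('a::finite \<Rightarrow> 'a \<Rightarrow> 'a \<Rightarrow> real) \<Rightarrow> real \<Rightarrow> 'd \<Rightarrow> 'd \<Rightarrow>
    ('d::finite \<times> 'a, 'd, 'a) field_theory" where
  "vector_theory C g m n = \<lparr>
     matter = CARD('d \<times> 'a), deriv_order = 1, L_inv = vector_density C g m n, tr_order = 1,
     tr_coeff = (\<lambda>k a s x u. case unidx k of (\<mu>, c) \<Rightarrow>
       if s = [] then g * (\<Sum>b\<in>UNIV. C c b a * u (vector_var \<mu> b []))
       else if s = [\<mu>] \<and> a = c then 1 else 0),
     setting = Invariants 1 (\<lambda>_. curvature_square C g connection_var m n) \<rparr>"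

lemma vector_theory_simps [simp]:
  fixes C :: "'a::finite \<Rightarrow> 'a \<Rightarrow> 'a \<Rightarrow> real" and m :: "'d::finite"
  shows
  "matter (vector_theory C g m n) = CARD('d \<times> 'a)" "deriv_order (vector_theory C g m n) = 1"
  "L_inv (vector_theory C g m n) = vector_density C g m n" "tr_order (vector_theory C g m n) = 1"
  "setting (vector_theory C g m n) = Invariants 1 (\<lambda>_. curvature_square C g connection_var m n)"
  by (simp_all add: vector_theory_def)

lemma vector_matter_tr:
  fixes C :: "'a::finite \<Rightarrow> 'a \<Rightarrow> 'a \<Rightarrow> real" and \<epsilon> :: "('a, 'd::finite) param"
  assumes k: "unidx k = (\<mu>, c)"
  shows "matter_tr (vector_theory C g m n) A \<psi> \<epsilon> k =
    (\<lambda>x. pd \<mu> (\<epsilon> c) x + g * lie_br C (\<lambda>b. \<psi> (idx (\<mu>, b)) x) (\<lambda>a. \<epsilon> a x) c)"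
proof
  fix x
  have "matter_tr (vector_theory C g m n) A \<psi> \<epsilon> k x =
     (\<Sum>a\<in>UNIV. g * (\<Sum>b\<in>UNIV. C c b a * \<psi> (idx (\<mu>, b)) x) * \<epsilon> a x)
     + (\<Sum>\<nu>\<in>UNIV. \<Sum>a\<in>UNIV. (if \<nu> = \<mu> \<and> a = c then 1 else 0) * pd \<nu> (\<epsilon> a) x)"
    unfolding matter_tr_def vector_theory_simps sum_strings_1
    by (simp add: vector_theory_def k)
  also have "(\<Sum>\<nu>\<in>UNIV. \<Sum>a\<in>UNIV. (if \<nu> = \<mu> \<and> a = c then 1 else 0) * pd \<nu> (\<epsilon> a) x)
      = (\<Sum>\<nu>\<in>UNIV. if \<nu> = \<mu> then \<Sum>a\<in>UNIV. if a = c then pd \<nu> (\<epsilon> a) x else 0 else 0)"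
    by (intro sum.cong refl) (auto simp: if_distrib[of "\<lambda>r. r * _"] cong: if_cong)
  also have "(\<Sum>a\<in>UNIV. g * (\<Sum>b\<in>UNIV. C c b a * \<psi> (idx (\<mu>, b)) x) * \<epsilon> a x)
      = (\<Sum>a\<in>UNIV. \<Sum>b\<in>UNIV. g * (C c b a * \<psi> (idx (\<mu>, b)) x * \<epsilon> a x))"
    by (simp add: sum_distrib_left sum_distrib_right mult_ac)
  also have "\<dots> = (\<Sum>b\<in>UNIV. \<Sum>a\<in>UNIV. g * (C c b a * \<psi> (idx (\<mu>, b)) x * \<epsilon> a x))" by (rule sum.swap)
  finally show "matter_tr (vector_theory C g m n) A \<psi> \<epsilon> k x =
      pd \<mu> (\<epsilon> c) x + g * lie_br C (\<lambda>b. \<psi> (idx (\<mu>, b)) x) (\<lambda>a. \<epsilon> a x) c"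
    by (simp add: lie_br_def sum_distrib_left)
qed

lemma poly_vector_density: "poly_jet (vector_density C g m n)"
  unfolding vector_density_def[abs_def] by (intro poly_intros poly_mass_square poly_curvature_square)

lemma jpd_vector_density:
  "jpd v (vector_density C g m n) u = 1 / 2 * (jpd v mass_square u + (if v = Inv 0 then 1 else 0)
    - jpd v (curvature_square C g vector_var m n) u)"
proof -
  have "poly_jet (\<lambda>u. mass_square u + u (Inv 0))" by (intro poly_intros poly_mass_square)
  then show ?thesis
    unfolding vector_density_def[abs_def]
    by (subst jpd_cmult[OF poly_diff[OF _ poly_curvature_square]], assumption)
      (subst jpd_diff[OF _ poly_curvature_square], assumption,
       simp add: jpd_add[OF poly_mass_square poly_var] jpd_var)
qed

text \<open>The curvature squares of A and B have opposite signs, and so do the contributions of the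
  mass term to the two field equations. If A and B have equal curvature terms, both equations reduce
  to the same condition.\<close>

lemma vector_total_density:
  "total_density (vector_theory C g m n) = (\<lambda>u. 1 / 2 * (mass_square u
    + curvature_square C g connection_var m n u - curvature_square C g vector_var m n u))"
proof
  fix u
  let ?u = "insert_invariants (setting (vector_theory C g m n)) u"
  have "mass_square ?u = mass_square u" "curvature_square C g vector_var m n ?u = curvature_square C g vector_var m n u"
    "?u (Inv 0) = curvature_square C g connection_var m n u"
    by (simp_all add: mass_square_def curvature_square_def field_strength_def insert_invariants_Inv)
  then show "total_density (vector_theory C g m n) u = 1 / 2 * (mass_square u
    + curvature_square C g connection_var m n u - curvature_square C g vector_var m n u)"
    by (simp add: total_density_def inv_density_def vector_density_def)
qed

lemma jpd_vector_total:
  "jpd v (total_density (vector_theory C g m n)) u = 1 / 2 * (jpd v mass_square u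
    + jpd v (curvature_square C g connection_var m n) u - jpd v (curvature_square C g vector_var m n) u)"
proof -
  have "poly_jet (\<lambda>u. mass_square u + curvature_square C g connection_var m n u)"
    by (intro poly_intros poly_mass_square poly_curvature_square)
  then show ?thesis
    unfolding vector_total_density
    by (simp add: jpd_cmult jpd_diff jpd_add poly_mass_square poly_curvature_square poly_diff
        del: times_divide_eq_left)
qed

lemma lie_br_single_direction:
  assumes "structure_constants C"
  shows "lie_br C x (\<lambda>b. if b = c then p else 0) c = 0"
proof -
  have "C c b c = 0" for b using structure_constantsD(3)[OF assms, of c b c] by simp
  then show ?thesis by (auto simp: lie_br_def intro!: sum.neutral)
qed

text \<open>With one nonzero component the commutator terms drop out of the curvature and of the
  derivatives computed here, leaving the Maxwell expressions for a field r in the plane of m and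
  n.\<close>

lemma jpd_curvature_single_direction:
  fixes X :: "'d::finite \<Rightarrow> 'a::finite \<Rightarrow> 'd list \<Rightarrow> ('z, 'd) jvar"
  assumes C: "structure_constants C" and mn: "m \<noteq> n"
    and inj: "\<And>\<mu> a s \<mu>' a' s'. X \<mu> a s = X \<mu>' a' s' \<longleftrightarrow> \<mu> = \<mu>' \<and> a = a' \<and> s = s'"
    and u: "\<And>\<mu> a. u (X \<mu> a []) = (if \<mu> = n \<and> a = c then p else 0)"
      "\<And>\<mu> a \<nu>. u (X \<mu> a [\<nu>]) = (if \<mu> = n \<and> a = c then if \<nu> = m then r else 0 else 0)"
  shows "jpd (X \<mu> a []) (curvature_square C g X m n) u = 0"
    "jpd (X \<mu> a [\<nu>]) (curvature_square C g X m n) u = 2 * (if a = c then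
      (if \<mu> = n \<and> \<nu> = m then r else if \<mu> = m \<and> \<nu> = n then - r else 0) else 0)"
proof -
  have F: "field_strength C g X m n b u = (if b = c then r else 0)" for b
    using mn by (simp add: field_strength_def u)
  have j: "jpd v (curvature_square C g X m n) u = 2 * (r * jpd v (field_strength C g X m n c) u)" for v
  proof -
    have "(\<Sum>b\<in>UNIV. field_strength C g X m n b u * jpd v (field_strength C g X m n b) u)
      = (\<Sum>b\<in>UNIV. if b = c then r * jpd v (field_strength C g X m n b) u else 0)"
      unfolding F by (intro sum.cong) auto
    then show ?thesis unfolding jpd_curvature_square by simp
  qed
  have "(\<lambda>b. u (X n b [])) = (\<lambda>b. if b = c then p else 0)" "(\<lambda>b. u (X m b [])) = (\<lambda>b. 0)"
    using mn by (auto simp: u)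
  then have "jpd (X \<mu> a []) (field_strength C g X m n c) u = 0"
    unfolding jpd_field_strength using lie_br_single_direction[OF C] by (simp add: inj)
  then show "jpd (X \<mu> a []) (curvature_square C g X m n) u = 0" unfolding j by simp
  show "jpd (X \<mu> a [\<nu>]) (curvature_square C g X m n) u = 2 * (if a = c then
      (if \<mu> = n \<and> \<nu> = m then r else if \<mu> = m \<and> \<nu> = n then - r else 0) else 0)"
    unfolding j jpd_field_strength using mn by (auto simp: inj)
qed

lemma jpd_curvature_other:
  assumes "\<And>\<mu> a s. v \<noteq> X \<mu> a s"
  shows "jpd v (curvature_square C g X m n) u = 0"
  by (simp add: jpd_curvature_square jpd_field_strength assms)

context
  fixes V :: "(real ^ 'd::finite) set" and C :: "'a::finite \<Rightarrow> 'a \<Rightarrow> 'a \<Rightarrow> real" and g :: real and m n :: 'd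
  assumes V: "open V" and C: "structure_constants C"
begin

lemma connection_strength_derivative:
  fixes A :: "('d \<times> 'a, 'd) zfield" and \<psi> :: "real \<Rightarrow> 'd mfield"
  assumes A: "admissible (gauge_sector V C g) A" and \<epsilon>: "smooth_param V \<epsilon>" and x: "x \<in> V"
  defines "U \<equiv> (\<lambda>t. jet (\<lambda>z y. A z y + t * zeta_tr (gauge_sector V C g) A \<epsilon> z y) (\<psi> t) x)"
  shows "((\<lambda>t. field_strength C g connection_var m n a (U t)) has_real_derivative
      g * lie_br C (\<lambda>b. field_strength C g connection_var m n b (U 0)) (\<lambda>b. \<epsilon> b x) a) (at 0)"
proof -
  have As: "smooth_on V (A z)" for z using A unfolding gauge_sector_simps by blast
  have \<epsilon>s: "smooth_on V (\<epsilon> a)" for a using \<epsilon> by (simp add: smooth_param_def)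
  have ds: "smooth_on V (zeta_tr (gauge_sector V C g) A \<epsilon> (\<mu>, a))" for \<mu> a
    unfolding gauge_sector_simps by (intro smooth_on_intros smooth_on_lie_br smooth_on_const V As \<epsilon>s)
  show ?thesis
    by (rule field_strength_derivative[OF C V x, where A = "\<lambda>\<mu> a. A (\<mu>, a)", OF As \<epsilon>s])
      (use pds_linear[OF V As ds x, of "[_]"] in \<open>simp_all add: U_def\<close>)
qed

lemma vector_strength_derivative:
  fixes \<psi> :: "'d mfield" and A :: "('d \<times> 'a, 'd) zfield" and A' :: "real \<Rightarrow> ('d \<times> 'a, 'd) zfield"
  assumes \<psi>: "\<And>k. k < CARD('d \<times> 'a) \<Longrightarrow> smooth_on V (\<psi> k)" and \<epsilon>: "smooth_param V \<epsilon>" and x: "x \<in> V"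
  defines "U \<equiv> (\<lambda>t. jet (A' t) (\<lambda>k y. \<psi> k y + t * matter_tr (vector_theory C g m n) A \<psi> \<epsilon> k y) x)"
  shows "((\<lambda>t. field_strength C g vector_var m n a (U t)) has_real_derivative
      g * lie_br C (\<lambda>b. field_strength C g vector_var m n b (U 0)) (\<lambda>b. \<epsilon> b x) a) (at 0)"
proof -
  have \<psi>s: "smooth_on V (\<psi> (idx z))" for z :: "'d \<times> 'a" by (rule \<psi>[OF idx_less])
  have \<epsilon>s: "smooth_on V (\<epsilon> a)" for a using \<epsilon> by (simp add: smooth_param_def)
  have tr: "matter_tr (vector_theory C g m n) A \<psi> \<epsilon> (idx (\<mu>, a)) =
    (\<lambda>x. pd \<mu> (\<epsilon> a) x + g * lie_br C (\<lambda>b. \<psi> (idx (\<mu>, b)) x) (\<lambda>a. \<epsilon> a x) a)" for \<mu> a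
    by (rule vector_matter_tr) simp
  have ds: "smooth_on V (matter_tr (vector_theory C g m n) A \<psi> \<epsilon> (idx (\<mu>, a)))" for \<mu> :: 'd and a :: 'a
    unfolding tr by (intro smooth_on_intros smooth_on_lie_br smooth_on_const V \<psi>s \<epsilon>s)
  show ?thesis
    by (rule field_strength_derivative[OF C V x, where A = "\<lambda>\<mu> a. \<psi> (idx (\<mu>, a))", OF \<psi>s \<epsilon>s])
      (use pds_linear[OF V \<psi>s ds x, of "[_]"] in \<open>simp_all add: U_def tr\<close>)
qed

text \<open>The three summands are invariant separately. In \<open>A - B\<close> the gradients of
  the parameters cancel, so it varies by a bracket orthogonal to itself, just as the curvatures
  do.\<close>

lemma vector_variation:
  fixes A :: "('d \<times> 'a, 'd) zfield"
  assumes f: "fields V (gauge_sector V C g) (vector_theory C g m n) A \<psi>"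
    and \<epsilon>: "smooth_param V \<epsilon>" and x: "x \<in> V"
  shows "variation (inv_density (vector_theory C g m n)) A \<psi> (zeta_tr (gauge_sector V C g) A \<epsilon>)
    (matter_tr (vector_theory C g m n) A \<psi> \<epsilon>) x = 0"
proof -
  let ?T = "vector_theory C g m n"
  define U where "U = (\<lambda>t. jet (\<lambda>z y. A z y + t * zeta_tr (gauge_sector V C g) A \<epsilon> z y)
      (\<lambda>k y. \<psi> k y + t * matter_tr ?T A \<psi> \<epsilon> k y) x)"
  have A: "admissible (gauge_sector V C g) A" using f by (simp add: fields_def)
  have \<psi>: "smooth_on V (\<psi> k)" if "k < CARD('d \<times> 'a)" for k using f that by (simp add: fields_def)
  have 1: "((\<lambda>t. curvature_square C g connection_var m n (U t)) has_real_derivative 0) (at 0)"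
    unfolding U_def by (rule curvature_square_derivative[OF C connection_strength_derivative[OF A \<epsilon> x]])
  have 2: "((\<lambda>t. curvature_square C g vector_var m n (U t)) has_real_derivative 0) (at 0)"
    unfolding U_def by (rule curvature_square_derivative[OF C vector_strength_derivative[OF \<psi> \<epsilon> x]])
  have 3: "((\<lambda>t. mass_square (U t)) has_real_derivative 0) (at 0)"
  proof -
    define M where "M \<mu> a = A (\<mu>, a) x - \<psi> (idx (\<mu>, a)) x" for \<mu> a
    have d: "((\<lambda>t. U t (Zeta (\<mu>, a) []) - U t (Psi (idx (\<mu>, a)) [])) has_real_derivative
        g * lie_br C (M \<mu>) (\<lambda>b. \<epsilon> b x) a) (at 0)" for \<mu> a
    proof -
      have M: "M \<mu> = (\<lambda>b. A (\<mu>, b) x + - 1 * \<psi> (idx (\<mu>, b)) x)" by (simp add: M_def fun_eq_iff)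
      have "zeta_tr (gauge_sector V C g) A \<epsilon> (\<mu>, a) x - matter_tr ?T A \<psi> \<epsilon> (idx (\<mu>, a)) x
          = g * lie_br C (M \<mu>) (\<lambda>b. \<epsilon> b x) a"
        unfolding M lie_br_add lie_br_scale
        by (simp add: vector_matter_tr[of "idx (\<mu>, a)" \<mu> a] algebra_simps)
      moreover have "((\<lambda>t. A (\<mu>, a) x + t * zeta_tr (gauge_sector V C g) A \<epsilon> (\<mu>, a) x
          - (\<psi> (idx (\<mu>, a)) x + t * matter_tr ?T A \<psi> \<epsilon> (idx (\<mu>, a)) x)) has_real_derivative
         zeta_tr (gauge_sector V C g) A \<epsilon> (\<mu>, a) x - matter_tr ?T A \<psi> \<epsilon> (idx (\<mu>, a)) x) (at 0)"
        by (rule derivative_eq_intros refl | simp)+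
      ultimately show ?thesis by (simp add: U_def)
    qed
    have "((\<lambda>t. mass_square (U t)) has_real_derivative
      (\<Sum>\<mu>\<in>UNIV. \<Sum>a\<in>UNIV. 2 * (g * lie_br C (M \<mu>) (\<lambda>b. \<epsilon> b x) a * M \<mu> a))) (at 0)"
      unfolding mass_square_def sum_UNIV_prod
      by (rule derivative_eq_intros d refl | simp add: M_def U_def)+
    moreover have "(\<Sum>a\<in>UNIV. 2 * (g * lie_br C (M \<mu>) (\<lambda>b. \<epsilon> b x) a * M \<mu> a)) = 0" for \<mu>
      using arg_cong[OF dot_lie_br_self[OF C, of "M \<mu>" "\<lambda>b. \<epsilon> b x"], of "\<lambda>r. 2 * g * r"]
      by (simp add: sum_distrib_left mult_ac)
    ultimately show ?thesis by simp
  qed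
  have inv: "inv_density ?T = (\<lambda>u. 1 / 2 * (mass_square u
    + curvature_square C g connection_var m n u - curvature_square C g vector_var m n u))"
    unfolding vector_total_density[symmetric] by (simp add: total_density_def fun_eq_iff)
  have "((\<lambda>t. inv_density ?T (U t)) has_real_derivative 1 / 2 * (0 + 0 - 0)) (at 0)"
    unfolding inv by (intro DERIV_cmult DERIV_diff DERIV_add 1 2 3)
  then show ?thesis unfolding variation_def U_def by (simp add: DERIV_imp_deriv)
qed

lemma curvature_local_invariant:
  "local_invariant V (gauge_sector V C g) (curvature_square C g connection_var m n)"
  unfolding local_invariant_def
proof (intro allI impI ballI)
  fix A :: "('d \<times> 'a, 'd) zfield" and \<epsilon> :: "('a, 'd) param" and x
  assume "admissible (gauge_sector V C g) A" "smooth_param V \<epsilon>" "x \<in> V"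
  from curvature_square_derivative[OF C connection_strength_derivative[OF this]]
  show "variation (curvature_square C g connection_var m n) A (\<lambda>_ _. 0) (zeta_tr (gauge_sector V C g) A \<epsilon>) (\<lambda>_ _. 0) x = 0"
    unfolding variation_def by (rule DERIV_imp_deriv)
qed

lemma vector_represents_algebra:
  "represents_algebra V (gauge_sector V C g) (vector_theory C g m n)"
  unfolding represents_algebra_def
proof (intro allI impI ballI)
  fix A :: "('d \<times> 'a, 'd) zfield" and \<psi> :: "'d mfield" and \<epsilon> \<eta> :: "('a, 'd) param" and k x
  assume x: "x \<in> V" and \<epsilon>: "smooth_param V \<epsilon>" and \<eta>: "smooth_param V \<eta>"
  let ?T = "vector_theory C g m n"
  obtain \<mu> :: 'd and c :: 'a where k: "unidx k = (\<mu>, c)" by (cases "unidx k :: 'd \<times> 'a")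
  let ?B = "\<lambda>b. \<psi> (idx (\<mu>, b)) x"
  let ?E = "\<lambda>\<epsilon> b. \<epsilon> b x" and ?P = "\<lambda>\<epsilon> b. pd \<mu> (\<epsilon> b) x"
  have tr: "matter_tr ?T A \<psi> \<epsilon> (idx (\<mu>, b)) x = ?P \<epsilon> b + g * lie_br C ?B (?E \<epsilon>) b" for \<epsilon> b
    by (simp add: vector_matter_tr[of "idx (\<mu>, b)" \<mu> b])
  have d: "deriv (\<lambda>t. matter_tr ?T (A' t) (\<lambda>l y. \<psi> l y + t * matter_tr ?T A \<psi> \<epsilon> l y) \<eta> k x) 0
      = g * lie_br C (?P \<epsilon>) (?E \<eta>) c + g * (g * lie_br C (lie_br C ?B (?E \<epsilon>)) (?E \<eta>) c)" for A' \<epsilon> \<eta>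
  proof (rule DERIV_imp_deriv)
    have "((\<lambda>t. ?P \<eta> c + g * lie_br C (\<lambda>b. ?B b + t * matter_tr ?T A \<psi> \<epsilon> (idx (\<mu>, b)) x) (\<lambda>b. \<eta> b x + t * 0) c)
       has_real_derivative g * (lie_br C (\<lambda>b. matter_tr ?T A \<psi> \<epsilon> (idx (\<mu>, b)) x) (?E \<eta>) c + lie_br C ?B (\<lambda>b. 0) c)) (at 0)"
      by (rule derivative_eq_intros lie_br_derivative refl | simp)+
    moreover have "g * (lie_br C (\<lambda>b. matter_tr ?T A \<psi> \<epsilon> (idx (\<mu>, b)) x) (?E \<eta>) c + lie_br C ?B (\<lambda>b. 0) c)
        = g * lie_br C (?P \<epsilon>) (?E \<eta>) c + g * (g * lie_br C (lie_br C ?B (?E \<epsilon>)) (?E \<eta>) c)"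
      unfolding tr by (simp add: lie_br_add lie_br_scale distrib_left)
    moreover have "(\<lambda>t. matter_tr ?T (A' t) (\<lambda>l y. \<psi> l y + t * matter_tr ?T A \<psi> \<epsilon> l y) \<eta> k x) =
       (\<lambda>t. ?P \<eta> c + g * lie_br C (\<lambda>b. ?B b + t * matter_tr ?T A \<psi> \<epsilon> (idx (\<mu>, b)) x) (\<lambda>b. \<eta> b x + t * 0) c)"
      by (simp add: vector_matter_tr[OF k])
    ultimately show "((\<lambda>t. matter_tr ?T (A' t) (\<lambda>l y. \<psi> l y + t * matter_tr ?T A \<psi> \<epsilon> l y) \<eta> k x) has_real_derivative
        g * lie_br C (?P \<epsilon>) (?E \<eta>) c + g * (g * lie_br C (lie_br C ?B (?E \<epsilon>)) (?E \<eta>) c)) (at 0)"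
      by (simp only:)
  qed
  have s: "\<epsilon> b differentiable at x" "\<eta> b differentiable at x" for b
    using \<epsilon> \<eta> smooth_on_differentiable[OF _ V x] by (auto simp: smooth_param_def)
  have "(\<lambda>y. lie_br C (\<lambda>b. \<epsilon> b y) (\<lambda>b. \<eta> b y) c) differentiable at x"
    by (rule smooth_on_differentiable[OF smooth_on_lie_br V x])
      (use V \<epsilon> \<eta> in \<open>auto simp: smooth_param_def\<close>)
  then have br: "pd \<mu> (bracket (gauge_sector V C g) \<epsilon> \<eta> c) x
      = g * (lie_br C (?P \<epsilon>) (?E \<eta>) c + lie_br C (?E \<epsilon>) (?P \<eta>) c)"
    by (simp add: pd_cmult pd_lie_br s)
  have "lie_br C (lie_br C ?B (?E \<eta>)) (?E \<epsilon>) c + lie_br C ?B (lie_br C (?E \<epsilon>) (?E \<eta>)) c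
      = lie_br C (lie_br C ?B (?E \<epsilon>)) (?E \<eta>) c"
    by (rule lie_br_leibniz[OF C])
  then have "g * (g * lie_br C (lie_br C ?B (?E \<eta>)) (?E \<epsilon>) c) + g * (g * lie_br C ?B (lie_br C (?E \<epsilon>) (?E \<eta>)) c)
      = g * (g * lie_br C (lie_br C ?B (?E \<epsilon>)) (?E \<eta>) c)" by (simp flip: distrib_left)
  \<comment> \<open>Turns the gradient term of the exchanged order into the second half of the
    derivative of the bracket of the parameters.\<close>
  moreover have "lie_br C (?P \<eta>) (?E \<epsilon>) c = - lie_br C (?E \<epsilon>) (?P \<eta>) c" by (rule lie_br_antisym[OF C])
  ultimately show "deriv (\<lambda>t. matter_tr ?T (\<lambda>z y. A z y + t * zeta_tr (gauge_sector V C g) A \<epsilon> z y)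
        (\<lambda>l y. \<psi> l y + t * matter_tr ?T A \<psi> \<epsilon> l y) \<eta> k x) 0
     - deriv (\<lambda>t. matter_tr ?T (\<lambda>z y. A z y + t * zeta_tr (gauge_sector V C g) A \<eta> z y)
        (\<lambda>l y. \<psi> l y + t * matter_tr ?T A \<psi> \<eta> l y) \<epsilon> k x) 0
     = matter_tr ?T A \<psi> (bracket (gauge_sector V C g) \<epsilon> \<eta>) k x"
    unfolding d unfolding vector_matter_tr[OF k] br
    by (simp add: lie_br_scale algebra_simps)
qed

lemma vector_invariant_theory:
  "invariant_theory V (gauge_sector V C g) (vector_theory C g m n)"
proof -
  let ?T = "vector_theory C g m n"
  have D1: "depends_only_on (jvars CARD('d \<times> 'a) 1 1) (vector_density C g m n :: ('d \<times> 'a, 'd) jet \<Rightarrow> real)"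
    unfolding depends_only_on_def
  proof (intro allI impI)
    fix u v :: "('d \<times> 'a, 'd) jet" assume a: "\<forall>i\<in>jvars CARD('d \<times> 'a) 1 1. u i = v i"
    have "u (vector_var \<mu> a [\<nu>]) = v (vector_var \<mu> a [\<nu>])" "u (vector_var \<mu> a []) = v (vector_var \<mu> a [])"
      "u (Zeta (\<mu>, a) []) = v (Zeta (\<mu>, a) [])" "u (Inv 0) = v (Inv 0)" for \<mu> \<nu> and a :: 'a
      using a idx_less_prod[of "(\<mu>, a)"] by (auto simp: jvars_def)
    then show "vector_density C g m n u = vector_density C g m n v"
      by (simp add: vector_density_def mass_square_def curvature_square_def field_strength_def sum_UNIV_prod)
  qed
  then have 1: "local_function (jet_domain (gauge_sector V C g)) (matter ?T)
    (n_invariants (setting ?T)) (deriv_order ?T) (L_inv ?T)"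
    by (simp add: local_function_def poly_smooth poly_vector_density n_invariants_def)
  have tc: "tr_coeff ?T k a s x = (\<lambda>u. case unidx k of (\<mu>, c) \<Rightarrow>
       if s = [] then g * (\<Sum>b\<in>UNIV. C c b a * u (vector_var \<mu> b []))
       else if s = [\<mu>] \<and> a = c then 1 else 0)" for k a s x
    by (simp add: vector_theory_def)
  have 2: "depends_only_on (jvars (matter ?T) 0 0) (tr_coeff ?T k a s x)" for k a s x
    unfolding tc depends_only_on_def vector_theory_simps
    using idx_less_prod[where 'd = 'd and 'a = 'a]
    by (auto simp: jvars_def split: prod.split intro!: sum.cong)
  have 3: "smooth_on V (\<lambda>x. tr_coeff ?T k a s x (jet A \<psi> x))"
    if f: "fields V (gauge_sector V C g) ?T A \<psi>" for A \<psi> k a s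
  proof -
    obtain \<mu> :: 'd and c :: 'a where k: "unidx k = (\<mu>, c)" by (cases "unidx k :: 'd \<times> 'a")
    have \<psi>s: "smooth_on V (\<psi> (idx z))" for z :: "'d \<times> 'a"
      using f idx_less[of z] unfolding fields_def vector_theory_simps by blast
    have "smooth_on V (\<lambda>x. g * (\<Sum>b\<in>UNIV. C c b a * \<psi> (idx (\<mu>, b)) x))"
      by (intro smooth_on_intros smooth_on_const V \<psi>s)
    then show ?thesis by (cases "s = []") (simp_all add: tc k)
  qed
  have 4: "invariant_action V (gauge_sector V C g) ?T"
    using vector_variation by (intro invariant_actionI)
  have "depends_only_on (jvars 0 0 1) (curvature_square C g connection_var m n)"
    unfolding depends_only_on_def
    by (auto simp: curvature_square_def field_strength_def jvars_def intro!: sum.cong)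
  then have 5: "proper_setting V (gauge_sector V C g) ?T"
    by (simp add: proper_setting_def local_function_def poly_smooth poly_curvature_square
        curvature_local_invariant)
  show ?thesis unfolding invariant_theory_def
    by (intro conjI allI impI exI[of _ 0] 1 2 3 4 5) simp_all
qed


text \<open>The current is the derivative of the mass term, hence P - Q. For a constant difference
  both connections have the same field strength, and both equations say that its divergence equals P
  - Q.\<close>

lemma
  fixes c :: 'a and k :: 'd and P Q :: "'d scalar"
  assumes P: "smooth_on UNIV P" and Q: "smooth_on UNIV Q"
  defines "A \<equiv> (\<lambda>z. if z = (k, c) then P else (\<lambda>_. 0))"
    and "B \<equiv> (\<lambda>l. if unidx l = (k, c) then Q else (\<lambda>_. 0))"
  shows vector_configuration: "configuration V (gauge_sector V C g) (vector_theory C g m n) A B"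
    and vector_current: "current (gauge_sector V C g) (vector_theory C g m n) A B \<mu> a =
      (\<lambda>x. if \<mu> = k \<and> a = c then P x - Q x else 0)"
    and vector_on_shell: "m \<noteq> n \<Longrightarrow> k = n \<Longrightarrow> (\<And>x. P x - Q x = 1) \<Longrightarrow>
      (\<And>\<nu>. pd \<nu> P = (\<lambda>x. if \<nu> = m then x $ m else 0)) \<Longrightarrow>
      (\<And>\<nu>. pd \<nu> Q = (\<lambda>x. if \<nu> = m then x $ m else 0)) \<Longrightarrow>
      on_shell V (gauge_sector V C g) (vector_theory C g m n) A B"
proof -
  let ?T = "vector_theory C g m n" and ?K = "gauge_sector V C g"
  have sP: "smooth_on V P" and sQ: "smooth_on V Q"
    using smooth_on_subset[OF P subset_UNIV] smooth_on_subset[OF Q subset_UNIV] by auto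
  show "configuration V ?K ?T A B"
    by (auto simp: configuration_def fields_def A_def B_def sP sQ)
  have jm: "jpd v mass_square (jet A B x) = (if v = Zeta (k, c) [] then 2 * (P x - Q x) else 0) +
      (if v = Psi (idx (k, c)) [] then - 2 * (P x - Q x) else 0)" for v x
  proof -
    have "jpd v mass_square (jet A B x) = 2 * (\<Sum>z\<in>UNIV. if z = (k, c) then (P x - Q x) *
      ((if v = Zeta z [] then 1 else 0) - (if v = Psi (idx z) [] then 1 else 0)) else 0)"
      unfolding jpd_mass_square
      by (intro arg_cong2[where f = "(*)"] sum.cong refl) (simp add: A_def B_def)
    then show ?thesis by auto
  qed
  have jm': "jpd v mass_square (insert_invariants st u) = jpd v mass_square u" for v u
    and st :: "('d \<times> 'a, 'd) setting"
    by (simp add: jpd_mass_square)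
  have jc: "jpd (Zeta z s) (curvature_square C g vector_var m n) u = 0" for z s u
    by (rule jpd_curvature_other) simp
  have jc': "jpd (Psi l s) (curvature_square C g connection_var m n) u = 0" for l s u
    by (rule jpd_curvature_other) simp
  have "source ?K ?T A B (\<mu>, a) x = (if \<mu> = k \<and> a = c then P x - Q x else 0)" for \<mu> a x
    unfolding source_def gauge_sector_simps
    by (simp add: euler_1 jpd_vector_density jc jm' jm)
  then show "current ?K ?T A B \<mu> a = (\<lambda>x. if \<mu> = k \<and> a = c then P x - Q x else 0)"
    by (simp add: current_def fun_eq_iff)
  assume mn: "m \<noteq> n" and k: "k = n" and PQ: "\<And>x. P x - Q x = 1"
    and dP: "\<And>\<nu>. pd \<nu> P = (\<lambda>x. if \<nu> = m then x $ m else 0)"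
    and dQ: "\<And>\<nu>. pd \<nu> Q = (\<lambda>x. if \<nu> = m then x $ m else 0)"
  \<comment> \<open>The common field strength, indexed as the momentum conjugate to the
    \<nu>-derivative of the component \<open>(\<mu>, a)\<close>.\<close>
  define F where "F \<mu> a \<nu> x = (if a = c then
      (if \<mu> = n \<and> \<nu> = m then x $ m else if \<mu> = m \<and> \<nu> = n then - (x $ m) else 0) else 0)"
    for \<mu> \<nu> :: 'd and a :: 'a and x :: "real ^ 'd"
  have cA: "jpd (connection_var \<mu> a []) (curvature_square C g connection_var m n) (jet A B x) = 0"
    "jpd (connection_var \<mu> a [\<nu>]) (curvature_square C g connection_var m n) (jet A B x) = 2 * F \<mu> a \<nu> x" for \<mu> a \<nu> x
  proof -
    have inj: "connection_var \<mu> a s = connection_var \<mu>' a' s' \<longleftrightarrow> \<mu> = \<mu>' \<and> a = a' \<and> s = s'" for \<mu> \<mu>' :: 'd and a a' :: 'a and s s'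
      by auto
    have u: "jet A B x (connection_var \<mu> a []) = (if \<mu> = n \<and> a = c then P x else 0)"
      "jet A B x (connection_var \<mu> a [\<nu>]) = (if \<mu> = n \<and> a = c then if \<nu> = m then x $ m else 0 else 0)" for \<mu> a \<nu>
      by (simp_all add: A_def k dP)
    note * = jpd_curvature_single_direction[where X = connection_var and u = "jet A B x" and c = c, OF C mn inj u]
    show "jpd (connection_var \<mu> a []) (curvature_square C g connection_var m n) (jet A B x) = 0" by (rule *(1))
    show "jpd (connection_var \<mu> a [\<nu>]) (curvature_square C g connection_var m n) (jet A B x) = 2 * F \<mu> a \<nu> x" unfolding F_def by (rule *(2))
  qed
  have cB: "jpd (vector_var \<mu> a []) (curvature_square C g vector_var m n) (jet A B x) = 0"
    "jpd (vector_var \<mu> a [\<nu>]) (curvature_square C g vector_var m n) (jet A B x) = 2 * F \<mu> a \<nu> x" for \<mu> a \<nu> x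
  proof -
    have inj: "vector_var \<mu> a s = vector_var \<mu>' a' s' \<longleftrightarrow> \<mu> = \<mu>' \<and> a = a' \<and> s = s'" for \<mu> \<mu>' :: 'd and a a' :: 'a and s s'
      by auto
    have u: "jet A B x (vector_var \<mu> a []) = (if \<mu> = n \<and> a = c then Q x else 0)"
      "jet A B x (vector_var \<mu> a [\<nu>]) = (if \<mu> = n \<and> a = c then if \<nu> = m then x $ m else 0 else 0)" for \<mu> a \<nu>
      by (simp_all add: B_def k dQ)
    note * = jpd_curvature_single_direction[where X = vector_var and u = "jet A B x" and c = c, OF C mn inj u]
    show "jpd (vector_var \<mu> a []) (curvature_square C g vector_var m n) (jet A B x) = 0" by (rule *(1))
    show "jpd (vector_var \<mu> a [\<nu>]) (curvature_square C g vector_var m n) (jet A B x) = 2 * F \<mu> a \<nu> x" unfolding F_def by (rule *(2))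
  qed
  \<comment> \<open>Summed over \<nu>, the divergence of the field strength is 1 exactly in the
    component \<open>(n, c)\<close>, where it balances the mass term P - Q = 1.\<close>
  have pdx: "pd \<nu> (F \<mu> a \<nu>) x = (if \<nu> = m then if \<mu> = n \<and> a = c then 1 else 0 else 0)"
    "pd \<nu> (\<lambda>x. - F \<mu> a \<nu> x) x = - (if \<nu> = m then if \<mu> = n \<and> a = c then 1 else 0 else 0)" for \<nu> \<mu> a x
  proof -
    have d: "(\<lambda>x :: real ^ 'd. x $ m) differentiable at x" by (rule smooth_on_differentiable_UNIV) simp
    let ?one = "if \<nu> = m then if \<mu> = n \<and> a = c then 1 else 0 else 0 :: real"
    consider "a = c" "\<mu> = n" "\<nu> = m" | "a = c" "\<mu> = m" "\<nu> = n"
      | "\<not> (a = c \<and> \<mu> = n \<and> \<nu> = m)" "\<not> (a = c \<and> \<mu> = m \<and> \<nu> = n)" by blast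
    then have "pd \<nu> (F \<mu> a \<nu>) x = ?one \<and> F \<mu> a \<nu> differentiable at x"
    proof cases
      case 1
      then have "F \<mu> a \<nu> = (\<lambda>x. x $ m)" by (intro ext) (simp add: F_def)
      then show ?thesis using 1 d by (simp add: pd_component)
    next
      case 2
      then have "F \<mu> a \<nu> = (\<lambda>x. - (x $ m))" using mn by (intro ext) (simp add: F_def)
      then show ?thesis using 2 mn d by (simp add: pd_component pd_minus[OF d])
    next
      case 3
      have "F \<mu> a \<nu> x = 0" for x
        unfolding F_def using 3 by metis
      then have "F \<mu> a \<nu> = (\<lambda>x. 0)" by blast
      moreover have "?one = 0" using 3(1) by metis
      ultimately show ?thesis by simp
    qed
    then show "pd \<nu> (F \<mu> a \<nu>) x = ?one" "pd \<nu> (\<lambda>x. - F \<mu> a \<nu> x) x = - ?one"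
      by (simp_all only: pd_minus)
  qed
  show "on_shell V ?K ?T A B"
    unfolding on_shell_def
  proof (intro conjI impI allI ballI)
    fix l x assume l: "l < matter ?T"
    obtain \<mu> :: 'd and a :: 'a where u: "unidx l = (\<mu>, a)" by (cases "unidx l :: 'd \<times> 'a")
    have l: "l = idx (\<mu>, a)" using idx_unidx[where 'i = "'d \<times> 'a", of l] l unfolding u by simp
    show "euler (deriv_order ?T) (total_density ?T) (Psi l) (jet A B) x = 0"
      unfolding l by (simp add: euler_1 jpd_vector_total jc' jm cB PQ k pdx sum_negf)
  next
    fix z :: "'d \<times> 'a" and x
    obtain \<mu> a where z: "z = (\<mu>, a)" by (cases z)
    show "zeta_euler ?K (deriv_order ?T) (total_density ?T) (jet A B) z x = 0"
      unfolding z gauge_sector_simps by (simp add: euler_1 jpd_vector_total jc jm cA PQ k pdx)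
  qed
qed

end

text \<open>On-shell the current must be balanced by the divergence of an antisymmetric field
  strength, which takes two different directions m and n; hence the restriction on the dimension in
  the last claim.\<close>

lemma gauge_Invariants:
  fixes V :: "(real ^ 'd::finite) set" and C :: "'a::finite \<Rightarrow> 'a \<Rightarrow> 'a \<Rightarrow> real"
  assumes V: "open V" "V \<noteq> {}" and C: "structure_constants C"
  shows "\<exists>T. is_Invariants (setting T) \<and>
      invariant_theory V (gauge_sector V C g) T \<and> represents_algebra V (gauge_sector V C g) T \<and>
      \<not> divergence_identically_zero V (gauge_sector V C g) T \<and>
      (2 \<le> CARD('d) \<longrightarrow> \<not> current_zero_on_shell V (gauge_sector V C g) T)"
proof -
  obtain m n :: 'd where mn: "2 \<le> CARD('d) \<longrightarrow> m \<noteq> n"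
  proof (cases "2 \<le> CARD('d)")
    case True
    then have "\<not> (\<forall>i\<in>(UNIV :: 'd set). \<forall>j\<in>UNIV. i = j)" using card_le_Suc0_iff_eq[of "UNIV :: 'd set"] by auto
    then show ?thesis using that by blast
  qed auto
  fix c :: 'a
  let ?T = "vector_theory C g m n" and ?K = "gauge_sector V C g"
  obtain x where x: "x \<in> V" using V by blast
  have "\<not> divergence_identically_zero V ?K ?T"
  proof
    assume z: "divergence_identically_zero V ?K ?T"
    \<comment> \<open>The zero connection, written as a case distinction to match the general
      configuration above. With B growing like \<open>x $ m\<close>, the current has divergence
      -1.\<close>
    define A :: "('d \<times> 'a, 'd) zfield" where "A = (\<lambda>z. if z = (m, c) then (\<lambda>_. 0) else (\<lambda>_. 0))"
    define B :: "'d mfield" where "B = (\<lambda>l. if unidx l = (m, c) then (\<lambda>x. x $ m) else (\<lambda>_. 0))"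
    have A0: "A = (\<lambda>_ _. 0)" by (auto simp: A_def fun_eq_iff)
    have conf: "configuration V ?K ?T A B"
      unfolding A_def B_def by (rule vector_configuration[OF V(1) C]) auto
    have cur: "current ?K ?T A B \<mu> a = (\<lambda>x. if \<mu> = m \<and> a = c then 0 - x $ m else 0)" for \<mu> a
      unfolding A_def B_def by (rule vector_current[OF V(1) C]) auto
    have d: "(\<lambda>x :: real ^ 'd. x $ m) differentiable at x" by (rule smooth_on_differentiable_UNIV) simp
    have "covdiv ?K A (current ?K ?T A B) c x = (\<Sum>\<mu>\<in>UNIV. if \<mu> = m then - 1 else 0)"
      unfolding gauge_sector_simps A0[THEN fun_cong, THEN fun_cong] cur
      by (intro sum.cong refl) (auto simp: pd_minus[OF d] pd_component)
    then show False using z conf x by (auto simp: divergence_identically_zero_def simp del: gauge_sector_simps)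
  qed
  moreover have "\<not> current_zero_on_shell V ?K ?T" if D: "2 \<le> CARD('d)"
  proof
    assume z: "current_zero_on_shell V ?K ?T"
    \<comment> \<open>\<open>P\<close> has second derivative 1 along m, as the field equation
      demands, and the zero linear term brings it into the form of \<open>pd_quadratic\<close>.
      \<open>Q\<close> is lower by 1, which is the value of the current.\<close>
    define P Q :: "'d scalar" where "P = (\<lambda>x. 0 * x $ m + 1 / 2 * (x $ m)\<^sup>2)" and "Q = (\<lambda>x. P x + - 1)"
    have s: "smooth_on UNIV P" "smooth_on UNIV Q"
      unfolding P_def Q_def by (intro smooth_on_intros smooth_on_const smooth_on_component open_UNIV)+
    have dP: "pd \<nu> P = (\<lambda>x. if \<nu> = m then x $ m else 0)" for \<nu>
      unfolding P_def pd_quadratic by (simp add: fun_eq_iff)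
    have dQ: "pd \<nu> Q = (\<lambda>x. if \<nu> = m then x $ m else 0)" for \<nu>
      unfolding dP[symmetric] Q_def
      using smooth_on_differentiable_UNIV[OF s(1)] by (simp add: fun_eq_iff pd_add del: add_uminus_conv_diff)
    have PQ: "P x - Q x = 1" for x by (simp add: Q_def)
    define A :: "('d \<times> 'a, 'd) zfield" where "A = (\<lambda>z. if z = (n, c) then P else (\<lambda>_. 0))"
    define B :: "'d mfield" where "B = (\<lambda>l. if unidx l = (n, c) then Q else (\<lambda>_. 0))"
    have "configuration V ?K ?T A B"
      unfolding A_def B_def by (rule vector_configuration[OF V(1) C s])
    moreover have "on_shell V ?K ?T A B"
      unfolding A_def B_def by (rule vector_on_shell[OF V(1) C s _ refl PQ dP dQ]) (use mn D in auto)
    moreover have "current ?K ?T A B n c x = 1"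
      unfolding A_def B_def vector_current[OF V(1) C s] using PQ by simp
    ultimately show False using z x unfolding current_zero_on_shell_def by (metis zero_neq_one)
  qed
  ultimately show ?thesis
    using vector_invariant_theory[OF V(1) C] vector_represents_algebra[OF V(1) C]
    by (intro exI[of _ ?T]) auto
qed

section \<open>A fluid coupled to a metric\<close>

definition quad :: "('d::finite \<Rightarrow> 'd \<Rightarrow> real) \<Rightarrow> ('d \<Rightarrow> real) \<Rightarrow> ('d \<Rightarrow> real) \<Rightarrow> real" where
  "quad h y z = (\<Sum>\<mu>\<in>UNIV. \<Sum>\<nu>\<in>UNIV. h \<mu> \<nu> * y \<mu> * z \<nu>)"

lemma quad_derivative:
  "((\<lambda>t. quad (\<lambda>\<mu> \<nu>. h \<mu> \<nu> + t * h' \<mu> \<nu>) (\<lambda>\<mu>. y \<mu> + t * y' \<mu>) (\<lambda>\<mu>. z \<mu> + t * z' \<mu>)) has_real_derivative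
    quad h' y z + quad h y' z + quad h y z') (at 0)"
  unfolding quad_def
  by (auto intro!: derivative_eq_intros simp: sum.distrib algebra_simps)

lemma pd_quad:
  fixes h :: "'d::finite \<Rightarrow> 'd \<Rightarrow> 'd scalar"
  assumes "\<And>\<mu> \<nu>. h \<mu> \<nu> differentiable at x" "\<And>\<mu>. y \<mu> differentiable at x" "\<And>\<mu>. z \<mu> differentiable at x"
  shows "pd a (\<lambda>x. quad (\<lambda>\<mu> \<nu>. h \<mu> \<nu> x) (\<lambda>\<mu>. y \<mu> x) (\<lambda>\<mu>. z \<mu> x)) x =
    quad (\<lambda>\<mu> \<nu>. pd a (h \<mu> \<nu>) x) (\<lambda>\<mu>. y \<mu> x) (\<lambda>\<mu>. z \<mu> x)
    + quad (\<lambda>\<mu> \<nu>. h \<mu> \<nu> x) (\<lambda>\<mu>. pd a (y \<mu>) x) (\<lambda>\<mu>. z \<mu> x)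
    + quad (\<lambda>\<mu> \<nu>. h \<mu> \<nu> x) (\<lambda>\<mu>. y \<mu> x) (\<lambda>\<mu>. pd a (z \<mu>) x)"
  unfolding quad_def
  by (simp add: pd_sum pd_mult assms sum.distrib algebra_simps)

lemma quad_add:
  "quad (\<lambda>\<mu> \<nu>. h \<mu> \<nu> + k \<mu> \<nu>) y z = quad h y z + quad k y z"
  "quad h (\<lambda>\<mu>. y \<mu> + w \<mu>) z = quad h y z + quad h w z"
  "quad h y (\<lambda>\<mu>. z \<mu> + w \<mu>) = quad h y z + quad h y w"
  by (simp_all add: quad_def sum.distrib algebra_simps)

lemma quad_minus:
  "quad (\<lambda>\<mu> \<nu>. - h \<mu> \<nu>) y z = - quad h y z"
  "quad h (\<lambda>\<mu>. - y \<mu>) z = - quad h y z"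
  "quad h y (\<lambda>\<mu>. - z \<mu>) = - quad h y z"
  by (simp_all add: quad_def sum_negf)

lemma quad_sum:
  fixes h :: "'i::finite \<Rightarrow> 'd::finite \<Rightarrow> 'd \<Rightarrow> real" and k :: "'d \<Rightarrow> 'd \<Rightarrow> real"
  shows "quad (\<lambda>\<mu> \<nu>. \<Sum>a\<in>UNIV. e a * h a \<mu> \<nu>) y z = (\<Sum>a\<in>UNIV. e a * quad (h a) y z)"
  "quad k (\<lambda>\<mu>. \<Sum>a\<in>UNIV. e a * w a \<mu>) z = (\<Sum>a\<in>UNIV. e a * quad k (w a) z)"
  "quad k y (\<lambda>\<mu>. \<Sum>a\<in>UNIV. e a * w a \<mu>) = (\<Sum>a\<in>UNIV. e a * quad k y (w a))"
proof -
  have sw: "(\<Sum>\<mu>\<in>(UNIV :: 'd set). \<Sum>\<nu>\<in>(UNIV :: 'd set). \<Sum>a\<in>(UNIV :: 'i set). F \<mu> \<nu> a)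
      = (\<Sum>a\<in>UNIV. \<Sum>\<mu>\<in>UNIV. \<Sum>\<nu>\<in>UNIV. F \<mu> \<nu> a)" for F :: "'d \<Rightarrow> 'd \<Rightarrow> 'i \<Rightarrow> real"
  proof -
    have "(\<Sum>\<mu>\<in>(UNIV :: 'd set). \<Sum>\<nu>\<in>(UNIV :: 'd set). \<Sum>a\<in>(UNIV :: 'i set). F \<mu> \<nu> a)
      = (\<Sum>\<mu>\<in>UNIV. \<Sum>a\<in>UNIV. \<Sum>\<nu>\<in>UNIV. F \<mu> \<nu> a)" by (intro sum.cong refl sum.swap)
    also have "\<dots> = (\<Sum>a\<in>UNIV. \<Sum>\<mu>\<in>UNIV. \<Sum>\<nu>\<in>UNIV. F \<mu> \<nu> a)" by (rule sum.swap)
    finally show ?thesis .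
  qed
  show "quad (\<lambda>\<mu> \<nu>. \<Sum>a\<in>UNIV. e a * h a \<mu> \<nu>) y z = (\<Sum>a\<in>UNIV. e a * quad (h a) y z)"
    "quad k (\<lambda>\<mu>. \<Sum>a\<in>UNIV. e a * w a \<mu>) z = (\<Sum>a\<in>UNIV. e a * quad k (w a) z)"
    "quad k y (\<lambda>\<mu>. \<Sum>a\<in>UNIV. e a * w a \<mu>) = (\<Sum>a\<in>UNIV. e a * quad k y (w a))"
    unfolding quad_def sum_distrib_left sum_distrib_right sw[symmetric] by (simp_all add: mult_ac)
qed

text \<open>The matter fields are a scalar (\<open>None\<close>), a scalar density of weight 1 (\<open>Some None\<close>) and a vector
  (\<open>Some (Some i)\<close>). With \<open>M a b = \<partial>\<^sub>a \<epsilon>\<^sup>b\<close>, the term \<open>gl_action M y\<close> is the part of the transformation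
  that does not differentiate the field.\<close>

type_synonym 'd tensor_index = "'d option option"

definition gl_action :: "('d::finite \<Rightarrow> 'd \<Rightarrow> real) \<Rightarrow> ('d tensor_index \<Rightarrow> real) \<Rightarrow> 'd tensor_index \<Rightarrow> real" where
  "gl_action M y k = (case k of None \<Rightarrow> 0 | Some None \<Rightarrow> - (\<Sum>a\<in>UNIV. M a a) * y (Some None)
     | Some (Some i) \<Rightarrow> \<Sum>a\<in>UNIV. y (Some (Some a)) * M a i)"

lemma gl_action_add:
  "gl_action M (\<lambda>l. y l + z l) k = gl_action M y k + gl_action M z k"
  "gl_action (\<lambda>a b. M a b + M' a b) y k = gl_action M y k + gl_action M' y k"
  by (auto simp: gl_action_def sum.distrib algebra_simps split: option.splits)

lemma gl_action_minus:
  "gl_action M (\<lambda>l. - y l) k = - gl_action M y k"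
  "gl_action (\<lambda>a b. - M a b) y k = - gl_action M y k"
  by (auto simp: gl_action_def sum_negf split: option.splits)

lemma gl_action_scale: "gl_action M (\<lambda>l. t * y l) k = t * gl_action M y k"
  by (auto simp: gl_action_def sum_distrib_left mult_ac split: option.splits)

lemma gl_action_sum:
  "gl_action M (\<lambda>l. \<Sum>c\<in>UNIV. e c * y c l) k = (\<Sum>c\<in>(UNIV :: 'i::finite set). e c * gl_action M (y c) k)"
  "gl_action (\<lambda>a b. \<Sum>c\<in>UNIV. e c * N c a b) z k = (\<Sum>c\<in>(UNIV :: 'i::finite set). e c * gl_action (N c) z k)"
proof -
  show "gl_action M (\<lambda>l. \<Sum>c\<in>UNIV. e c * y c l) k = (\<Sum>c\<in>(UNIV :: 'i::finite set). e c * gl_action M (y c) k)"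
  proof (cases k)
    case (Some j)
    show ?thesis
    proof (cases j)
      case None
      then show ?thesis using Some
        by (simp add: gl_action_def sum_distrib_left sum_negf mult_ac)
    next
      case (Some i)
      have "gl_action M (\<lambda>l. \<Sum>c\<in>UNIV. e c * y c l) k = (\<Sum>a\<in>UNIV. \<Sum>c\<in>UNIV. e c * (y c (Some (Some a)) * M a i))"
        using Some \<open>k = Some j\<close> by (simp add: gl_action_def sum_distrib_left sum_distrib_right mult_ac)
      also have "\<dots> = (\<Sum>c\<in>UNIV. \<Sum>a\<in>UNIV. e c * (y c (Some (Some a)) * M a i))" by (rule sum.swap)
      finally show ?thesis using Some \<open>k = Some j\<close> by (simp add: gl_action_def sum_distrib_left)
    qed
  qed (simp add: gl_action_def)
  show "gl_action (\<lambda>a b. \<Sum>c\<in>UNIV. e c * N c a b) z k = (\<Sum>c\<in>(UNIV :: 'i::finite set). e c * gl_action (N c) z k)"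
  proof (cases k)
    case (Some j)
    show ?thesis
    proof (cases j)
      case None
      have "(\<Sum>a\<in>UNIV. \<Sum>c\<in>UNIV. e c * N c a a) = (\<Sum>c\<in>UNIV. \<Sum>a\<in>UNIV. e c * N c a a)" by (rule sum.swap)
      then show ?thesis using Some None
        by (simp add: gl_action_def sum_distrib_left sum_distrib_right sum_negf mult_ac)
    next
      case (Some i)
      have "gl_action (\<lambda>a b. \<Sum>c\<in>UNIV. e c * N c a b) z k = (\<Sum>a\<in>UNIV. \<Sum>c\<in>UNIV. e c * (z (Some (Some a)) * N c a i))"
        using Some \<open>k = Some j\<close> by (simp add: gl_action_def sum_distrib_left mult_ac)
      also have "\<dots> = (\<Sum>c\<in>UNIV. \<Sum>a\<in>UNIV. e c * (z (Some (Some a)) * N c a i))" by (rule sum.swap)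
      finally show ?thesis using Some \<open>k = Some j\<close> by (simp add: gl_action_def sum_distrib_left)
    qed
  qed (simp add: gl_action_def)
qed

text \<open>On vectors the matrices multiply from the right, so compositions become products in
  reversed order. On the density only traces enter, and the trace of a commutator is 0.\<close>

lemma gl_action_commutator:
  "gl_action M' (gl_action M y) k - gl_action M (gl_action M' y) k =
    gl_action (\<lambda>a b. (\<Sum>c\<in>UNIV. M a c * M' c b) + - (\<Sum>c\<in>UNIV. M' a c * M c b)) y k"
proof -
  have v: "gl_action M' (gl_action M y) (Some (Some i)) = gl_action (\<lambda>a b. \<Sum>c\<in>UNIV. M a c * M' c b) y (Some (Some i))"
    for M M' :: "'a \<Rightarrow> 'a \<Rightarrow> real" and i
  proof -
    have "gl_action M' (gl_action M y) (Some (Some i)) = (\<Sum>c\<in>UNIV. \<Sum>a\<in>UNIV. y (Some (Some a)) * (M a c * M' c i))"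
      by (simp add: gl_action_def sum_distrib_left sum_distrib_right mult_ac)
    also have "\<dots> = (\<Sum>a\<in>UNIV. \<Sum>c\<in>UNIV. y (Some (Some a)) * (M a c * M' c i))" by (rule sum.swap)
    finally show ?thesis by (simp add: gl_action_def sum_distrib_left)
  qed
  show ?thesis
  proof (cases k)
    case (Some j)
    show ?thesis
    proof (cases j)
      case None
      have "(\<Sum>a\<in>UNIV. \<Sum>c\<in>UNIV. M a c * M' c a) = (\<Sum>a\<in>UNIV. \<Sum>c\<in>UNIV. M' a c * M c a)"
        by (subst sum.swap) (simp add: mult.commute)
      then show ?thesis using Some None by (simp add: gl_action_def sum_subtractf mult_ac)
    next
      case (Some i)
      then show ?thesis using \<open>k = Some j\<close> by (simp only: v gl_action_add gl_action_minus)
    qed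
  qed (simp add: gl_action_def)
qed

lemma smooth_on_gl_action:
  assumes "open V" "\<And>a b. smooth_on V (M a b)" "\<And>l. smooth_on V (y l)"
  shows "smooth_on V (\<lambda>x. gl_action (\<lambda>a b. M a b x) (\<lambda>l. y l x) k)"
proof (cases k)
  case (Some j)
  then show ?thesis
    by (cases j) (auto simp: gl_action_def intro!: smooth_on_intros assms)
qed (simp add: gl_action_def)

lemma pd_gl_action:
  fixes M :: "'d::finite \<Rightarrow> 'd \<Rightarrow> 'd scalar"
  assumes "\<And>a b. M a b differentiable at x" "\<And>l. y l differentiable at x"
  shows "pd c (\<lambda>x. gl_action (\<lambda>a b. M a b x) (\<lambda>l. y l x) k) x =
    gl_action (\<lambda>a b. pd c (M a b) x) (\<lambda>l. y l x) k + gl_action (\<lambda>a b. M a b x) (\<lambda>l. pd c (y l) x) k"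
proof (cases k)
  case (Some j)
  have d: "(\<lambda>x. \<Sum>a\<in>UNIV. M a a x) differentiable at x" by (intro differentiable_sum) (simp_all add: assms)
  show ?thesis
  proof (cases j)
    case None
    then show ?thesis using Some d
      by (simp add: gl_action_def pd_mult pd_minus pd_sum assms)
  next
    case (Some i)
    then show ?thesis using \<open>k = Some j\<close>
      by (simp add: gl_action_def pd_sum pd_mult assms sum.distrib)
  qed
qed (simp add: gl_action_def)

abbreviation tensor_var :: "'d::finite tensor_index \<Rightarrow> 'd list \<Rightarrow> ('d \<times> 'd, 'd) jvar" where
  "tensor_var k \<equiv> Psi (idx k)"

text \<open>Multiplied by the density \<rho>, this is the Lagrangian of irrotational dust: the
  vector y yields g y = -\<partial>\<phi>, the density then yields g(y, y) = 1, which fixes the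
  constant 1/2, and the scalar \<phi> yields the continuity equation for \<rho> y.\<close>

definition fluid_scalar :: "('d::finite \<times> 'd, 'd) jet \<Rightarrow> real" where
  "fluid_scalar u = 1 / 2 * quad (\<lambda>\<mu> \<nu>. u (Zeta (\<mu>, \<nu>) []))
       (\<lambda>\<mu>. u (tensor_var (Some (Some \<mu>)) [])) (\<lambda>\<mu>. u (tensor_var (Some (Some \<mu>)) []))
     + (\<Sum>\<mu>\<in>UNIV. u (tensor_var (Some (Some \<mu>)) []) * u (tensor_var None [\<mu>])) + 1 / 2"

definition fluid_density :: "('d::finite \<times> 'd, 'd) jet \<Rightarrow> real" where
  "fluid_density u = u (tensor_var (Some None) []) * fluid_scalar u"

text \<open>Since \<open>\<rho>\<close> is a density, neither the determinant nor the inverse of the metric is needed, and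
  the Lagrangian stays polynomial.\<close>

definition fluid_theory :: "('d \<times> 'd, 'd) setting \<Rightarrow> ('d::finite \<times> 'd, 'd, 'd) field_theory" where
  "fluid_theory st = \<lparr>
     matter = CARD('d tensor_index), deriv_order = 1, L_inv = fluid_density, tr_order = 1,
     tr_coeff = (\<lambda>k b s x u. if s = [] then - u (Psi k [b])
       else gl_action (\<lambda>a c. if a = hd s \<and> c = b then 1 else 0) (\<lambda>l. u (tensor_var l [])) (unidx k)),
     setting = st \<rparr>"

lemma fluid_theory_simps [simp]:
  fixes st :: "('d::finite \<times> 'd, 'd) setting"
  shows "matter (fluid_theory st) = CARD('d tensor_index)" "deriv_order (fluid_theory st) = 1"
  "L_inv (fluid_theory st) = fluid_density" "tr_order (fluid_theory st) = 1" "setting (fluid_theory st) = st"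
  by (simp_all add: fluid_theory_def del: card_option)

text \<open>The coefficients encode minus the Lie derivative along \<epsilon>. Those of strings of
  length one are \<open>gl_action\<close> on matrix units, and expanding the Jacobian of \<epsilon>
  in matrix units reassembles them.\<close>

lemma fluid_matter_tr:
  fixes k :: "'d::finite tensor_index"
  shows "matter_tr (fluid_theory st) g \<psi> \<epsilon> (idx k) = (\<lambda>x. - (\<Sum>b\<in>UNIV. \<epsilon> b x * pd b (\<psi> (idx k)) x)
    + gl_action (\<lambda>a b. pd a (\<epsilon> b) x) (\<lambda>l. \<psi> (idx l) x) k)"
proof
  fix x
  let ?y = "\<lambda>l. \<psi> (idx l) x"
  have e: "gl_action (\<lambda>a b. pd a (\<epsilon> b) x) ?y k =
    (\<Sum>\<mu>\<in>UNIV. \<Sum>c\<in>UNIV. pd \<mu> (\<epsilon> c) x * gl_action (\<lambda>a b. if a = \<mu> \<and> b = c then 1 else 0) ?y k)"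
  proof -
    have "(\<lambda>a b. pd a (\<epsilon> b) x) = (\<lambda>a b. \<Sum>\<mu>\<in>UNIV. 1 * (\<Sum>c\<in>UNIV. pd \<mu> (\<epsilon> c) x * (if a = \<mu> \<and> b = c then 1 else 0)))"
    proof (intro ext)
      fix a b
      have "(\<Sum>\<mu>\<in>UNIV. 1 * (\<Sum>c\<in>UNIV. pd \<mu> (\<epsilon> c) x * (if a = \<mu> \<and> b = c then 1 else 0)))
        = (\<Sum>\<mu>\<in>UNIV. if a = \<mu> then \<Sum>c\<in>UNIV. if b = c then pd \<mu> (\<epsilon> c) x else 0 else 0)"
        by (intro sum.cong refl) (auto simp: if_distrib[of "\<lambda>r. _ * r"] cong: if_cong)
      then show "pd a (\<epsilon> b) x = (\<Sum>\<mu>\<in>UNIV. 1 * (\<Sum>c\<in>UNIV. pd \<mu> (\<epsilon> c) x * (if a = \<mu> \<and> b = c then 1 else 0)))"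
        by simp
    qed
    then show ?thesis by (simp only: gl_action_sum) simp
  qed
  have "matter_tr (fluid_theory st) g \<psi> \<epsilon> (idx k) x = (\<Sum>b\<in>UNIV. - pd b (\<psi> (idx k)) x * \<epsilon> b x)
    + (\<Sum>\<mu>\<in>UNIV. \<Sum>b\<in>UNIV. gl_action (\<lambda>a c. if a = \<mu> \<and> c = b then 1 else 0) ?y k * pd \<mu> (\<epsilon> b) x)"
    unfolding matter_tr_def fluid_theory_simps sum_strings_1
    by (simp add: fluid_theory_def)
  then show "matter_tr (fluid_theory st) g \<psi> \<epsilon> (idx k) x = - (\<Sum>b\<in>UNIV. \<epsilon> b x * pd b (\<psi> (idx k)) x)
    + gl_action (\<lambda>a b. pd a (\<epsilon> b) x) ?y k"
    unfolding e by (simp add: sum_negf mult.commute)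
qed

lemma poly_quad:
  "(\<And>\<mu> \<nu>. poly_jet (h \<mu> \<nu>)) \<Longrightarrow> (\<And>\<mu>. poly_jet (y \<mu>)) \<Longrightarrow> (\<And>\<mu>. poly_jet (z \<mu>)) \<Longrightarrow>
    poly_jet (\<lambda>u. quad (\<lambda>\<mu> \<nu>. h \<mu> \<nu> u) (\<lambda>\<mu>. y \<mu> u) (\<lambda>\<mu>. z \<mu> u))"
  unfolding quad_def by (intro poly_intros)

lemma poly_fluid_scalar: "poly_jet fluid_scalar"
  unfolding fluid_scalar_def[abs_def] by (intro poly_intros poly_quad)

lemma poly_fluid_density: "poly_jet fluid_density"
  unfolding fluid_density_def[abs_def] by (intro poly_intros poly_fluid_scalar)

lemma fluid_inv_density: "inv_density (fluid_theory st) = fluid_density"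
  by (simp add: inv_density_def fluid_density_def fluid_scalar_def fun_eq_iff)

context
  fixes V :: "(real ^ 'd::finite) set"
  assumes V: "open V"
begin

text \<open>A scalar density of weight 1 varies by minus its Lie derivative, which is a total
  divergence. The factor \<open>fluid_scalar\<close> is merely transported, and the missing term
  with the divergence of \<epsilon> comes from \<rho>.\<close>

lemma fluid_variation:
  fixes g :: "('d \<times> 'd, 'd) zfield"
  assumes f: "fields V (metric_sector V) (fluid_theory st) g \<psi>"
    and \<epsilon>: "smooth_param V \<epsilon>" and x: "x \<in> V"
  shows "variation fluid_density g \<psi> (zeta_tr (metric_sector V) g \<epsilon>) (matter_tr (fluid_theory st) g \<psi> \<epsilon>) x
    = - (\<Sum>a\<in>UNIV. pd a (\<lambda>y. \<epsilon> a y * fluid_density (jet g \<psi> y)) x)"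
proof -
  let ?T = "fluid_theory st"
  have gs: "smooth_on V (g z)" for z
    using f unfolding fields_def metric_sector_simps by blast
  have \<psi>s: "smooth_on V (\<psi> (idx l))" for l :: "'d tensor_index"
    using f idx_less[of l] unfolding fields_def fluid_theory_simps by blast
  have \<epsilon>s: "smooth_on V (\<epsilon> a)" for a using \<epsilon> by (simp add: smooth_param_def)
  note diff = smooth_on_differentiable[OF _ V x]
  define d\<psi> where "d\<psi> l = matter_tr ?T g \<psi> \<epsilon> (idx l)" for l :: "'d tensor_index"
  have d\<psi>: "d\<psi> l = (\<lambda>x. - (\<Sum>b\<in>UNIV. \<epsilon> b x * pd b (\<psi> (idx l)) x)
    + gl_action (\<lambda>a b. pd a (\<epsilon> b) x) (\<lambda>l. \<psi> (idx l) x) l)" for l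
    unfolding d\<psi>_def by (rule fluid_matter_tr)
  have ds: "smooth_on V (d\<psi> l)" for l
    unfolding d\<psi> by (intro smooth_on_intros smooth_on_gl_action V \<epsilon>s \<psi>s)
  let ?v = "\<lambda>\<mu>. Some (Some \<mu>) :: 'd tensor_index"
  \<comment> \<open>From here on the fields and their derivatives at x are abbreviated as numbers; a
    prime marks a derivative in the direction given by the first argument.\<close>
  define h where "h \<mu> \<nu> = g (\<mu>, \<nu>) x" for \<mu> \<nu>
  define y where "y \<mu> = \<psi> (idx (?v \<mu>)) x" for \<mu>
  define r where "r = \<psi> (idx (Some None :: 'd tensor_index)) x"
  define p where "p \<mu> = pd \<mu> (\<psi> (idx (None :: 'd tensor_index))) x" for \<mu>
  define e where "e a = \<epsilon> a x" for a
  define E where "E a b = pd a (\<epsilon> b) x" for a b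
  define h' where "h' a \<mu> \<nu> = pd a (g (\<mu>, \<nu>)) x" for a \<mu> \<nu>
  define y' where "y' a \<mu> = pd a (\<psi> (idx (?v \<mu>))) x" for a \<mu>
  define r' where "r' a = pd a (\<psi> (idx (Some None :: 'd tensor_index))) x" for a
  define p' where "p' a \<mu> = pd a (pd \<mu> (\<psi> (idx (None :: 'd tensor_index)))) x" for a \<mu>
  define W where "W \<mu> = (\<Sum>\<rho>\<in>UNIV. y \<rho> * E \<rho> \<mu>)" for \<mu>
  define H where "H \<mu> \<nu> = (\<Sum>\<rho>\<in>UNIV. h \<rho> \<nu> * E \<mu> \<rho> + h \<mu> \<rho> * E \<nu> \<rho>)" for \<mu> \<nu>
  define S where "S = 1 / 2 * quad h y y + (\<Sum>\<mu>\<in>UNIV. y \<mu> * p \<mu>) + 1 / 2"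
  define S' where "S' a = 1 / 2 * (quad (h' a) y y + quad h (y' a) y + quad h y (y' a))
    + (\<Sum>\<mu>\<in>UNIV. y' a \<mu> * p \<mu> + y \<mu> * p' a \<mu>)" for a
  have dh: "zeta_tr (metric_sector V) g \<epsilon> (\<mu>, \<nu>) x = - (\<Sum>a\<in>UNIV. e a * h' a \<mu> \<nu>) + - H \<mu> \<nu>" for \<mu> \<nu>
    by (simp add: lie_metric_def e_def h'_def H_def h_def E_def sum.distrib algebra_simps)
  have dy: "d\<psi> (?v \<mu>) x = - (\<Sum>a\<in>UNIV. e a * y' a \<mu>) + W \<mu>" for \<mu>
    by (simp add: d\<psi> gl_action_def e_def y'_def W_def y_def E_def)
  have dr: "d\<psi> (Some None) x = - (\<Sum>a\<in>UNIV. e a * r' a) - (\<Sum>a\<in>UNIV. E a a) * r"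
    by (simp add: d\<psi> gl_action_def e_def r'_def r_def E_def)
  have dp: "pd \<mu> (d\<psi> None) x = - (\<Sum>a\<in>UNIV. e a * p' a \<mu>) - (\<Sum>a\<in>UNIV. E \<mu> a * p a)" for \<mu>
  proof -
    have dx: "(\<lambda>x. \<epsilon> b x * pd b (\<psi> (idx (None :: 'd tensor_index))) x) differentiable at x" for b
      by (intro diff smooth_on_intros V \<epsilon>s \<psi>s)
    have "pd \<mu> (d\<psi> None) x = - (\<Sum>b\<in>UNIV. pd \<mu> (\<lambda>x. \<epsilon> b x * pd b (\<psi> (idx (None :: 'd tensor_index))) x) x)"
      unfolding d\<psi> gl_action_def using dx by (simp add: pd_minus pd_sum)
    also have "\<dots> = - (\<Sum>b\<in>UNIV. E \<mu> b * p b + e b * p' b \<mu>)"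
      using pd_commute[OF \<psi>s V x, of \<mu>]
      by (simp add: pd_mult diff \<epsilon>s smooth_on_pd[OF \<psi>s] E_def e_def p_def p'_def)
    finally show ?thesis by (simp add: sum.distrib)
  qed
  define U where "U t = jet (\<lambda>z y. g z y + t * zeta_tr (metric_sector V) g \<epsilon> z y)
      (\<lambda>k y. \<psi> k y + t * matter_tr ?T g \<psi> \<epsilon> k y) x" for t
  have UX: "pd \<mu> (\<lambda>y. \<psi> (idx (None :: 'd tensor_index)) y + t * matter_tr ?T g \<psi> \<epsilon> (idx (None :: 'd tensor_index)) y) x
      = p \<mu> + t * pd \<mu> (d\<psi> None) x" for t \<mu>
    using pds_linear[OF V \<psi>s ds x, of "[\<mu>]"] by (simp add: d\<psi>_def p_def)
  have US: "fluid_scalar (U t) = 1 / 2 * quad (\<lambda>\<mu> \<nu>. h \<mu> \<nu> + t * zeta_tr (metric_sector V) g \<epsilon> (\<mu>, \<nu>) x)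
      (\<lambda>\<mu>. y \<mu> + t * d\<psi> (?v \<mu>) x) (\<lambda>\<mu>. y \<mu> + t * d\<psi> (?v \<mu>) x)
      + (\<Sum>\<mu>\<in>UNIV. (y \<mu> + t * d\<psi> (?v \<mu>) x) * (p \<mu> + t * pd \<mu> (d\<psi> None) x)) + 1 / 2" for t
    unfolding fluid_scalar_def U_def jet_simps pds.simps UX by (simp add: h_def y_def d\<psi>_def del: metric_sector_simps)
  have dS: "((\<lambda>t. fluid_scalar (U t)) has_real_derivative - (\<Sum>a\<in>UNIV. e a * S' a)) (at 0)"
  proof -
    let ?dh = "\<lambda>\<mu> \<nu>. zeta_tr (metric_sector V) g \<epsilon> (\<mu>, \<nu>) x" and ?dy = "\<lambda>\<mu>. d\<psi> (?v \<mu>) x"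
    have "((\<lambda>t. fluid_scalar (U t)) has_real_derivative 1 / 2 * (quad ?dh y y + quad h ?dy y + quad h y ?dy)
        + (\<Sum>\<mu>\<in>UNIV. ?dy \<mu> * p \<mu> + y \<mu> * pd \<mu> (d\<psi> None) x)) (at 0)"
      unfolding US
      by (rule derivative_eq_intros quad_derivative refl | simp add: algebra_simps del: metric_sector_simps)+
    moreover have "quad ?dh y y + quad h ?dy y + quad h y ?dy
        = - (\<Sum>a\<in>UNIV. e a * (quad (h' a) y y + quad h (y' a) y + quad h y (y' a)))"
    proof -
      \<comment> \<open>The terms without derivatives of the fields: what the metric loses through
        \<open>H\<close> is restored by the two vector factors through \<open>W\<close>.\<close>
      have "quad H y y = quad h W y + quad h y W"
      proof -
        have "(\<Sum>\<mu>\<in>UNIV. \<Sum>\<nu>\<in>UNIV. \<Sum>\<rho>\<in>UNIV. h \<rho> \<nu> * E \<mu> \<rho> * y \<mu> * y \<nu>)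
          = (\<Sum>\<nu>\<in>UNIV. \<Sum>\<mu>\<in>UNIV. \<Sum>\<rho>\<in>UNIV. h \<rho> \<nu> * E \<mu> \<rho> * y \<mu> * y \<nu>)" by (rule sum.swap)
        also have "\<dots> = (\<Sum>\<nu>\<in>UNIV. \<Sum>\<rho>\<in>UNIV. \<Sum>\<mu>\<in>UNIV. h \<rho> \<nu> * E \<mu> \<rho> * y \<mu> * y \<nu>)"
          by (intro sum.cong refl sum.swap)
        also have "\<dots> = (\<Sum>\<rho>\<in>UNIV. \<Sum>\<nu>\<in>UNIV. \<Sum>\<mu>\<in>UNIV. h \<rho> \<nu> * E \<mu> \<rho> * y \<mu> * y \<nu>)" by (rule sum.swap)
        finally have 1: "(\<Sum>\<mu>\<in>UNIV. \<Sum>\<nu>\<in>UNIV. \<Sum>\<rho>\<in>UNIV. h \<rho> \<nu> * E \<mu> \<rho> * y \<mu> * y \<nu>) = quad h W y"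
          by (simp add: quad_def W_def sum_distrib_left sum_distrib_right mult_ac)
        have "(\<Sum>\<mu>\<in>UNIV. \<Sum>\<nu>\<in>UNIV. \<Sum>\<rho>\<in>UNIV. h \<mu> \<rho> * E \<nu> \<rho> * y \<mu> * y \<nu>)
          = (\<Sum>\<mu>\<in>UNIV. \<Sum>\<rho>\<in>UNIV. \<Sum>\<nu>\<in>UNIV. h \<mu> \<rho> * E \<nu> \<rho> * y \<mu> * y \<nu>)"
          by (intro sum.cong refl sum.swap)
        then have 2: "(\<Sum>\<mu>\<in>UNIV. \<Sum>\<nu>\<in>UNIV. \<Sum>\<rho>\<in>UNIV. h \<mu> \<rho> * E \<nu> \<rho> * y \<mu> * y \<nu>) = quad h y W"
          by (simp add: quad_def W_def sum_distrib_left sum_distrib_right mult_ac)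
        show ?thesis unfolding 1[symmetric] 2[symmetric]
          by (simp add: quad_def H_def sum_distrib_right distrib_right sum.distrib)
      qed
      then show ?thesis
        unfolding dh dy quad_add quad_minus quad_sum
        by (simp add: distrib_left sum.distrib)
    qed
    moreover have "(\<Sum>\<mu>\<in>UNIV. ?dy \<mu> * p \<mu> + y \<mu> * pd \<mu> (d\<psi> None) x)
        = - (\<Sum>a\<in>UNIV. e a * (\<Sum>\<mu>\<in>UNIV. y' a \<mu> * p \<mu> + y \<mu> * p' a \<mu>))"
    proof -
      \<comment> \<open>The same compensation in the pairing of the vector with the gradient of the
        scalar.\<close>
      have 1: "(\<Sum>\<mu>\<in>UNIV. W \<mu> * p \<mu>) = (\<Sum>\<mu>\<in>UNIV. y \<mu> * (\<Sum>a\<in>UNIV. E \<mu> a * p a))"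
      proof -
        have "(\<Sum>\<mu>\<in>UNIV. W \<mu> * p \<mu>) = (\<Sum>\<mu>\<in>UNIV. \<Sum>\<rho>\<in>UNIV. y \<rho> * E \<rho> \<mu> * p \<mu>)"
          by (simp add: W_def sum_distrib_right)
        also have "\<dots> = (\<Sum>\<rho>\<in>UNIV. \<Sum>\<mu>\<in>UNIV. y \<rho> * E \<rho> \<mu> * p \<mu>)" by (rule sum.swap)
        finally show ?thesis by (simp add: sum_distrib_left mult.assoc)
      qed
      have "(\<Sum>a\<in>UNIV. e a * (\<Sum>\<mu>\<in>UNIV. y' a \<mu> * p \<mu> + y \<mu> * p' a \<mu>))
          = (\<Sum>a\<in>UNIV. \<Sum>\<mu>\<in>UNIV. e a * y' a \<mu> * p \<mu> + y \<mu> * (e a * p' a \<mu>))"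
        by (simp add: sum_distrib_left algebra_simps)
      also have "\<dots> = (\<Sum>\<mu>\<in>UNIV. \<Sum>a\<in>UNIV. e a * y' a \<mu> * p \<mu> + y \<mu> * (e a * p' a \<mu>))" by (rule sum.swap)
      also have "\<dots> = (\<Sum>\<mu>\<in>UNIV. (\<Sum>a\<in>UNIV. e a * y' a \<mu>) * p \<mu>) + (\<Sum>\<mu>\<in>UNIV. y \<mu> * (\<Sum>a\<in>UNIV. e a * p' a \<mu>))"
        by (simp add: sum.distrib sum_distrib_left sum_distrib_right)
      finally show ?thesis unfolding dy dp using 1
        by (simp add: sum.distrib sum_subtractf distrib_right right_diff_distrib left_diff_distrib sum_negf)
    qed
    moreover have "(\<Sum>a\<in>UNIV. e a * S' a) =
        1 / 2 * (\<Sum>a\<in>UNIV. e a * (quad (h' a) y y + quad h (y' a) y + quad h y (y' a)))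
        + (\<Sum>a\<in>UNIV. e a * (\<Sum>\<mu>\<in>UNIV. y' a \<mu> * p \<mu> + y \<mu> * p' a \<mu>))"
      unfolding S'_def sum_distrib_left[of "1 / 2"] sum.distrib[symmetric]
      by (intro sum.cong refl) (simp only: distrib_left mult_ac)
    ultimately show ?thesis by (simp del: metric_sector_simps)
  qed
  have S0: "fluid_scalar (U 0) = S" unfolding US by (simp add: S_def)
  have Ur: "U t (tensor_var (Some None) []) = r + t * d\<psi> (Some None) x" for t
    by (simp add: U_def r_def d\<psi>_def)
  have "((\<lambda>t. fluid_density (U t)) has_real_derivative
      d\<psi> (Some None) x * S + r * - (\<Sum>a\<in>UNIV. e a * S' a)) (at 0)"
    unfolding fluid_density_def Ur
    by (rule derivative_eq_intros dS refl | simp add: S0)+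
  then have "variation fluid_density g \<psi> (zeta_tr (metric_sector V) g \<epsilon>) (matter_tr ?T g \<psi> \<epsilon>) x =
      d\<psi> (Some None) x * S + r * - (\<Sum>a\<in>UNIV. e a * S' a)"
    unfolding variation_def U_def by (rule DERIV_imp_deriv)
  moreover have "pd a (\<lambda>y. \<epsilon> a y * fluid_density (jet g \<psi> y)) x = E a a * (r * S) + e a * (r' a * S + r * S' a)" for a
  proof -
    let ?S = "\<lambda>x. 1 / 2 * quad (\<lambda>\<mu> \<nu>. g (\<mu>, \<nu>) x) (\<lambda>\<mu>. \<psi> (idx (?v \<mu>)) x) (\<lambda>\<mu>. \<psi> (idx (?v \<mu>)) x)
      + (\<Sum>\<mu>\<in>UNIV. \<psi> (idx (?v \<mu>)) x * pd \<mu> (\<psi> (idx (None :: 'd tensor_index))) x) + 1 / 2"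
    have L: "fluid_density (jet g \<psi> x) = \<psi> (idx (Some None :: 'd tensor_index)) x * ?S x" for x
      by (simp add: fluid_density_def fluid_scalar_def)
    have qs: "smooth_on V (\<lambda>x. quad (\<lambda>\<mu> \<nu>. g (\<mu>, \<nu>) x) (\<lambda>\<mu>. \<psi> (idx (?v \<mu>)) x) (\<lambda>\<mu>. \<psi> (idx (?v \<mu>)) x))"
      unfolding quad_def by (intro smooth_on_intros V gs \<psi>s)
    have ps: "smooth_on V (\<lambda>x. \<psi> (idx (?v \<mu>)) x * pd \<mu> (\<psi> (idx (None :: 'd tensor_index))) x)" for \<mu>
      by (intro smooth_on_intros V \<psi>s)
    have ss: "smooth_on V (\<lambda>x. \<Sum>\<mu>\<in>UNIV. \<psi> (idx (?v \<mu>)) x * pd \<mu> (\<psi> (idx (None :: 'd tensor_index))) x)"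
      by (intro smooth_on_intros V ps)
    have Ss: "smooth_on V ?S" by (intro smooth_on_intros smooth_on_const V qs ps)
    have "pd a ?S x = S' a"
    proof -
      have "pd a ?S x = pd a (\<lambda>x. 1 / 2 * quad (\<lambda>\<mu> \<nu>. g (\<mu>, \<nu>) x) (\<lambda>\<mu>. \<psi> (idx (?v \<mu>)) x) (\<lambda>\<mu>. \<psi> (idx (?v \<mu>)) x)) x
        + pd a (\<lambda>x. \<Sum>\<mu>\<in>UNIV. \<psi> (idx (?v \<mu>)) x * pd \<mu> (\<psi> (idx (None :: 'd tensor_index))) x) x"
        using diff[OF qs] diff[OF ss] by (simp add: pd_add)
      also have "pd a (\<lambda>x. 1 / 2 * quad (\<lambda>\<mu> \<nu>. g (\<mu>, \<nu>) x) (\<lambda>\<mu>. \<psi> (idx (?v \<mu>)) x) (\<lambda>\<mu>. \<psi> (idx (?v \<mu>)) x)) x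
        = 1 / 2 * (quad (h' a) y y + quad h (y' a) y + quad h y (y' a))"
        by (simp only: pd_cmult[OF diff[OF qs]] pd_quad[OF diff[OF gs] diff[OF \<psi>s] diff[OF \<psi>s]])
          (simp add: h'_def[abs_def] y_def[abs_def] h_def[abs_def] y'_def[abs_def])
      also have "pd a (\<lambda>x. \<Sum>\<mu>\<in>UNIV. \<psi> (idx (?v \<mu>)) x * pd \<mu> (\<psi> (idx (None :: 'd tensor_index))) x) x
        = (\<Sum>\<mu>\<in>UNIV. y' a \<mu> * p \<mu> + y \<mu> * p' a \<mu>)"
        by (simp add: pd_sum[OF diff[OF ps]] pd_mult diff \<psi>s smooth_on_pd[OF \<psi>s] y'_def p_def y_def p'_def)
      finally show ?thesis by (simp add: S'_def)
    qed
    moreover have "?S x = S" by (simp add: S_def h_def[abs_def] y_def[abs_def] p_def)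
    moreover have "pd a (\<lambda>y. \<epsilon> a y * (\<psi> (idx (Some None :: 'd tensor_index)) y * ?S y)) x
        = E a a * (r * ?S x) + e a * (r' a * ?S x + r * pd a ?S x)"
      using diff[OF Ss] diff[OF \<epsilon>s] diff[OF \<psi>s] diff[OF smooth_on_mult[OF V \<psi>s Ss]]
      by (simp only: pd_mult E_def r_def e_def r'_def)
    ultimately show ?thesis unfolding L by simp
  qed
  ultimately show ?thesis unfolding dr
    by (simp add: sum.distrib sum_distrib_left sum_distrib_right sum_negf algebra_simps)
qed

text \<open>Two transformations are composed and antisymmetrized. Second derivatives of the fields
  drop out by symmetry, and the rest regroups into transport along the bracket and
  \<open>gl_action\<close> of its Jacobian.\<close>

lemma fluid_represents_algebra:
  "represents_algebra V (metric_sector V) (fluid_theory st)"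
  unfolding represents_algebra_def
proof (intro allI impI ballI)
  fix g :: "('d \<times> 'd, 'd) zfield" and \<psi> :: "'d mfield" and \<epsilon> \<eta> :: "('d, 'd) param" and k x
  assume f: "fields V (metric_sector V) (fluid_theory st) g \<psi>" and k: "k < matter (fluid_theory st)"
    and \<epsilon>: "smooth_param V \<epsilon>" and \<eta>: "smooth_param V \<eta>" and x: "x \<in> V"
  let ?T = "fluid_theory st"
  define l where "l = (unidx k :: 'd tensor_index)"
  have k: "k = idx l" using k by (simp only: l_def fluid_theory_simps idx_unidx)
  have \<psi>s: "smooth_on V (\<psi> (idx l))" for l :: "'d tensor_index"
    using f idx_less[of l] unfolding fields_def fluid_theory_simps by blast
  note diff = smooth_on_differentiable[OF _ V x]
  define Y where "Y l = \<psi> (idx l) x" for l :: "'d tensor_index"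
  define Y' where "Y' a l = pd a (\<psi> (idx l)) x" for a and l :: "'d tensor_index"
  define Y'' where "Y'' a b l = pd a (pd b (\<psi> (idx l))) x" for a b and l :: "'d tensor_index"
  define J where "J \<epsilon> a b = pd a (\<epsilon> b) x" for \<epsilon> :: "('d, 'd) param" and a b
  define J' where "J' \<epsilon> c a b = pd c (pd a (\<epsilon> b)) x" for \<epsilon> :: "('d, 'd) param" and a b c
  \<comment> \<open>\<open>Z\<close> is the variation of the fields at x and \<open>Z'\<close> its
    first derivatives. The second variation needs both, because the transformation itself
    differentiates the fields.\<close>
  define Z where "Z \<epsilon> l = - (\<Sum>b\<in>UNIV. \<epsilon> b x * Y' b l) + gl_action (J \<epsilon>) Y l"
    for \<epsilon> :: "('d, 'd) param" and l
  define Z' where "Z' \<epsilon> a l = - (\<Sum>b\<in>UNIV. J \<epsilon> a b * Y' b l + \<epsilon> b x * Y'' a b l)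
      + (gl_action (J' \<epsilon> a) Y l + gl_action (J \<epsilon>) (Y' a) l)" for \<epsilon> :: "('d, 'd) param" and a l
  have Z: "matter_tr ?T g \<psi> \<epsilon> (idx l) x = Z \<epsilon> l" for \<epsilon> l
    unfolding fluid_matter_tr by (simp add: Z_def Y'_def J_def[abs_def] Y_def[abs_def])
  have ds: "smooth_on V (matter_tr ?T g \<psi> \<epsilon> (idx l))" if "smooth_param V \<epsilon>" for \<epsilon> and l :: "'d tensor_index"
    unfolding fluid_matter_tr using that
    by (intro smooth_on_intros smooth_on_gl_action V \<psi>s) (auto simp: smooth_param_def)
  have Z': "pd a (matter_tr ?T g \<psi> \<epsilon> (idx l)) x = Z' \<epsilon> a l" if sp: "smooth_param V \<epsilon>" for \<epsilon> a l
  proof -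
    have \<epsilon>s: "smooth_on V (\<epsilon> b)" for b using sp by (simp add: smooth_param_def)
    have d1: "smooth_on V (\<lambda>x. \<epsilon> b x * pd b (\<psi> (idx l)) x)" for b by (intro smooth_on_intros V \<epsilon>s \<psi>s)
    have d2: "smooth_on V (\<lambda>x. \<Sum>b\<in>UNIV. \<epsilon> b x * pd b (\<psi> (idx l)) x)" by (intro smooth_on_intros V d1)
    have d3: "smooth_on V (\<lambda>x. gl_action (\<lambda>a b. pd a (\<epsilon> b) x) (\<lambda>l. \<psi> (idx l) x) l)"
      by (intro smooth_on_gl_action smooth_on_pd V \<epsilon>s \<psi>s)
    have "pd a (matter_tr ?T g \<psi> \<epsilon> (idx l)) x = - (\<Sum>b\<in>UNIV. pd a (\<lambda>x. \<epsilon> b x * pd b (\<psi> (idx l)) x) x)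
        + pd a (\<lambda>x. gl_action (\<lambda>a b. pd a (\<epsilon> b) x) (\<lambda>l. \<psi> (idx l) x) l) x"
      unfolding fluid_matter_tr
      by (simp only: pd_add[OF differentiable_minus[OF diff[OF d2]] diff[OF d3]] pd_minus[OF diff[OF d2]]
          pd_sum[OF diff[OF d1]])
    moreover have "pd a (\<lambda>x. \<epsilon> b x * pd b (\<psi> (idx l)) x) x = J \<epsilon> a b * Y' b l + \<epsilon> b x * Y'' a b l" for b
      by (simp add: pd_mult diff \<epsilon>s smooth_on_pd[OF \<psi>s] J_def Y'_def Y''_def)
    moreover have "pd a (\<lambda>x. gl_action (\<lambda>a b. pd a (\<epsilon> b) x) (\<lambda>l. \<psi> (idx l) x) l) x
        = gl_action (J' \<epsilon> a) Y l + gl_action (J \<epsilon>) (Y' a) l"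
      unfolding pd_gl_action[OF diff[OF smooth_on_pd[OF \<epsilon>s]] diff[OF \<psi>s]]
      by (simp add: J'_def[abs_def] J_def[abs_def] Y_def[abs_def] Y'_def[abs_def])
    ultimately show ?thesis by (simp add: Z'_def)
  qed
  have d: "deriv (\<lambda>t. matter_tr ?T (g' t) (\<lambda>i y. \<psi> i y + t * matter_tr ?T g \<psi> \<epsilon> i y) \<eta> k x) 0
      = - (\<Sum>b\<in>UNIV. \<eta> b x * Z' \<epsilon> b l) + gl_action (J \<eta>) (Z \<epsilon>) l" if sp: "smooth_param V \<epsilon>" for g' \<epsilon> \<eta>
  proof (rule DERIV_imp_deriv)
    have p: "pd b (\<lambda>y. \<psi> (idx l) y + t * matter_tr ?T g \<psi> \<epsilon> (idx l) y) x = Y' b l + t * Z' \<epsilon> b l" for b t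
      using pds_linear[OF V \<psi>s[of l] ds[OF sp, of l] x, of "[b]"] by (simp add: Z'[OF sp] Y'_def)
    have "matter_tr ?T (g' t) (\<lambda>i y. \<psi> i y + t * matter_tr ?T g \<psi> \<epsilon> i y) \<eta> k x
        = - (\<Sum>b\<in>UNIV. \<eta> b x * (Y' b l + t * Z' \<epsilon> b l)) + gl_action (J \<eta>) (\<lambda>l. Y l + t * Z \<epsilon> l) l" for t
      unfolding k fluid_matter_tr[of st "g' t"] p Z
      by (simp add: J_def[abs_def] Y_def[abs_def])
    then have e: "matter_tr ?T (g' t) (\<lambda>i y. \<psi> i y + t * matter_tr ?T g \<psi> \<epsilon> i y) \<eta> k x
        = - (\<Sum>b\<in>UNIV. \<eta> b x * (Y' b l + t * Z' \<epsilon> b l)) + (gl_action (J \<eta>) Y l + t * gl_action (J \<eta>) (Z \<epsilon>) l)" for t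
      by (simp only: gl_action_add gl_action_scale)
    show "((\<lambda>t. matter_tr ?T (g' t) (\<lambda>i y. \<psi> i y + t * matter_tr ?T g \<psi> \<epsilon> i y) \<eta> k x) has_real_derivative
        - (\<Sum>b\<in>UNIV. \<eta> b x * Z' \<epsilon> b l) + gl_action (J \<eta>) (Z \<epsilon>) l) (at 0)"
      unfolding e by (rule derivative_eq_intros refl | simp add: mult.commute)+
  qed
  have \<epsilon>s: "smooth_on V (\<epsilon> b)" and \<eta>s: "smooth_on V (\<eta> b)" for b
    using \<epsilon> \<eta> by (auto simp: smooth_param_def)
  let ?\<beta> = "bracket (metric_sector V) \<epsilon> \<eta>"
  \<comment> \<open>Products of first derivatives form a matrix commutator, answering to that of
    \<open>gl_action\<close>; the remaining terms transport each Jacobian along the other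
    parameter.\<close>
  have J\<beta>: "J ?\<beta> = (\<lambda>a b. ((\<Sum>c\<in>UNIV. J \<epsilon> a c * J \<eta> c b) + - (\<Sum>c\<in>UNIV. J \<eta> a c * J \<epsilon> c b))
     + ((\<Sum>c\<in>UNIV. \<epsilon> c x * J' \<eta> c a b) + - (\<Sum>c\<in>UNIV. \<eta> c x * J' \<epsilon> c a b)))"
  proof (intro ext)
    fix a b
    have d1: "smooth_on V (\<lambda>x. \<epsilon> c x * pd c (\<eta> b) x)" "smooth_on V (\<lambda>x. \<eta> c x * pd c (\<epsilon> b) x)" for c
      by (intro smooth_on_intros V \<epsilon>s \<eta>s)+
    have "J ?\<beta> a b = (\<Sum>c\<in>UNIV. pd a (\<lambda>x. \<epsilon> c x * pd c (\<eta> b) x + - (\<eta> c x * pd c (\<epsilon> b) x)) x)"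
      unfolding J_def metric_sector_simps
      by (subst pd_sum[symmetric]) (auto intro!: diff smooth_on_diff V d1)
    also have "\<dots> = (\<Sum>c\<in>UNIV. (J \<epsilon> a c * J \<eta> c b + \<epsilon> c x * J' \<eta> a c b) - (J \<eta> a c * J \<epsilon> c b + \<eta> c x * J' \<epsilon> a c b))"
    proof (intro sum.cong refl)
      fix c
      have "pd a (\<lambda>x. \<epsilon> c x * pd c (\<eta> b) x + - (\<eta> c x * pd c (\<epsilon> b) x)) x
        = pd a (\<lambda>x. \<epsilon> c x * pd c (\<eta> b) x) x + - pd a (\<lambda>x. \<eta> c x * pd c (\<epsilon> b) x) x"
        using diff[OF d1(1)[of c]] diff[OF d1(2)[of c]]
        by (simp only: pd_add differentiable_minus pd_minus)
      then show "pd a (\<lambda>x. \<epsilon> c x * pd c (\<eta> b) x + - (\<eta> c x * pd c (\<epsilon> b) x)) x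
        = (J \<epsilon> a c * J \<eta> c b + \<epsilon> c x * J' \<eta> a c b) - (J \<eta> a c * J \<epsilon> c b + \<eta> c x * J' \<epsilon> a c b)"
        by (simp add: pd_mult diff \<epsilon>s \<eta>s smooth_on_pd[OF \<epsilon>s] smooth_on_pd[OF \<eta>s] J_def J'_def)
    qed
    also have "(\<Sum>c\<in>UNIV. (J \<epsilon> a c * J \<eta> c b + \<epsilon> c x * J' \<eta> a c b) - (J \<eta> a c * J \<epsilon> c b + \<eta> c x * J' \<epsilon> a c b))
      = (\<Sum>c\<in>UNIV. (J \<epsilon> a c * J \<eta> c b + \<epsilon> c x * J' \<eta> c a b) - (J \<eta> a c * J \<epsilon> c b + \<eta> c x * J' \<epsilon> c a b))"
    proof -
      have "J' \<eta> a c b = J' \<eta> c a b" "J' \<epsilon> a c b = J' \<epsilon> c a b" for c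
        unfolding J'_def by (rule pd_commute[OF \<eta>s V x], rule pd_commute[OF \<epsilon>s V x])
      then show ?thesis by simp
    qed
    finally show "J ?\<beta> a b = ((\<Sum>c\<in>UNIV. J \<epsilon> a c * J \<eta> c b) + - (\<Sum>c\<in>UNIV. J \<eta> a c * J \<epsilon> c b))
     + ((\<Sum>c\<in>UNIV. \<epsilon> c x * J' \<eta> c a b) + - (\<Sum>c\<in>UNIV. \<eta> c x * J' \<epsilon> c a b))"
      by (simp add: sum.distrib sum_subtractf)
  qed
  have gl\<beta>: "gl_action (J ?\<beta>) Y l = gl_action (J \<eta>) (gl_action (J \<epsilon>) Y) l - gl_action (J \<epsilon>) (gl_action (J \<eta>) Y) l
      + ((\<Sum>c\<in>UNIV. \<epsilon> c x * gl_action (J' \<eta> c) Y l) - (\<Sum>c\<in>UNIV. \<eta> c x * gl_action (J' \<epsilon> c) Y l))"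
    unfolding J\<beta> gl_action_add(2)[of "\<lambda>a b. (\<Sum>c\<in>UNIV. J \<epsilon> a c * J \<eta> c b) + - (\<Sum>c\<in>UNIV. J \<eta> a c * J \<epsilon> c b)"]
      gl_action_commutator
    by (simp only: gl_action_add gl_action_minus gl_action_sum diff_conv_add_uminus)
  have glZ: "gl_action (J \<eta>) (Z \<epsilon>) l = - (\<Sum>b\<in>UNIV. \<epsilon> b x * gl_action (J \<eta>) (Y' b) l)
      + gl_action (J \<eta>) (gl_action (J \<epsilon>) Y) l" for \<epsilon> \<eta>
    unfolding Z_def[abs_def] by (simp only: gl_action_add gl_action_minus gl_action_sum)
  have sZ': "(\<Sum>a\<in>UNIV. \<eta> a x * Z' \<epsilon> a l) =
      - (\<Sum>b\<in>UNIV. (\<Sum>a\<in>UNIV. \<eta> a x * J \<epsilon> a b) * Y' b l) - (\<Sum>a\<in>UNIV. \<Sum>b\<in>UNIV. \<eta> a x * \<epsilon> b x * Y'' a b l)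
      + (\<Sum>a\<in>UNIV. \<eta> a x * gl_action (J' \<epsilon> a) Y l) + (\<Sum>a\<in>UNIV. \<eta> a x * gl_action (J \<epsilon>) (Y' a) l)" for \<epsilon> \<eta>
  proof -
    have "(\<Sum>b\<in>UNIV. (\<Sum>a\<in>UNIV. \<eta> a x * J \<epsilon> a b) * Y' b l) = (\<Sum>b\<in>UNIV. \<Sum>a\<in>UNIV. \<eta> a x * (J \<epsilon> a b * Y' b l))"
      by (simp add: sum_distrib_right mult.assoc)
    also have "\<dots> = (\<Sum>a\<in>UNIV. \<Sum>b\<in>UNIV. \<eta> a x * (J \<epsilon> a b * Y' b l))" by (rule sum.swap)
    finally show ?thesis
      by (simp add: Z'_def sum.distrib distrib_left right_diff_distrib sum_subtractf sum_distrib_left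
          sum_negf mult.assoc)
  qed
  have sym: "(\<Sum>a\<in>UNIV. \<Sum>b\<in>UNIV. \<eta> a x * \<epsilon> b x * Y'' a b l) = (\<Sum>a\<in>UNIV. \<Sum>b\<in>UNIV. \<epsilon> a x * \<eta> b x * Y'' a b l)"
  proof -
    have "Y'' a b l = Y'' b a l" for a b unfolding Y''_def by (rule pd_commute[OF \<psi>s V x])
    then have "(\<Sum>a\<in>UNIV. \<Sum>b\<in>UNIV. \<eta> a x * \<epsilon> b x * Y'' a b l) = (\<Sum>a\<in>UNIV. \<Sum>b\<in>UNIV. \<epsilon> b x * \<eta> a x * Y'' b a l)"
      by (simp add: mult.commute)
    also have "\<dots> = (\<Sum>a\<in>UNIV. \<Sum>b\<in>UNIV. \<epsilon> a x * \<eta> b x * Y'' a b l)" by (rule sum.swap)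
    finally show ?thesis .
  qed
  have "matter_tr ?T g \<psi> ?\<beta> k x = - (\<Sum>b\<in>UNIV. ?\<beta> b x * Y' b l) + gl_action (J ?\<beta>) Y l"
    unfolding k Z by (simp only: Z_def)
  also have "(\<Sum>b\<in>UNIV. ?\<beta> b x * Y' b l) = (\<Sum>b\<in>UNIV. (\<Sum>a\<in>UNIV. \<epsilon> a x * J \<eta> a b) * Y' b l)
      - (\<Sum>b\<in>UNIV. (\<Sum>a\<in>UNIV. \<eta> a x * J \<epsilon> a b) * Y' b l)"
    by (simp add: J_def sum_subtractf left_diff_distrib)
  finally show "deriv (\<lambda>t. matter_tr ?T (\<lambda>z y. g z y + t * zeta_tr (metric_sector V) g \<epsilon> z y)
        (\<lambda>i y. \<psi> i y + t * matter_tr ?T g \<psi> \<epsilon> i y) \<eta> k x) 0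
     - deriv (\<lambda>t. matter_tr ?T (\<lambda>z y. g z y + t * zeta_tr (metric_sector V) g \<eta> z y)
        (\<lambda>i y. \<psi> i y + t * matter_tr ?T g \<psi> \<eta> i y) \<epsilon> k x) 0
     = matter_tr ?T g \<psi> ?\<beta> k x"
    unfolding d[OF \<epsilon>] d[OF \<eta>] glZ sZ' gl\<beta> using sym by (simp del: metric_sector_simps)
qed

lemma fluid_invariant_theory:
  assumes p: "proper_setting V (metric_sector V) (fluid_theory st)"
  shows "invariant_theory V (metric_sector V) (fluid_theory st)"
proof -
  let ?T = "fluid_theory st"
  have D1: "depends_only_on (jvars CARD('d tensor_index) Q 1) (fluid_density :: ('d \<times> 'd, 'd) jet \<Rightarrow> real)" for Q
    unfolding depends_only_on_def
  proof (intro allI impI)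
    fix u v :: "('d \<times> 'd, 'd) jet" assume a: "\<forall>i\<in>jvars CARD('d tensor_index) Q 1. u i = v i"
    have "tensor_var l s \<in> jvars CARD('d tensor_index) Q 1" if "length s \<le> 1" for l :: "'d tensor_index" and s
      using that idx_less[of l] unfolding jvars_def by blast
    then have "u (tensor_var l [\<nu>]) = v (tensor_var l [\<nu>])" "u (tensor_var l []) = v (tensor_var l [])" for l \<nu>
      using a by auto
    moreover have "u (Zeta z []) = v (Zeta z [])" for z using a by (auto simp: jvars_def)
    ultimately show "fluid_density u = fluid_density v"
      by (simp add: fluid_density_def fluid_scalar_def)
  qed
  have 1: "local_function (jet_domain (metric_sector V)) (matter ?T)
    (n_invariants (setting ?T)) (deriv_order ?T) (L_inv ?T)"
    unfolding local_function_def fluid_theory_simps using D1 poly_smooth[OF poly_fluid_density] by blast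
  have tc: "tr_coeff ?T k b s x = (\<lambda>u. if s = [] then - u (Psi k [b])
       else gl_action (\<lambda>a c. if a = hd s \<and> c = b then 1 else 0) (\<lambda>l. u (tensor_var l [])) (unidx k))" for k b s x
    by (simp add: fluid_theory_def)
  have 2: "depends_only_on (jvars (matter ?T) 0 1) (tr_coeff ?T k b s x)" if "k < matter ?T" for k b s x
    unfolding depends_only_on_def
  proof (intro allI impI)
    fix u v :: "('d \<times> 'd, 'd) jet" assume a: "\<forall>i\<in>jvars (matter ?T) 0 1. u i = v i"
    have e: "u (Psi i s) = v (Psi i s)" if "length s \<le> 1" "i < matter ?T" for i s
      using that by (intro bspec[OF a]) (unfold jvars_def, blast)
    have "u (Psi k [b]) = v (Psi k [b])" by (rule e) (use that in simp_all)
    moreover have "u (tensor_var l []) = v (tensor_var l [])" for l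
      by (rule e) (simp_all del: card_option)
    ultimately show "tr_coeff ?T k b s x u = tr_coeff ?T k b s x v" by (simp add: tc)
  qed
  have 3: "smooth_on V (\<lambda>x. tr_coeff ?T k b s x (jet g \<psi> x))"
    if f: "fields V (metric_sector V) ?T g \<psi>" and k: "k < matter ?T" for g \<psi> k b s
  proof -
    have \<psi>s: "smooth_on V (\<psi> (idx l))" for l :: "'d tensor_index"
      using f idx_less[of l] unfolding fields_def fluid_theory_simps by blast
    have "smooth_on V (\<psi> k)" using f k unfolding fields_def by blast
    then have "smooth_on V (\<lambda>x. - pd b (\<psi> k) x)" by (intro smooth_on_intros V)
    moreover have "smooth_on V (\<lambda>x. gl_action (\<lambda>a c. if a = hd s \<and> c = b then 1 else 0) (\<lambda>l. \<psi> (idx l) x) (unidx k))"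
      by (intro smooth_on_gl_action smooth_on_const V \<psi>s)
    ultimately show ?thesis by (cases "s = []") (simp_all add: tc)
  qed
  \<comment> \<open>Here the integrand is a divergence with compact support, so only its integral
    vanishes.\<close>
  have 4: "invariant_action V (metric_sector V) ?T"
    unfolding invariant_action_def
  proof (intro allI impI)
    fix g \<psi> and \<epsilon> :: "('d, 'd) param"
    assume f: "fields V (metric_sector V) ?T g \<psi>" and "test_param V \<epsilon>"
    then obtain X where X: "compact X" "X \<subseteq> V" "\<And>a x. x \<notin> X \<Longrightarrow> \<epsilon> a x = 0" "\<And>a. smooth_on V (\<epsilon> a)"
      using test_paramE by metis
    have gs: "smooth_on V (g z)" for z using f unfolding fields_def metric_sector_simps by blast
    have \<psi>s: "smooth_on V (\<psi> (idx l))" for l :: "'d tensor_index"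
      using f idx_less[of l] unfolding fields_def fluid_theory_simps by blast
    have "smooth_on V (\<lambda>y. fluid_density (jet g \<psi> y))"
      unfolding fluid_density_def fluid_scalar_def quad_def jet_simps
      by (intro smooth_on_intros smooth_on_const V gs \<psi>s)
    then have "smooth_on V (\<lambda>y. \<epsilon> a y * fluid_density (jet g \<psi> y))" for a
      by (intro smooth_on_mult V X(4))
    then have "((\<lambda>x. - (\<Sum>a\<in>UNIV. pd a (\<lambda>y. \<epsilon> a y * fluid_density (jet g \<psi> y)) x)) has_integral
        - (\<Sum>a\<in>(UNIV :: 'd set). 0)) V"
      by (intro has_integral_neg has_integral_sum has_integral_pd_compact_support[OF V _ X(1,2)])
        (auto simp: X(3))
    then have "((\<lambda>x. - (\<Sum>a\<in>UNIV. pd a (\<lambda>y. \<epsilon> a y * fluid_density (jet g \<psi> y)) x)) has_integral 0) V"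
      by simp
    then show "(variation (inv_density ?T) g \<psi> (zeta_tr (metric_sector V) g \<epsilon>) (matter_tr ?T g \<psi> \<epsilon>) has_integral 0) V"
      by (rule has_integral_eq[rotated])
        (simp only: fluid_inv_density fluid_variation[OF f] smooth_param_def X(4) simp_thms)
  qed
  show ?thesis unfolding invariant_theory_def
    by (intro conjI allI impI exI[of _ 1] 1 2 3 4 p) (simp del: card_option)
qed

end


section \<open>Dust in flat space\<close>

lemma quad_delta: "quad (\<lambda>\<mu> \<nu>. if \<mu> = \<nu> then 1 else 0) y z = (\<Sum>\<mu>\<in>UNIV. y \<mu> * z \<mu>)"
  unfolding quad_def by (simp add: if_distrib[of "\<lambda>r. r * _"] cong: if_cong)

lemma quad_unit: "quad h (\<lambda>\<mu>. if \<mu> = m then 1 else 0) (\<lambda>\<mu>. if \<mu> = m then 1 else 0) = h m m"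
  unfolding quad_def
  by (simp add: if_distrib[of "\<lambda>r. r * _"] if_distrib[of "\<lambda>r. _ * r"] cong: if_cong)

lemma jpd_quad:
  assumes "\<And>\<mu> \<nu>. poly_jet (h \<mu> \<nu>)" "\<And>\<mu>. poly_jet (y \<mu>)" "\<And>\<mu>. poly_jet (z \<mu>)"
  shows "jpd v (\<lambda>u. quad (\<lambda>\<mu> \<nu>. h \<mu> \<nu> u) (\<lambda>\<mu>. y \<mu> u) (\<lambda>\<mu>. z \<mu> u)) u =
    quad (\<lambda>\<mu> \<nu>. jpd v (h \<mu> \<nu>) u) (\<lambda>\<mu>. y \<mu> u) (\<lambda>\<mu>. z \<mu> u)
    + quad (\<lambda>\<mu> \<nu>. h \<mu> \<nu> u) (\<lambda>\<mu>. jpd v (y \<mu>) u) (\<lambda>\<mu>. z \<mu> u)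
    + quad (\<lambda>\<mu> \<nu>. h \<mu> \<nu> u) (\<lambda>\<mu>. y \<mu> u) (\<lambda>\<mu>. jpd v (z \<mu>) u)"
  unfolding quad_def
  by (simp add: jpd_sum jpd_mult poly_intros assms sum.distrib algebra_simps)

lemma jpd_fluid_scalar:
  "jpd v fluid_scalar u =
    1 / 2 * (quad (\<lambda>\<mu> \<nu>. if v = Zeta (\<mu>, \<nu>) [] then 1 else 0)
        (\<lambda>\<mu>. u (tensor_var (Some (Some \<mu>)) [])) (\<lambda>\<mu>. u (tensor_var (Some (Some \<mu>)) []))
      + quad (\<lambda>\<mu> \<nu>. u (Zeta (\<mu>, \<nu>) [])) (\<lambda>\<mu>. if v = tensor_var (Some (Some \<mu>)) [] then 1 else 0)
          (\<lambda>\<mu>. u (tensor_var (Some (Some \<mu>)) []))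
      + quad (\<lambda>\<mu> \<nu>. u (Zeta (\<mu>, \<nu>) [])) (\<lambda>\<mu>. u (tensor_var (Some (Some \<mu>)) []))
          (\<lambda>\<mu>. if v = tensor_var (Some (Some \<mu>)) [] then 1 else 0))
    + (\<Sum>\<mu>\<in>UNIV. (if v = tensor_var (Some (Some \<mu>)) [] then 1 else 0) * u (tensor_var None [\<mu>])
      + u (tensor_var (Some (Some \<mu>)) []) * (if v = tensor_var None [\<mu>] then 1 else 0))"
proof -
  let ?q = "\<lambda>u. quad (\<lambda>\<mu> \<nu>. u (Zeta (\<mu>, \<nu>) [])) (\<lambda>\<mu>. u (tensor_var (Some (Some \<mu>)) []))
    (\<lambda>\<mu>. u (tensor_var (Some (Some \<mu>)) []))"
  let ?s = "\<lambda>u. \<Sum>\<mu>\<in>UNIV. u (tensor_var (Some (Some \<mu>)) []) * u (tensor_var None [\<mu>])"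
  have p: "poly_jet ?q" "poly_jet (\<lambda>u. 1 / 2 * ?q u)" "poly_jet ?s" by (intro poly_intros poly_quad)+
  have "jpd v fluid_scalar u = 1 / 2 * jpd v ?q u + jpd v ?s u"
    unfolding fluid_scalar_def[abs_def]
    by (simp only: jpd_add[OF poly_add[OF p(2,3)] poly_const] jpd_add[OF p(2,3)] jpd_cmult[OF p(1)] jpd_const add_0_right)
  also have "jpd v ?s u = (\<Sum>\<mu>\<in>UNIV. (if v = tensor_var (Some (Some \<mu>)) [] then 1 else 0) * u (tensor_var None [\<mu>])
      + u (tensor_var (Some (Some \<mu>)) []) * (if v = tensor_var None [\<mu>] then 1 else 0))"
    by (simp add: jpd_sum jpd_mult jpd_var poly_intros)
  finally show ?thesis by (simp only: jpd_quad poly_var jpd_var)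
qed

definition flat_metric :: "('d \<times> 'd, 'd::finite) zfield" where
  "flat_metric = (\<lambda>(\<mu>, \<nu>) x. if \<mu> = \<nu> then 1 else 0)"

text \<open>Unit velocity along the axis m, with potential \<open>- (x $ m)\<close>, so that the
  velocity is minus the gradient. The equations of velocity and density then hold for every density
  R, and that of the potential asks R to be constant along m.\<close>

definition fluid_fields :: "'d::finite \<Rightarrow> 'd scalar \<Rightarrow> 'd mfield" where
  "fluid_fields m R k = (case unidx k :: 'd tensor_index of None \<Rightarrow> (\<lambda>x. - (x $ m)) | Some None \<Rightarrow> R
     | Some (Some i) \<Rightarrow> (\<lambda>_. if i = m then 1 else 0))"

lemma flat_metric_admissible:
  fixes V :: "(real ^ 'd::finite) set"
  shows "admissible (metric_sector V) flat_metric"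
proof -
  have "metric_matrix flat_metric x = mat 1" for x :: "real ^ 'd"
    by (simp add: metric_matrix_def flat_metric_def mat_def)
  moreover have "smooth_on V (flat_metric z)" for z :: "'d \<times> 'd" by (cases z) (simp add: flat_metric_def)
  ultimately show ?thesis by (simp del: split_paired_All)
qed

lemma fluid_jet:
  fixes m :: "'d::finite" and R :: "'d scalar"
  defines "J \<equiv> jet flat_metric (fluid_fields m R)"
  shows "J x (Zeta (\<mu>, \<nu>) []) = (if \<mu> = \<nu> then 1 else 0)"
    "J x (tensor_var (Some (Some i)) []) = (if i = m then 1 else 0)"
    "J x (tensor_var None [\<mu>]) = - (if \<mu> = m then 1 else 0)"
    "J x (tensor_var (Some None) []) = R x"
proof -
  have d: "(\<lambda>x :: real ^ 'd. x $ m) differentiable at x" by (rule smooth_on_differentiable_UNIV) simp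
  show "J x (Zeta (\<mu>, \<nu>) []) = (if \<mu> = \<nu> then 1 else 0)"
    "J x (tensor_var (Some (Some i)) []) = (if i = m then 1 else 0)"
    "J x (tensor_var None [\<mu>]) = - (if \<mu> = m then 1 else 0)"
    "J x (tensor_var (Some None) []) = R x"
    by (simp_all add: J_def flat_metric_def fluid_fields_def pd_minus[OF d] pd_component)
qed

lemma jpd_fluid_density:
  fixes m :: "'d::finite" and R :: "'d scalar"
  defines "J \<equiv> jet flat_metric (fluid_fields m R)"
  shows "jpd (Zeta (\<mu>, \<nu>) []) fluid_density (J x) = (if \<mu> = m \<and> \<nu> = m then R x / 2 else 0)"
    "jpd (Zeta z [a]) fluid_density (J x) = 0"
    "jpd (tensor_var l []) fluid_density (J x) = 0"
    "jpd (tensor_var l [a]) fluid_density (J x) = (if l = None \<and> a = m then R x else 0)"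
proof -
  \<comment> \<open>The terms are 1/2 - 1 + 1/2. Consequently the equation of the density holds, and
    in the product rule only R times a derivative of \<open>fluid_scalar\<close> survives.\<close>
  have S: "fluid_scalar (J x) = 0"
    unfolding fluid_scalar_def J_def fluid_jet quad_unit
    by (simp add: sum_negf if_distrib[of "\<lambda>r. r * _"] cong: if_cong)
  have j: "jpd v fluid_density (J x) = R x * jpd v fluid_scalar (J x)" for v
    unfolding fluid_density_def[abs_def] jpd_mult[OF poly_var poly_fluid_scalar] S
    by (simp add: J_def fluid_jet del: jet_simps)
  \<comment> \<open>The derivatives with respect to the velocity cancel: the quadratic form
    contributes twice one half, the gradient of the potential -1.\<close>
  have js: "jpd v fluid_scalar (J x) = 1 / 2 * (if v = Zeta (m, m) [] then 1 else 0)
      + (\<Sum>\<mu>\<in>UNIV. if \<mu> = m then if v = tensor_var None [\<mu>] then 1 else 0 else 0)" for v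
  proof -
    have c: "(if v = tensor_var (Some (Some \<mu>)) [] then 1 else 0) * - (if \<mu> = m then 1 else 0)
        + (if \<mu> = m then 1 else 0) * (if v = tensor_var None [\<mu>] then 1 else 0) =
       (if \<mu> = m then - (if v = tensor_var (Some (Some \<mu>)) [] then 1 else 0)
          + (if v = tensor_var None [\<mu>] then 1 else (0 :: real)) else 0)" for \<mu>
      by simp
    have c': "(if v = tensor_var (Some (Some \<mu>)) [] then 1 else 0) * (if \<mu> = m then 1 else 0) =
        (if \<mu> = m then if v = tensor_var (Some (Some \<mu>)) [] then 1 else (0 :: real) else 0)"
      "(if \<mu> = m then 1 else 0) * (if v = tensor_var (Some (Some \<mu>)) [] then 1 else 0) =
        (if \<mu> = m then if v = tensor_var (Some (Some \<mu>)) [] then 1 else (0 :: real) else 0)" for \<mu>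
      by simp_all
    show ?thesis
      unfolding jpd_fluid_scalar J_def fluid_jet quad_unit quad_delta c c'
      by (simp add: if_distrib[of "\<lambda>r. _ * r"] if_distrib[of "\<lambda>r. r * _"] cong: if_cong)
  qed
  show "jpd (Zeta (\<mu>, \<nu>) []) fluid_density (J x) = (if \<mu> = m \<and> \<nu> = m then R x / 2 else 0)"
    "jpd (Zeta z [a]) fluid_density (J x) = 0"
    "jpd (tensor_var l []) fluid_density (J x) = 0"
    "jpd (tensor_var l [a]) fluid_density (J x) = (if l = None \<and> a = m then R x else 0)"
    unfolding j js by auto
qed

lemma fluid_configuration:
  fixes V :: "(real ^ 'd::finite) set" and m :: 'd
  assumes R: "smooth_on UNIV R" and V: "open V"
    and st: "\<And>\<zeta>0. st = Background \<zeta>0 \<Longrightarrow> \<zeta>0 = flat_metric"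
  shows "configuration V (metric_sector V) (fluid_theory st) flat_metric (fluid_fields m R)"
proof -
  have "smooth_on V (fluid_fields m R k)" for k
    unfolding fluid_fields_def using smooth_on_subset[OF R subset_UNIV]
    by (auto split: option.split intro!: smooth_on_minus V)
  moreover have "case st of Background \<zeta>0 \<Rightarrow> flat_metric = \<zeta>0 | _ \<Rightarrow> True"
    using st by (cases st) auto
  ultimately show ?thesis
    unfolding configuration_def fields_def fluid_theory_simps using flat_metric_admissible by blast
qed

lemma fluid_source:
  "source (metric_sector V) (fluid_theory st) flat_metric (fluid_fields m R) (\<mu>, \<nu>) x =
    (if \<mu> = m \<and> \<nu> = m then R x / 2 else 0)"
proof -
  have e: "jpd v fluid_density (insert_invariants st u) = jpd v fluid_density u" for v u
    unfolding fluid_density_def[abs_def] jpd_mult[OF poly_var poly_fluid_scalar] jpd_fluid_scalar jpd_var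
    by (simp add: fluid_scalar_def)
  show ?thesis unfolding source_def metric_sector_simps
    by (simp add: euler_1 e jpd_fluid_density)
qed

lemma fluid_current:
  "current (metric_sector V) (fluid_theory st) flat_metric (fluid_fields m R) \<mu> \<nu> =
    (\<lambda>x. if \<mu> = m \<and> \<nu> = m then - R x else 0)"
proof
  fix x
  have "(\<Sum>\<rho>\<in>UNIV. flat_metric (\<nu>, \<rho>) x * (if \<mu> = m \<and> \<rho> = m then R x / 2 else 0))
      = (\<Sum>\<rho>\<in>UNIV. if \<nu> = \<rho> then if \<mu> = m \<and> \<rho> = m then R x / 2 else 0 else 0)"
    by (intro sum.cong) (auto simp: flat_metric_def)
  then show "current (metric_sector V) (fluid_theory st) flat_metric (fluid_fields m R) \<mu> \<nu> x =
    (if \<mu> = m \<and> \<nu> = m then - R x else 0)"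
    unfolding current_def metric_sector_simps fluid_source by simp
qed

lemma fluid_div_nonzero:
  fixes V :: "(real ^ 'd::finite) set"
  assumes V: "open V" "V \<noteq> {}" and st: "\<And>\<zeta>0. st = Background \<zeta>0 \<Longrightarrow> \<zeta>0 = flat_metric"
  shows "\<not> divergence_identically_zero V (metric_sector V) (fluid_theory st)"
proof
  assume z: "divergence_identically_zero V (metric_sector V) (fluid_theory st)"
  define m :: 'd where "m = undefined"
  obtain x where x: "x \<in> V" using V by blast
  let ?K = "metric_sector V" and ?T = "fluid_theory st"
  \<comment> \<open>A density growing along the flow violates the continuity equation; the current
    has divergence -1.\<close>
  define \<psi> where "\<psi> = fluid_fields m (\<lambda>x. x $ m)"
  have conf: "configuration V ?K ?T flat_metric \<psi>"
    unfolding \<psi>_def by (rule fluid_configuration[OF _ V(1) st]) simp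
  have S: "source ?K ?T flat_metric \<psi> (\<mu>, \<nu>) x = source ?K ?T flat_metric \<psi> (\<nu>, \<mu>) x" for \<mu> \<nu>
    unfolding \<psi>_def fluid_source by auto
  have d: "(\<lambda>x :: real ^ 'd. x $ m) differentiable at x" by (rule smooth_on_differentiable_UNIV) simp
  have c: "pd \<nu> (flat_metric (\<mu>, \<sigma>)) x = 0" for \<mu> \<nu> \<sigma> by (simp add: flat_metric_def)
  have "covdiv ?K flat_metric (current ?K ?T flat_metric \<psi>) m x
    = (\<Sum>\<mu>\<in>UNIV. pd \<mu> (current ?K ?T flat_metric \<psi> \<mu> m) x)"
    unfolding current_def
    using metric_covdiv[where S = "source ?K ?T flat_metric \<psi>", OF V(1) flat_metric_admissible x S, of m]
    by (simp add: c)
  also have "\<dots> = (\<Sum>\<mu>\<in>UNIV. if \<mu> = m then - 1 else 0)"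
    unfolding \<psi>_def fluid_current by (intro sum.cong refl) (auto simp: pd_minus[OF d] pd_component)
  finally show False using z conf x unfolding divergence_identically_zero_def by auto
qed

text \<open>For density 1 the source has the single component 1/2 at \<open>(m, m)\<close>, and the
  coefficient -1/2 of \<open>Lg\<close> cancels it in the equation of the metric, leaving the
  current at -1.\<close>

lemma fluid_current_nonzero:
  fixes V :: "(real ^ 'd::finite) set" and m :: 'd
  defines "Lg \<equiv> (\<lambda>u. - 1 / 2 * u (Zeta (m, m) []))"
  assumes V: "open V" "V \<noteq> {}" and st: "st = Background flat_metric \<or> st = Extra Lg"
  shows "\<not> current_zero_on_shell V (metric_sector V) (fluid_theory st)"
proof -
  let ?K = "metric_sector V" and ?T = "fluid_theory st"
  define \<psi> where "\<psi> = fluid_fields m (\<lambda>_. 1)"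
  have conf: "configuration V ?K ?T flat_metric \<psi>"
    unfolding \<psi>_def by (rule fluid_configuration[OF _ V(1)]) (use st in auto)
  define L where "L = (if is_Background st then (\<lambda>_. 0) else Lg)"
  have L: "total_density ?T = (\<lambda>u. fluid_density u + L u)"
    using st unfolding total_density_def fluid_inv_density
    by (auto simp: L_def fun_eq_iff)
  have "poly_jet Lg" unfolding Lg_def by (intro poly_intros)
  then have pL: "poly_jet L" by (simp add: L_def poly_const)
  have jL: "jpd v L u = (if is_Background st then 0 else - 1 / 2 * (if v = Zeta (m, m) [] then 1 else 0))" for v u
  proof -
    have "jpd v Lg u = - 1 / 2 * (if v = Zeta (m, m) [] then 1 else 0)"
      unfolding Lg_def jpd_cmult[OF poly_var] jpd_var ..
    then show ?thesis by (simp add: L_def)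
  qed
  have jt: "jpd v (total_density ?T) u = jpd v fluid_density u + jpd v L u" for v u
    unfolding L by (simp add: jpd_add poly_fluid_density pL)
  have "on_shell V ?K ?T flat_metric \<psi>"
    unfolding on_shell_def
  proof (intro conjI impI allI ballI)
    fix k x assume "k < matter ?T"
    then obtain l :: "'d tensor_index" where k: "k = idx l"
      unfolding fluid_theory_simps by (metis idx_unidx)
    show "euler (deriv_order ?T) (total_density ?T) (Psi k) (jet flat_metric \<psi>) x = 0"
      unfolding k \<psi>_def by (simp add: euler_1 jt jL jpd_fluid_density)
  next
    fix z :: "'d \<times> 'd" and x assume b: "\<not> is_Background (setting ?T)"
    obtain \<mu> \<nu> where z: "z = (\<mu>, \<nu>)" by (cases z)
    show "zeta_euler ?K (deriv_order ?T) (total_density ?T) (jet flat_metric \<psi>) z x = 0"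
      unfolding z \<psi>_def metric_sector_simps using b by (auto simp: euler_1 jt jL jpd_fluid_density)
  qed
  moreover obtain x where "x \<in> V" using V by blast
  moreover have "current ?K ?T flat_metric \<psi> m m x \<noteq> 0" unfolding \<psi>_def fluid_current by simp
  ultimately show ?thesis using conf unfolding current_zero_on_shell_def by blast
qed

lemma metric_examples:
  fixes V :: "(real ^ 'd::finite) set"
  assumes V: "open V" "V \<noteq> {}"
  shows "\<exists>T. is_Background (setting T) \<and>
      invariant_theory V (metric_sector V) T \<and> represents_algebra V (metric_sector V) T \<and>
      \<not> divergence_identically_zero V (metric_sector V) T \<and>
      \<not> current_zero_on_shell V (metric_sector V) T"
    "\<exists>T. is_Extra (setting T) \<and>
      invariant_theory V (metric_sector V) T \<and> represents_algebra V (metric_sector V) T \<and>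
      \<not> divergence_identically_zero V (metric_sector V) T \<and>
      \<not> current_zero_on_shell V (metric_sector V) T"
    "\<exists>T. is_Invariants (setting T) \<and>
      invariant_theory V (metric_sector V) T \<and> represents_algebra V (metric_sector V) T \<and>
      \<not> divergence_identically_zero V (metric_sector V) T"
proof -
  define Lg :: "('d \<times> 'd, 'd) jet \<Rightarrow> real" where "Lg = (\<lambda>u. - 1 / 2 * u (Zeta (undefined, undefined) []))"
  let ?K = "metric_sector V"
  have "proper_setting V ?K (fluid_theory (Background flat_metric))"
    unfolding proper_setting_def fluid_theory_simps setting.case by (rule flat_metric_admissible)
  then show "\<exists>T. is_Background (setting T) \<and> invariant_theory V ?K T \<and> represents_algebra V ?K T \<and>
      \<not> divergence_identically_zero V ?K T \<and> \<not> current_zero_on_shell V ?K T"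
    by (intro exI[of _ "fluid_theory (Background flat_metric)"] conjI fluid_invariant_theory[OF V(1)]
        fluid_represents_algebra[OF V(1)] fluid_div_nonzero[OF V] fluid_current_nonzero[OF V]) auto
  have "depends_only_on (jvars 0 0 1) Lg"
    unfolding depends_only_on_def Lg_def by (auto simp: jvars_def)
  moreover have "poly_jet Lg" unfolding Lg_def by (intro poly_intros)
  ultimately have "proper_setting V ?K (fluid_theory (Extra Lg))"
    by (simp add: proper_setting_def local_function_def poly_smooth)
  then show "\<exists>T. is_Extra (setting T) \<and> invariant_theory V ?K T \<and> represents_algebra V ?K T \<and>
      \<not> divergence_identically_zero V ?K T \<and> \<not> current_zero_on_shell V ?K T"
    by (intro exI[of _ "fluid_theory (Extra Lg)"] conjI fluid_invariant_theory[OF V(1)]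
        fluid_represents_algebra[OF V(1)] fluid_div_nonzero[OF V] fluid_current_nonzero[OF V, of _ undefined])
      (auto simp: Lg_def)
  \<comment> \<open>With an empty list of invariants the total density is \<open>L_inv\<close>. The
    equation of the metric then makes the current vanish on-shell, so only the divergence is claimed
    to be nontrivial.\<close>
  have "proper_setting V ?K (fluid_theory (Invariants 0 (\<lambda>_ _. 0)))"
    by (simp add: proper_setting_def)
  then show "\<exists>T. is_Invariants (setting T) \<and> invariant_theory V ?K T \<and> represents_algebra V ?K T \<and>
      \<not> divergence_identically_zero V ?K T"
    by (intro exI[of _ "fluid_theory (Invariants 0 (\<lambda>_ _. 0))"] conjI fluid_invariant_theory[OF V(1)]
        fluid_represents_algebra[OF V(1)] fluid_div_nonzero[OF V]) auto
qed

theorem theorem3: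
  fixes V :: "(real ^ 'd::finite) set"
    and C :: "'a::finite \<Rightarrow> 'a \<Rightarrow> 'a \<Rightarrow> real"
    and g\<^sub>Y\<^sub>M :: real
  assumes "open V" and "V \<noteq> {}" and "structure_constants C"
  shows
    "(\<forall>T. invariant_theory V (gauge_sector V C g\<^sub>Y\<^sub>M) T \<longrightarrow>
        conserved_on_shell V (gauge_sector V C g\<^sub>Y\<^sub>M) T \<and>
        (\<not> invariant_under_matter_alone V (gauge_sector V C g\<^sub>Y\<^sub>M) T \<longrightarrow>
          \<not> divergence_identically_zero V (gauge_sector V C g\<^sub>Y\<^sub>M) T) \<and>
        (extra_terms_contribute V (gauge_sector V C g\<^sub>Y\<^sub>M) T \<longrightarrow>
          \<not> current_zero_on_shell V (gauge_sector V C g\<^sub>Y\<^sub>M) T))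
   \<and> (\<forall>T. invariant_theory V (metric_sector V) T \<longrightarrow>
        conserved_on_shell V (metric_sector V) T \<and>
        (\<not> invariant_under_matter_alone V (metric_sector V) T \<longrightarrow>
          \<not> divergence_identically_zero V (metric_sector V) T) \<and>
        (extra_terms_contribute V (metric_sector V) T \<longrightarrow>
          \<not> current_zero_on_shell V (metric_sector V) T))
   \<and> (\<exists>T. is_Background (setting T) \<and>
        invariant_theory V (gauge_sector V C g\<^sub>Y\<^sub>M) T \<and> represents_algebra V (gauge_sector V C g\<^sub>Y\<^sub>M) T \<and>
        \<not> divergence_identically_zero V (gauge_sector V C g\<^sub>Y\<^sub>M) T \<and>
        \<not> current_zero_on_shell V (gauge_sector V C g\<^sub>Y\<^sub>M) T)
   \<and> (\<exists>T. is_Extra (setting T) \<and>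
        invariant_theory V (gauge_sector V C g\<^sub>Y\<^sub>M) T \<and> represents_algebra V (gauge_sector V C g\<^sub>Y\<^sub>M) T \<and>
        \<not> divergence_identically_zero V (gauge_sector V C g\<^sub>Y\<^sub>M) T \<and>
        \<not> current_zero_on_shell V (gauge_sector V C g\<^sub>Y\<^sub>M) T)
   \<and> (\<exists>T. is_Invariants (setting T) \<and>
        invariant_theory V (gauge_sector V C g\<^sub>Y\<^sub>M) T \<and> represents_algebra V (gauge_sector V C g\<^sub>Y\<^sub>M) T \<and>
        \<not> divergence_identically_zero V (gauge_sector V C g\<^sub>Y\<^sub>M) T \<and>
        (2 \<le> CARD('d) \<longrightarrow> \<not> current_zero_on_shell V (gauge_sector V C g\<^sub>Y\<^sub>M) T))
   \<and> (\<exists>T. is_Background (setting T) \<and>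
        invariant_theory V (metric_sector V) T \<and> represents_algebra V (metric_sector V) T \<and>
        \<not> divergence_identically_zero V (metric_sector V) T \<and>
        \<not> current_zero_on_shell V (metric_sector V) T)
   \<and> (\<exists>T. is_Extra (setting T) \<and>
        invariant_theory V (metric_sector V) T \<and> represents_algebra V (metric_sector V) T \<and>
        \<not> divergence_identically_zero V (metric_sector V) T \<and>
        \<not> current_zero_on_shell V (metric_sector V) T)
   \<and> (\<exists>T. is_Invariants (setting T) \<and>
        invariant_theory V (metric_sector V) T \<and> represents_algebra V (metric_sector V) T \<and>
        \<not> divergence_identically_zero V (metric_sector V) T)"
proof -
  note V = assms(1,2) and C = assms(3)
  interpret gauge: sector_laws V "gauge_sector V C g\<^sub>Y\<^sub>M"
    by (rule gauge_sector_laws[OF assms(1) C])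
  interpret metric: sector_laws V "metric_sector V"
    by (rule metric_sector_laws[OF assms(1)])
  show ?thesis
    by (intro conjI allI impI gauge.conserved gauge.not_divergence_identically_zero
        gauge.not_current_zero_on_shell metric.conserved metric.not_divergence_identically_zero
        metric.not_current_zero_on_shell gauge_Background_Extra[OF V C] gauge_Invariants[OF V C]
        metric_examples[OF V])
qed

end
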